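(* (Stochastic Fubini theorem.) Let $\Phi$ be a locally convex space, let $M$ be a nuclear cylindrical martingale-valued measure in $\Phi'$ on $\mathbb{R}_+\times\mathcal{R}$ with associated $\mu$, $\lambda$ and $\{q_{r,u}\}$, let $T>0$, let $(E,\mathcal{E},\varrho)$ be a $\sigma$-finite measure space, and let $X\in\Xi^{1,2}_w(T,E)$. Then: (1) For a.e. $(r,\omega,u)\in[0,T]\times\Omega\times U$, the mapping $E\ni e\mapsto X(r,\omega,u,e)\in\Phi_{q_{r,u}}$ is Bochner integrable. Moreover, $$\int_E X(\cdot,\cdot,\cdot,e)\,\varrho(de)=\left\{\int_E X(r,\omega,u,e)\,\varrho(de): r\in[0,T],\omega\in\Omega,u\in U\right\}\in\Lambda^2_w(T).$$ (2) The mapping $E\ni e\mapsto I^w(X(\cdot,\cdot,\cdot,e))\in\mathcal{M}^2_T(\mathbb{R})$ is Bochner integrable. Furthermore, $$\left(\int_E I^w(X(\cdot,\cdot,\cdot,e))\,\varrho(de)\right)_t=\int_E I^w_t(X(\cdot,\cdot,\cdot,e))\,\varrho(de),\qquad\forall\,t\in[0,T].$$ (3) The following equality holds $\mathbb{P}$-a.e.: $$I^w_t\left(\int_E X(\cdot,\cdot,\cdot,e)\,\varrho(de)\right)=\int_E I^w_t(X(\cdot,\cdot,\cdot,e))\,\varrho(de),\qquad\forall\,t\in[0,T].$$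
   Context: Notation. All vector spaces are real. $(\Omega,\mathscr{F},\mathbb{P})$ is a complete probability space with a filtration $\{\mathcal{F}_t\}_{t\ge0}$ satisfying the usual conditions; $\mathcal{P}_T$ is the predictable $\sigma$-algebra on $[0,T]\times\Omega$. A continuous semi-norm $p$ on a locally convex space $\Phi$ is Hilbertian if $p(\phi)^2=p(\phi,\phi)$ for a symmetric non-negative bilinear form $p(\cdot,\cdot)$; $\Phi_p$ is the Hilbert space completion of $\Phi/\ker p$ (with $p$ and $p(\cdot,\cdot)$ extended to it) and $i_p:\Phi\to\Phi_p$ is the canonical map. A cylindrical random variable in $\Phi'$ is a linear map $\Phi\to L^0(\Omega,\mathscr{F},\mathbb{P})$. $\int_s^t$ means integration over $(s,t]$. Nuclear cylindrical martingale-valued measure. $U$ is a topological space, $\mathcal{R}\subseteq\mathcal{B}(U)$ a ring generating $\mathcal{B}(U)$, and $M=(M(t,A):t\ge0,A\in\mathcal{R})$ is a family of cylindrical random variables in $\Phi'$ such that: (1) $M(0,A)(\phi)=0$ a.s.; (2) $M(t,\emptyset)(\phi)=0$ a.s. and $M(t,A\cup B)(\phi)=M(t,A)(\phi)+M(t,B)(\phi)$ a.s. for disjoint $A,B\in\mathcal{R}$; (3) for all $A\in\mathcal{R}$, $\phi\in\Phi$, $(M(t,A)(\phi))_{t\ge0}$ is an $\{\mathcal{F}_t\}$-adapted zero-mean square integrable c\`adl\`ag martingale; (4) $\mathbb{E}(M(t,A)(\phi)M(s,B)(\varphi))=0$ for disjoint $A,B\in\mathcal{R}$, all $s,t\ge0$,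 $\phi,\varphi\in\Phi$; (5) for $0\le s<t$, $M((s,t],A)(\phi):=(M(t,A)-M(s,A))(\phi)$ is independent of $\mathcal{F}_s$ for all $A\in\mathcal{R}$, $\phi\in\Phi$; (6) $\mathbb{E}(|M((s,t],A)(\phi)|^2)=\int_s^t\int_A q_{r,u}(\phi)^2\mu(du)\lambda(dr)$ for all $0\le s<t$, $A\in\mathcal{R}$, $\phi\in\Phi$, where $\mu$ is a $\sigma$-finite measure on $(U,\mathcal{B}(U))$ finite on $\mathcal{R}$, $\lambda$ is a $\sigma$-finite Borel measure on $\mathbb{R}_+$ finite on bounded intervals, and $\{q_{r,u}:r\in\mathbb{R}_+,u\in U\}$ are continuous Hilbertian semi-norms on $\Phi$ such that $(r,u)\mapsto q_{r,u}(\phi,\varphi)$ is Borel measurable and bounded on $[0,T]\times U$ for all $T>0$, $\phi,\varphi\in\Phi$. Standing assumption: for each $T>0$ there is a countable $D\subseteq\Phi$ that is dense in $\Phi_{q_{r,u}}$ for every $r\in[0,T]$, $u\in U$. Integrands. $\Lambda^2_w(T)$ is the Hilbert space of (classes of) families $X=\{X(r,\omega,u)\}$ with $X(r,\omega,u)\in\Phi_{q_{r,u}}$, with $(r,\omega,u)\mapsto q_{r,u}(X(r,\omega,u),\phi)$ $\mathcal{P}_T\otimes\mathcal{B}(U)$-measurable for each $\phi\in\Phi$, and $\|X\|_{w,T}^2:=\mathbb{E}\int_0^T\int_U q_{r,u}(X(r,u))^2\mu(du)\lambda(dr)<\infty$. $\Xi^{1,2}_w(T,E)$ is the space of (classes of)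 families $X=\{X(r,\omega,u,e):r\in[0,T],\omega\in\Omega,u\in U,e\in E\}$ with $X(r,\omega,u,e)\in\Phi_{q_{r,u}}$, with $(r,\omega,u,e)\mapsto q_{r,u}(X(r,\omega,u,e),\phi)$ $\mathcal{P}_T\otimes\mathcal{B}(U)\otimes\mathcal{E}$-measurable for every $\phi\in\Phi$, and $\int_E\|X(\cdot,\cdot,\cdot,e)\|_{w,T}\,\varrho(de)<\infty$. Weak integral. $\mathcal{S}_w(T)\subseteq\Lambda_w^2(T)$ is the dense subspace of families $X(r,\omega,u)=\sum_{i=1}^n\sum_{j=1}^m \mathbf{1}_{]s_j,t_j]}(r)\mathbf{1}_{F_j}(\omega)\mathbf{1}_{A_i}(u)\,i_{q_{r,u}}\phi_{i,j}$ with $0\le s_j<t_j\le T$, $F_j\in\mathcal{F}_{s_j}$, $A_i\in\mathcal{R}$, $\phi_{i,j}\in\Phi$, which may be written so that for $k\ne j$ intersecting intervals $]s_k,t_k]$, $]s_j,t_j]$ are equal with $F_k\cap F_j=\emptyset$; for such $X$, $I^w_T(X)=\sum_{i,j}\mathbf{1}_{F_j}M((s_j,t_j],A_i)(\phi_{i,j})$. This extends to a linear isometry $I^w_T:\Lambda^2_w(T)\to L^2(\Omega,\mathscr{F},\mathbb{P})$; $I^w_t(X):=I^w_T(\mathbf{1}_{[0,t]}X)$, and $I^w(X)=\{I^w_t(X)\}_{t\in[0,T]}$ (c\`adl\`ag version) is an element of $\mathcal{M}^2_T(\mathbb{R})$, the Banach space of $\{\mathcal{F}_t\}$-adapted zero-mean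 square integrable c\`adl\`ag martingales on $[0,T]$ with norm $(\mathbb{E}\sup_{t\in[0,T]}|M_t|^2)^{1/2}$. *)

theory Defs
  imports "HOL-Probability.Probability" "HOL-Library.Function_Algebras"
begin

section \<open>Locally convex spaces and Hilbertian semi-norms\<close>

text \<open>No separation axiom is imposed.\<close>

class locally_convex_space = real_vector + topological_ab_group_add +
  assumes tendsto_scaleR_nhds:
    "filterlim (\<lambda>(c, x). scaleR c x) (nhds (scaleR a x)) (nhds (a::real) \<times>\<^sub>F nhds x)"
  and convex_nhds_zero:
    "open S \<Longrightarrow> 0 \<in> S \<Longrightarrow>
      \<exists>C. open C \<and> 0 \<in> C \<and> C \<subseteq> S \<and>
        (\<forall>x\<in>C. \<forall>y\<in>C. \<forall>u v. 0 \<le> u \<longrightarrow> 0 \<le> v \<longrightarrow> u + v = 1 \<longrightarrow> scaleR u x + scaleR v y \<in> C)"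

definition seminorm :: "('f::real_vector \<Rightarrow> real) \<Rightarrow> bool" where
  "seminorm p \<longleftrightarrow>
     (\<forall>x. 0 \<le> p x) \<and> (\<forall>x y. p (x + y) \<le> p x + p y) \<and> (\<forall>c x. p (c *\<^sub>R x) = \<bar>c\<bar> * p x)"

definition form_of_seminorm :: "('f::real_vector \<Rightarrow> real) \<Rightarrow> ('f \<Rightarrow> 'f \<Rightarrow> real) \<Rightarrow> bool" where
  "form_of_seminorm p b \<longleftrightarrow>
     bilinear b \<and> (\<forall>x y. b x y = b y x) \<and> (\<forall>x. 0 \<le> b x x) \<and> (\<forall>x. (p x)\<^sup>2 = b x x)"

definition hilbertian_seminorm :: "('f::real_vector \<Rightarrow> real) \<Rightarrow> bool" where
  "hilbertian_seminorm p \<longleftrightarrow> seminorm p \<and> (\<exists>b. form_of_seminorm p b)"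

text \<open>The form is unique by polarization.\<close>

definition hform :: "('f::real_vector \<Rightarrow> real) \<Rightarrow> 'f \<Rightarrow> 'f \<Rightarrow> real" where
  "hform p = (THE b. form_of_seminorm p b)"

text \<open>
  The Hilbert space completion of the quotient of \<open>'f\<close> by \<open>ker p\<close> is, up to isometric isomorphism,
  a complete inner product space with a linear map \<open>j\<close> from \<open>'f\<close> that satisfies
  \<open>norm (j x) = p x\<close> (so that \<open>j\<close> factors isometrically through the quotient) and has dense range.
  It is realised here as the closed subspace \<open>completion_space j\<close> of an ambient Hilbert space \<open>'h\<close>,
  so that completions for different semi-norms can live in one type. The
  extensions of \<open>p\<close> and of its form are the norm and the inner product of \<open>'h\<close>. Statements are
  meant to quantify over all \<open>'h\<close> and all \<open>j\<close>. Requiring \<open>'h\<close> to be separable is no restriction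
  when the completions involved are separable, since each of them then embeds isometrically
  into the sequence space of square summable reals.
\<close>

definition hilbert_completion ::
  "('f::real_vector \<Rightarrow> real) \<Rightarrow> ('f \<Rightarrow> 'h::{real_inner, banach}) \<Rightarrow> bool" where
  "hilbert_completion p j \<longleftrightarrow> linear j \<and> (\<forall>x. norm (j x) = p x)"

definition completion_space :: "('f \<Rightarrow> 'h::{real_inner, banach}) \<Rightarrow> 'h set" where
  "completion_space j = closure (range j)"


section \<open>Bochner integral in a semi-normed space of functions\<close>

text \<open>Pointwise scalar multiplication; the additive structure comes from
  \<^theory>\<open>HOL-Library.Function_Algebras\<close>.\<close>

instantiation "fun" :: (type, real_vector) real_vector
begin

definition scaleR_fun :: "real \<Rightarrow> ('a \<Rightarrow> 'b) \<Rightarrow> 'a \<Rightarrow> 'b" where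
  "scaleR_fun c f = (\<lambda>x. c *\<^sub>R f x)"

instance
  by standard (simp_all add: scaleR_fun_def fun_eq_iff plus_fun_def algebra_simps)

end

text \<open>
  \<open>V\<close> is the set of representatives of the elements of a Banach space with norm \<open>N\<close>:
  two members \<open>x\<close>, \<open>y\<close> of \<open>V\<close> represent the same element if \<open>N (x - y) = 0\<close>. The library integral is
  not applicable since the spaces concerned are neither separable nor types. The map \<open>f\<close> only has to
  take values in \<open>V\<close> almost everywhere. The third clause of the existential is strong measurability
  of \<open>f\<close>; it also makes the functions integrated in the fourth one measurable up to null sets.
\<close>

definition has_bochner_integral_in ::
  "'v::real_vector set \<Rightarrow> ('v \<Rightarrow> ennreal) \<Rightarrow> 'e measure \<Rightarrow> ('e \<Rightarrow> 'v) \<Rightarrow> 'v \<Rightarrow> bool" where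
  "has_bochner_integral_in V N R f y \<longleftrightarrow>
     (AE e in R. f e \<in> V) \<and> y \<in> V \<and>
     (\<exists>s :: nat \<Rightarrow> 'e \<Rightarrow> 'v.
        (\<forall>n. Bochner_Integration.simple_bochner_integrable R (s n) \<and> s n ` space R \<subseteq> V) \<and>
        (AE e in R. (\<lambda>n. N (f e - s n e)) \<longlonglongrightarrow> 0) \<and>
        (\<lambda>n. \<integral>\<^sup>+e. N (f e - s n e) \<partial>R) \<longlonglongrightarrow> 0 \<and>
        (\<lambda>n. N (Bochner_Integration.simple_bochner_integral R (s n) - y)) \<longlonglongrightarrow> 0)"

definition bochner_integrable_in ::
  "'v::real_vector set \<Rightarrow> ('v \<Rightarrow> ennreal) \<Rightarrow> 'e measure \<Rightarrow> ('e \<Rightarrow> 'v) \<Rightarrow> bool" where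
  "bochner_integrable_in V N R f \<longleftrightarrow> (\<exists>y. has_bochner_integral_in V N R f y)"

definition ennsqrt :: "ennreal \<Rightarrow> ennreal" where
  "ennsqrt x = (if x = \<top> then \<top> else ennreal (sqrt (enn2real x)))"

definition L2_space :: "'w measure \<Rightarrow> ('w \<Rightarrow> real) set" where
  "L2_space P = {Y \<in> borel_measurable P. integrable P (\<lambda>\<omega>. (Y \<omega>)\<^sup>2)}"

definition L2_enorm :: "'w measure \<Rightarrow> ('w \<Rightarrow> real) \<Rightarrow> ennreal" where
  "L2_enorm P Y = ennsqrt (\<integral>\<^sup>+\<omega>. ennreal ((Y \<omega>)\<^sup>2) \<partial>P)"


section \<open>Martingales\<close>

text \<open>Only the \<open>\<sigma>\<close>-algebras of the measures \<open>F t\<close>, \<open>t \<ge> 0\<close>, matter.\<close>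

locale stochastic_basis = prob_space P + complete_measure P
  for P :: "'w measure" +
  fixes F :: "real \<Rightarrow> 'w measure"
  assumes subalgebra_F: "0 \<le> t \<Longrightarrow> subalgebra P (F t)"
    and F_mono: "0 \<le> s \<Longrightarrow> s \<le> t \<Longrightarrow> sets (F s) \<subseteq> sets (F t)"
    and F_right_continuous: "0 \<le> t \<Longrightarrow> sets (F t) = (\<Inter>s\<in>{t<..}. sets (F s))"
    and F_complete: "null_sets P \<subseteq> sets (F 0)"

definition martingale_on ::
  "'w measure \<Rightarrow> (real \<Rightarrow> 'w measure) \<Rightarrow> real set \<Rightarrow> (real \<Rightarrow> 'w \<Rightarrow> real) \<Rightarrow> bool" where
  "martingale_on P F S Y \<longleftrightarrow>
     (\<forall>t\<in>S. Y t \<in> borel_measurable (F t) \<and> integrable P (Y t)) \<and>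
     (\<forall>s\<in>S. \<forall>t\<in>S. s \<le> t \<longrightarrow> (AE \<omega> in P. real_cond_exp P (F s) (Y t) \<omega> = Y s \<omega>))"

definition zero_mean_L2_martingale_on ::
  "'w measure \<Rightarrow> (real \<Rightarrow> 'w measure) \<Rightarrow> real set \<Rightarrow> (real \<Rightarrow> 'w \<Rightarrow> real) \<Rightarrow> bool" where
  "zero_mean_L2_martingale_on P F S Y \<longleftrightarrow>
     martingale_on P F S Y \<and>
     (\<forall>t\<in>S. integrable P (\<lambda>\<omega>. (Y t \<omega>)\<^sup>2) \<and> (\<integral>\<omega>. Y t \<omega> \<partial>P) = 0)"

definition cadlag_on :: "real set \<Rightarrow> (real \<Rightarrow> real) \<Rightarrow> bool" where
  "cadlag_on S f \<longleftrightarrow>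
     (\<forall>t\<in>S. (f \<longlongrightarrow> f t) (at t within S \<inter> {t<..}) \<and>
            (\<exists>l. (f \<longlongrightarrow> l) (at t within S \<inter> {..<t})))"

text \<open>Processes in \<open>M2_space\<close> are representatives up to indistinguishability; their values at
  times outside \<open>[0,T]\<close> are irrelevant.\<close>

definition M2_space ::
  "'w measure \<Rightarrow> (real \<Rightarrow> 'w measure) \<Rightarrow> real \<Rightarrow> (real \<Rightarrow> 'w \<Rightarrow> real) set" where
  "M2_space P F T =
     {Y. zero_mean_L2_martingale_on P F {0..T} Y \<and>
         (\<forall>\<omega>\<in>space P. cadlag_on {0..T} (\<lambda>t. Y t \<omega>))}"

definition M2_enorm :: "'w measure \<Rightarrow> real \<Rightarrow> (real \<Rightarrow> 'w \<Rightarrow> real) \<Rightarrow> ennreal" where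
  "M2_enorm P T Y = ennsqrt (\<integral>\<^sup>+\<omega>. (SUP t\<in>{0..T}. ennreal ((Y t \<omega>)\<^sup>2)) \<partial>P)"


section \<open>Nuclear cylindrical martingale-valued measures\<close>

definition cylindrical_rv :: "'w measure \<Rightarrow> ('f::real_vector \<Rightarrow> 'w \<Rightarrow> real) \<Rightarrow> bool" where
  "cylindrical_rv P Z \<longleftrightarrow>
     (\<forall>\<phi>. Z \<phi> \<in> borel_measurable P) \<and>
     (\<forall>\<phi> \<psi>. AE \<omega> in P. Z (\<phi> + \<psi>) \<omega> = Z \<phi> \<omega> + Z \<psi> \<omega>) \<and>
     (\<forall>c \<phi>. AE \<omega> in P. Z (c *\<^sub>R \<phi>) \<omega> = c * Z \<phi> \<omega>)"

text \<open>
  \<open>M t A \<phi>\<close> is a representative of a class in \<open>L\<^sup>0\<close>, whence the almost sure path regularity.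
  \<open>\<Lambda>\<close> is a measure on the half line \<open>{0..}\<close>. The Borel \<open>\<sigma>\<close>-algebra of the product of \<open>{0..}\<close> with any
  topological space is the product \<open>\<sigma>\<close>-algebra since \<open>{0..}\<close> is second countable.
\<close>

locale nuclear_cylindrical_mvm = stochastic_basis P F
  for P :: "'w measure" and F :: "real \<Rightarrow> 'w measure" +
  fixes \<R> :: "'u::topological_space set set"
    and M :: "real \<Rightarrow> 'u set \<Rightarrow> 'f::locally_convex_space \<Rightarrow> 'w \<Rightarrow> real"
    and \<mu> :: "'u measure" and \<Lambda> :: "real measure"
    and q :: "real \<Rightarrow> 'u \<Rightarrow> 'f \<Rightarrow> real"
  assumes ring_R: "ring_of_sets UNIV \<R>"
    and generates_R: "sigma_sets UNIV \<R> = sets borel"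
    and cylindrical: "0 \<le> t \<Longrightarrow> A \<in> \<R> \<Longrightarrow> cylindrical_rv P (M t A)"
    and M_zero: "A \<in> \<R> \<Longrightarrow> AE \<omega> in P. M 0 A \<phi> \<omega> = 0"
    and M_empty: "0 \<le> t \<Longrightarrow> AE \<omega> in P. M t {} \<phi> \<omega> = 0"
    and M_additive: "0 \<le> t \<Longrightarrow> A \<in> \<R> \<Longrightarrow> B \<in> \<R> \<Longrightarrow> A \<inter> B = {} \<Longrightarrow>
          AE \<omega> in P. M t (A \<union> B) \<phi> \<omega> = M t A \<phi> \<omega> + M t B \<phi> \<omega>"
    and M_martingale: "A \<in> \<R> \<Longrightarrow> zero_mean_L2_martingale_on P F {0..} (\<lambda>t. M t A \<phi>)"
    and M_cadlag: "A \<in> \<R> \<Longrightarrow> AE \<omega> in P. cadlag_on {0..} (\<lambda>t. M t A \<phi> \<omega>)"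
    and M_orthogonal: "A \<in> \<R> \<Longrightarrow> B \<in> \<R> \<Longrightarrow> A \<inter> B = {} \<Longrightarrow> 0 \<le> s \<Longrightarrow> 0 \<le> t \<Longrightarrow>
          (\<integral>\<omega>. M t A \<phi> \<omega> * M s B \<psi> \<omega> \<partial>P) = 0"
    and M_independent: "0 \<le> s \<Longrightarrow> s < t \<Longrightarrow> A \<in> \<R> \<Longrightarrow>
          indep_set {(\<lambda>\<omega>. M t A \<phi> \<omega> - M s A \<phi> \<omega>) -` B \<inter> space P | B. B \<in> sets borel} (sets (F s))"
    and M_covariance: "0 \<le> s \<Longrightarrow> s < t \<Longrightarrow> A \<in> \<R> \<Longrightarrow>
          (\<integral>\<^sup>+\<omega>. ennreal ((M t A \<phi> \<omega> - M s A \<phi> \<omega>)\<^sup>2) \<partial>P) =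
          (\<integral>\<^sup>+r\<in>{s<..t}. (\<integral>\<^sup>+u\<in>A. ennreal ((q r u \<phi>)\<^sup>2) \<partial>\<mu>) \<partial>\<Lambda>)"
    and sets_mu: "sets \<mu> = sets borel"
    and sigma_finite_mu: "sigma_finite_measure \<mu>"
    and finite_mu: "A \<in> \<R> \<Longrightarrow> emeasure \<mu> A < \<infinity>"
    and sets_Lambda: "sets \<Lambda> = sets (restrict_space borel {0..})"
    and sigma_finite_Lambda: "sigma_finite_measure \<Lambda>"
    and finite_Lambda: "0 \<le> a \<Longrightarrow> emeasure \<Lambda> {a..b} < \<infinity>"
    and q_hilbertian: "0 \<le> r \<Longrightarrow> hilbertian_seminorm (q r u)"
    and q_continuous: "0 \<le> r \<Longrightarrow> continuous_on UNIV (q r u)"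
    and q_measurable:
          "(\<lambda>(r, u). hform (q r u) \<phi> \<psi>) \<in> borel_measurable (restrict_space borel {0..} \<Otimes>\<^sub>M borel)"
    and q_bounded: "0 < T \<Longrightarrow> \<exists>C. \<forall>r\<in>{0..T}. \<forall>u. \<bar>hform (q r u) \<phi> \<psi>\<bar> \<le> C"


section \<open>Integrands\<close>

text \<open>Below, \<open>\<iota> r u\<close> is the canonical map of \<open>'f\<close> into its completion with respect to the
  semi-norm \<open>q r u\<close>; see \<^const>\<open>hilbert_completion\<close>.\<close>

definition predictable_algebra :: "'w measure \<Rightarrow> (real \<Rightarrow> 'w measure) \<Rightarrow> real \<Rightarrow> (real \<times> 'w) measure" where
  "predictable_algebra P F T =
     sigma ({0..T} \<times> space P)
       ({{s<..t} \<times> A | s t A. 0 \<le> s \<and> s \<le> t \<and> t \<le> T \<and> A \<in> sets (F s)} \<union>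
        {{0} \<times> A | A. A \<in> sets (F 0)})"

text \<open>The time integral runs over \<open>(0,T]\<close>, so a possible atom of \<open>\<Lambda>\<close> at \<open>0\<close> plays no role.\<close>

definition w_enorm ::
  "'w measure \<Rightarrow> 'u measure \<Rightarrow> real measure \<Rightarrow> real
    \<Rightarrow> (real \<Rightarrow> 'w \<Rightarrow> 'u \<Rightarrow> 'h::real_normed_vector) \<Rightarrow> ennreal" where
  "w_enorm P \<mu> \<Lambda> T X =
     ennsqrt (\<integral>\<^sup>+\<omega>. (\<integral>\<^sup>+r\<in>{0<..T}. (\<integral>\<^sup>+u. ennreal ((norm (X r \<omega> u))\<^sup>2) \<partial>\<mu>) \<partial>\<Lambda>) \<partial>P)"

definition Lambda2w ::
  "'w measure \<Rightarrow> (real \<Rightarrow> 'w measure) \<Rightarrow> 'u::topological_space measure \<Rightarrow> real measure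
    \<Rightarrow> (real \<Rightarrow> 'u \<Rightarrow> 'f \<Rightarrow> 'h::{real_inner, banach}) \<Rightarrow> real
    \<Rightarrow> (real \<Rightarrow> 'w \<Rightarrow> 'u \<Rightarrow> 'h) set" where
  "Lambda2w P F \<mu> \<Lambda> \<iota> T =
     {X. (\<forall>r\<in>{0..T}. \<forall>\<omega>\<in>space P. \<forall>u. X r \<omega> u \<in> completion_space (\<iota> r u)) \<and>
         (\<forall>\<phi>. (\<lambda>((r, \<omega>), u). inner (X r \<omega> u) (\<iota> r u \<phi>))
                \<in> borel_measurable (predictable_algebra P F T \<Otimes>\<^sub>M borel)) \<and>
         w_enorm P \<mu> \<Lambda> T X < \<infinity>}"

definition Xi12w ::
  "'w measure \<Rightarrow> (real \<Rightarrow> 'w measure) \<Rightarrow> 'u::topological_space measure \<Rightarrow> real measure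
    \<Rightarrow> (real \<Rightarrow> 'u \<Rightarrow> 'f \<Rightarrow> 'h::{real_inner, banach}) \<Rightarrow> 'e measure \<Rightarrow> real
    \<Rightarrow> (real \<Rightarrow> 'w \<Rightarrow> 'u \<Rightarrow> 'e \<Rightarrow> 'h) set" where
  "Xi12w P F \<mu> \<Lambda> \<iota> \<rho> T =
     {X. (\<forall>r\<in>{0..T}. \<forall>\<omega>\<in>space P. \<forall>u. \<forall>e\<in>space \<rho>. X r \<omega> u e \<in> completion_space (\<iota> r u)) \<and>
         (\<forall>\<phi>. (\<lambda>((r, \<omega>), u, e). inner (X r \<omega> u e) (\<iota> r u \<phi>))
                \<in> borel_measurable (predictable_algebra P F T \<Otimes>\<^sub>M borel \<Otimes>\<^sub>M \<rho>)) \<and>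
         (\<integral>\<^sup>+e. w_enorm P \<mu> \<Lambda> T (\<lambda>r \<omega> u. X r \<omega> u e) \<partial>\<rho>) < \<infinity>}"


section \<open>The weak integral\<close>

definition simple_data ::
  "(real \<Rightarrow> 'w measure) \<Rightarrow> 'u set set \<Rightarrow> real \<Rightarrow> nat \<Rightarrow> nat \<Rightarrow> (nat \<Rightarrow> real) \<Rightarrow> (nat \<Rightarrow> real)
    \<Rightarrow> (nat \<Rightarrow> 'w set) \<Rightarrow> (nat \<Rightarrow> 'u set) \<Rightarrow> bool" where
  "simple_data F \<R> T n m s t G A \<longleftrightarrow>
     (\<forall>j<m. 0 \<le> s j \<and> s j < t j \<and> t j \<le> T \<and> G j \<in> sets (F (s j))) \<and>
     (\<forall>i<n. A i \<in> \<R>) \<and>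
     (\<forall>j<m. \<forall>k<m. k \<noteq> j \<longrightarrow> {s k<..t k} \<inter> {s j<..t j} \<noteq> {} \<longrightarrow>
        {s k<..t k} = {s j<..t j} \<and> G k \<inter> G j = {})"

text \<open>\<open>simple_integral_pair \<dots> X Y\<close>: \<open>X\<close> is a simple integrand and \<open>Y\<close> is its weak integral
  over \<open>[0,T]\<close>, computed from one representation of \<open>X\<close>.\<close>

definition simple_integral_pair ::
  "(real \<Rightarrow> 'w measure) \<Rightarrow> 'u set set \<Rightarrow> (real \<Rightarrow> 'u set \<Rightarrow> 'f \<Rightarrow> 'w \<Rightarrow> real)
    \<Rightarrow> (real \<Rightarrow> 'u \<Rightarrow> 'f \<Rightarrow> 'h::{real_inner, banach}) \<Rightarrow> real
    \<Rightarrow> (real \<Rightarrow> 'w \<Rightarrow> 'u \<Rightarrow> 'h) \<Rightarrow> ('w \<Rightarrow> real) \<Rightarrow> bool" where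
  "simple_integral_pair F \<R> M \<iota> T X Y \<longleftrightarrow>
     (\<exists>n m s t G A (\<phi> :: nat \<Rightarrow> nat \<Rightarrow> 'f). simple_data F \<R> T n m s t G A \<and>
        X = (\<lambda>r \<omega> u. \<Sum>i<n. \<Sum>j<m.
               (indicator {s j<..t j} r * indicator (G j) \<omega> * indicator (A i) u) *\<^sub>R \<iota> r u (\<phi> i j)) \<and>
        Y = (\<lambda>\<omega>. \<Sum>i<n. \<Sum>j<m.
               indicator (G j) \<omega> * (M (t j) (A i) (\<phi> i j) \<omega> - M (s j) (A i) (\<phi> i j) \<omega>)))"

text \<open>
  \<open>I\<close> is the weak integral over \<open>[0,T]\<close>: simple integrands are dense in \<^const>\<open>Lambda2w\<close>, and \<open>I\<close> is
  the linear isometry into \<open>L\<^sup>2\<close> that extends the integral of simple integrands. It is thereby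
  determined up to almost sure equality.
\<close>

definition is_weak_integral ::
  "'w measure \<Rightarrow> (real \<Rightarrow> 'w measure) \<Rightarrow> 'u::topological_space set set
    \<Rightarrow> (real \<Rightarrow> 'u set \<Rightarrow> 'f \<Rightarrow> 'w \<Rightarrow> real)
    \<Rightarrow> 'u measure \<Rightarrow> real measure \<Rightarrow> (real \<Rightarrow> 'u \<Rightarrow> 'f \<Rightarrow> 'h::{real_inner, banach}) \<Rightarrow> real
    \<Rightarrow> ((real \<Rightarrow> 'w \<Rightarrow> 'u \<Rightarrow> 'h) \<Rightarrow> 'w \<Rightarrow> real) \<Rightarrow> bool" where
  "is_weak_integral P F \<R> M \<mu> \<Lambda> \<iota> T I \<longleftrightarrow>
     (\<forall>X \<in> Lambda2w P F \<mu> \<Lambda> \<iota> T. \<forall>\<epsilon>>0.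
        \<exists>S Y. simple_integral_pair F \<R> M \<iota> T S Y \<and> w_enorm P \<mu> \<Lambda> T (X - S) < \<epsilon>) \<and>
     (\<forall>X Y. simple_integral_pair F \<R> M \<iota> T X Y \<longrightarrow> (AE \<omega> in P. I X \<omega> = Y \<omega>)) \<and>
     (\<forall>X \<in> Lambda2w P F \<mu> \<Lambda> \<iota> T. I X \<in> L2_space P \<and> L2_enorm P (I X) = w_enorm P \<mu> \<Lambda> T X) \<and>
     (\<forall>X \<in> Lambda2w P F \<mu> \<Lambda> \<iota> T. \<forall>Y \<in> Lambda2w P F \<mu> \<Lambda> \<iota> T. \<forall>a b.
        AE \<omega> in P. I (a *\<^sub>R X + b *\<^sub>R Y) \<omega> = a * I X \<omega> + b * I Y \<omega>)"

text \<open>A cadlag version of the process of integrals over \<open>[0,t]\<close>, unique up to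
  indistinguishability.\<close>

definition weak_integral_process ::
  "'w measure \<Rightarrow> (real \<Rightarrow> 'w measure) \<Rightarrow> real
    \<Rightarrow> ((real \<Rightarrow> 'w \<Rightarrow> 'u \<Rightarrow> 'h::real_vector) \<Rightarrow> 'w \<Rightarrow> real)
    \<Rightarrow> (real \<Rightarrow> 'w \<Rightarrow> 'u \<Rightarrow> 'h) \<Rightarrow> real \<Rightarrow> 'w \<Rightarrow> real" where
  "weak_integral_process P F T I X =
     (SOME Y. Y \<in> M2_space P F T \<and>
        (\<forall>t\<in>{0..T}. AE \<omega> in P. Y t \<omega> = I (\<lambda>r \<omega> u. indicator {0..t} r *\<^sub>R X r \<omega> u) \<omega>))"

end

theory Submission
  imports Defs
begin

text \<open>
  Simple families \<open>E \<rightarrow> \<Lambda>\<^sup>2\<^sub>w(T)\<close> are dense in \<open>\<Xi>\<^sup>1\<^sup>,\<^sup>2\<^sub>w(T,E)\<close>: choosing the nearest element among the first \<open>n\<close>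
  members of the countable dense family approximates an integrand by sums of \<open>1\<^sub>C i\<^sub>q \<phi>\<close> with \<open>C\<close>
  jointly measurable, and a Dynkin argument reduces \<open>C\<close> to rectangles. By Doob's inequality and the
  isometry, \<open>X \<mapsto> I\<^sup>w(X)\<close> is bounded from \<open>\<Lambda>\<^sup>2\<^sub>w(T)\<close> into the space of martingales, so applying it to
  these simple families gives simple functions that approximate \<open>e \<mapsto> I\<^sup>w(X(e))\<close>, and their integrals
  converge to \<open>I\<^sup>w(\<integral>X)\<close> since \<open>\<Lambda>\<^sup>2\<^sub>w\<close>-norms obey Minkowski's integral inequality. The rest
  follows from the continuity of evaluation at \<open>t\<close> and uniqueness of Bochner integrals in \<open>L\<^sup>2\<close>.
\<close>

section \<open>Square roots and square norms in the extended nonnegative reals\<close>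

text \<open>The completions under \<open>q r u\<close> change with \<open>(r, u)\<close>, so an
  integrand is no function into one space; measurability is given only through inner products with
  the canonical images of vectors \<open>\<phi>\<close>. The locale \<open>hilbert_field\<close>
  treats such families as measurable fields of Hilbert spaces, over a base measure whose
  \<sigma>-algebra is the predictable one, so that approximants are predictable automatically.

  Sections and martingales are functions under a seminorm, not classes. In particular
  \<open>weak_integral_process\<close> is a choice of version: it is meaningful only once a cadlag
  version is known to exist, and it is not linear as a map. Linearity is recovered almost surely, on
  finite sums.

  Suprema over all times, and distances between values in a non-separable space, need not be
  measurable, and the nonnegative integral is then a lower integral, which is monotone but not
  subadditive. Hence the maximal inequality supplies a measurable majorant, and uniqueness of
  Bochner integrals goes through measurable versions of the distances.\<close>

lemma ennsqrt_power2 [simp]: "(ennsqrt x)\<^sup>2 = x"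
  by (cases x) (auto simp: ennsqrt_def ennreal_power)

lemma ennsqrt_of_power2 [simp]: "ennsqrt (x\<^sup>2) = x"
  by (cases x) (auto simp: ennsqrt_def ennreal_power)

lemma ennreal_power2_mono_iff: "(x::ennreal)\<^sup>2 \<le> y\<^sup>2 \<longleftrightarrow> x \<le> y"
  by (cases x; cases y) (auto simp: ennreal_power ennreal_le_iff top_unique power_mono abs_le_square_iff[symmetric])

text \<open>Squaring is an order isomorphism of the extended half line, so norm estimates can be
  checked on integrals of squares.\<close>

lemma ennsqrt_le_iff: "ennsqrt x \<le> y \<longleftrightarrow> x \<le> y\<^sup>2"
  using ennreal_power2_mono_iff[of "ennsqrt x" y] by simp

lemma le_ennsqrt_iff: "y \<le> ennsqrt x \<longleftrightarrow> y\<^sup>2 \<le> x"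
  using ennreal_power2_mono_iff[of y "ennsqrt x"] by simp

lemma ennsqrt_less_iff: "ennsqrt x < y \<longleftrightarrow> x < y\<^sup>2"
  using le_ennsqrt_iff[of y x] by (simp add: not_le[symmetric])

lemma ennsqrt_mono: "x \<le> y \<Longrightarrow> ennsqrt x \<le> ennsqrt y"
  by (simp add: ennsqrt_le_iff)

lemma ennsqrt_0 [simp]: "ennsqrt 0 = 0"
  by (simp add: ennsqrt_def)

lemma ennsqrt_eq_0_iff [simp]: "ennsqrt x = 0 \<longleftrightarrow> x = 0"
  by (metis ennsqrt_0 ennsqrt_power2)

lemma ennsqrt_eq_top_iff [simp]: "ennsqrt x = \<top> \<longleftrightarrow> x = \<top>"
  by (simp add: ennsqrt_def)

lemma ennsqrt_less_top_iff [simp]: "ennsqrt x < \<top> \<longleftrightarrow> x < \<top>"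
  by (simp add: less_top[symmetric])

lemma ennsqrt_mult: "ennsqrt (x * y) = ennsqrt x * ennsqrt y"
  by (metis ennsqrt_of_power2 ennsqrt_power2 power_mult_distrib)

lemma borel_measurable_ennsqrt [measurable]: "ennsqrt \<in> borel_measurable borel"
  unfolding ennsqrt_def by measurable

lemma tendsto_ennreal_0_iff:
  fixes f :: "'a \<Rightarrow> ennreal"
  shows "(f \<longlongrightarrow> 0) G \<longleftrightarrow> (\<forall>e>0. eventually (\<lambda>x. f x < e) G)"
  by (auto simp: order_tendsto_iff)

lemma tendsto_ennsqrt_0:
  assumes "(f \<longlongrightarrow> 0) G"
  shows "((\<lambda>x. ennsqrt (f x)) \<longlongrightarrow> 0) G"
  unfolding tendsto_ennreal_0_iff ennsqrt_less_iff
  using assms[unfolded tendsto_ennreal_0_iff] by (simp add: zero_less_power zero_less_iff_neq_zero)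

text \<open>Integrands with values in the extended half line make Cauchy-Schwarz, the triangle
  inequality and Minkowski's integral inequality available without integrability conditions.
  \<open>L2_enorm\<close>, \<open>fnorm\<close> and, on sections, \<open>w_enorm\<close> are
  instances.\<close>

definition enorm2 :: "'a measure \<Rightarrow> ('a \<Rightarrow> ennreal) \<Rightarrow> ennreal" where
  "enorm2 M f = ennsqrt (\<integral>\<^sup>+x. (f x)\<^sup>2 \<partial>M)"

lemma enorm2_mono_AE:
  assumes "AE x in M. f x \<le> g x"
  shows "enorm2 M f \<le> enorm2 M g"
  unfolding enorm2_def using assms
  by (intro ennsqrt_mono nn_integral_mono_AE) (auto simp: ennreal_power2_mono_iff)

lemma enorm2_cong_AE:
  assumes "AE x in M. f x = g x"
  shows "enorm2 M f = enorm2 M g"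
  by (intro antisym enorm2_mono_AE) (use assms in auto)

lemma enorm2_mono: "(\<And>x. x \<in> space M \<Longrightarrow> f x \<le> g x) \<Longrightarrow> enorm2 M f \<le> enorm2 M g"
  by (intro enorm2_mono_AE AE_I2)

lemma ennreal_two_mult_le: "2 * a * b \<le> a\<^sup>2 + (b::ennreal)\<^sup>2"
proof (cases a; cases b)
  fix r s assume "0 \<le> r" "a = ennreal r" "0 \<le> s" "b = ennreal s"
  then show ?thesis
    using sum_squares_bound[of r s]
    by (simp add: ennreal_mult[symmetric] ennreal_power ennreal_plus[symmetric] ennreal_numeral[symmetric]
          ennreal_leI del: ennreal_plus ennreal_numeral)
qed (auto simp: ennreal_top_mult ennreal_mult_top power2_eq_square)

lemma ennreal_two_mult_cancel: "2 * a \<le> 2 * b \<Longrightarrow> a \<le> (b::ennreal)"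
  by (simp add: ennreal_mult_le_mult_iff)

text \<open>Integrating \<open>2 * a * b \<le> a^2 + b^2\<close> with \<open>a = f x * g y\<close>
  and \<open>b = g x * f y\<close> over both variables gives twice the square of the claim. Nothing
  is divided by a norm, so the values 0 and infinity are no special cases.\<close>

lemma nn_integral_mult_le_enorm2:
  assumes [measurable]: "f \<in> borel_measurable M" "g \<in> borel_measurable M"
  shows "(\<integral>\<^sup>+x. f x * g x \<partial>M) \<le> enorm2 M f * enorm2 M g"
proof -
  let ?A = "\<integral>\<^sup>+x. (f x)\<^sup>2 \<partial>M" and ?B = "\<integral>\<^sup>+x. (g x)\<^sup>2 \<partial>M" and ?C = "\<integral>\<^sup>+x. f x * g x \<partial>M"
  have "2 * ?C\<^sup>2 = (\<integral>\<^sup>+x. \<integral>\<^sup>+y. 2 * (f x * g x) * (f y * g y) \<partial>M \<partial>M)"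
  proof -
    have "(\<integral>\<^sup>+x. \<integral>\<^sup>+y. 2 * (f x * g x) * (f y * g y) \<partial>M \<partial>M) = (\<integral>\<^sup>+x. 2 * (f x * g x) * ?C \<partial>M)"
      by (intro nn_integral_cong nn_integral_cmult) simp
    also have "\<dots> = 2 * ?C * ?C"
      by (subst nn_integral_multc, simp, subst nn_integral_cmult) simp_all
    finally show ?thesis by (simp add: power2_eq_square mult.assoc)
  qed
  also have "\<dots> \<le> (\<integral>\<^sup>+x. \<integral>\<^sup>+y. (f x)\<^sup>2 * (g y)\<^sup>2 + (g x)\<^sup>2 * (f y)\<^sup>2 \<partial>M \<partial>M)"
  proof (intro nn_integral_mono)
    fix x y
    show "2 * (f x * g x) * (f y * g y) \<le> (f x)\<^sup>2 * (g y)\<^sup>2 + (g x)\<^sup>2 * (f y)\<^sup>2"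
      using ennreal_two_mult_le[of "f x * g y" "g x * f y"] by (simp add: power_mult_distrib mult_ac)
  qed
  also have "\<dots> = 2 * (?A * ?B)"
  proof -
    have "(\<integral>\<^sup>+x. \<integral>\<^sup>+y. (f x)\<^sup>2 * (g y)\<^sup>2 + (g x)\<^sup>2 * (f y)\<^sup>2 \<partial>M \<partial>M) = (\<integral>\<^sup>+x. (f x)\<^sup>2 * ?B + (g x)\<^sup>2 * ?A \<partial>M)"
      by (simp add: nn_integral_cmult nn_integral_add)
    also have "\<dots> = ?A * ?B + ?B * ?A"
      by (simp add: nn_integral_multc nn_integral_add)
    finally show ?thesis by (simp add: mult.commute mult_2)
  qed
  finally have "?C\<^sup>2 \<le> ?A * ?B" by (rule ennreal_two_mult_cancel)
  then show ?thesis
    unfolding enorm2_def by (simp add: ennsqrt_mult[symmetric] le_ennsqrt_iff)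
qed

lemma enorm2_triangle:
  assumes [measurable]: "f \<in> borel_measurable M" "g \<in> borel_measurable M"
  shows "enorm2 M (\<lambda>x. f x + g x) \<le> enorm2 M f + enorm2 M g"
proof -
  have "(\<integral>\<^sup>+x. (f x + g x)\<^sup>2 \<partial>M) = (\<integral>\<^sup>+x. (f x)\<^sup>2 \<partial>M) + 2 * (\<integral>\<^sup>+x. f x * g x \<partial>M) + (\<integral>\<^sup>+x. (g x)\<^sup>2 \<partial>M)"
    by (simp add: power2_sum nn_integral_add nn_integral_cmult mult.assoc add_ac)
  also have "\<dots> \<le> (enorm2 M f)\<^sup>2 + 2 * (enorm2 M f * enorm2 M g) + (enorm2 M g)\<^sup>2"
    by (intro add_mono mult_left_mono nn_integral_mult_le_enorm2) (auto simp: enorm2_def)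
  also have "\<dots> = (enorm2 M f + enorm2 M g)\<^sup>2"
    by (simp add: power2_sum mult.assoc add_ac)
  finally show ?thesis by (simp add: enorm2_def[of M "\<lambda>x. f x + g x"] ennsqrt_le_iff)
qed

text \<open>The square of the inner integral is a double integral over \<open>e\<close> and
  \<open>e'\<close>. Two applications of Fubini bring the integral over \<open>x\<close> innermost,
  where Cauchy-Schwarz splits it into a product of norms. This is Minkowski's integral
  inequality.\<close>

lemma enorm2_nn_integral_le:
  fixes f :: "'a \<Rightarrow> 'b \<Rightarrow> ennreal"
  assumes "sigma_finite_measure M" "sigma_finite_measure R"
    and f [measurable]: "case_prod f \<in> borel_measurable (M \<Otimes>\<^sub>M R)"
  shows "enorm2 M (\<lambda>x. \<integral>\<^sup>+e. f x e \<partial>R) \<le> (\<integral>\<^sup>+e. enorm2 M (\<lambda>x. f x e) \<partial>R)"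
proof -
  interpret M: sigma_finite_measure M by fact
  interpret R: sigma_finite_measure R by fact
  interpret MR: pair_sigma_finite M R ..
  interpret RR: pair_sigma_finite R R ..
  let ?n = "\<lambda>e. enorm2 M (\<lambda>x. f x e)"
  have [measurable]: "?n \<in> borel_measurable R" unfolding enorm2_def by measurable
  have "(\<integral>\<^sup>+x. (\<integral>\<^sup>+e. f x e \<partial>R)\<^sup>2 \<partial>M) = (\<integral>\<^sup>+x. \<integral>\<^sup>+e. \<integral>\<^sup>+e'. f x e * f x e' \<partial>R \<partial>R \<partial>M)"
    by (intro nn_integral_cong) (simp add: nn_integral_cmult nn_integral_multc power2_eq_square)
  also have "\<dots> = (\<integral>\<^sup>+e. \<integral>\<^sup>+x. \<integral>\<^sup>+e'. f x e * f x e' \<partial>R \<partial>M \<partial>R)"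
    by (subst MR.Fubini') simp_all
  also have "\<dots> = (\<integral>\<^sup>+e. \<integral>\<^sup>+e'. \<integral>\<^sup>+x. f x e * f x e' \<partial>M \<partial>R \<partial>R)"
    by (intro nn_integral_cong MR.Fubini'[symmetric]) simp
  also have "\<dots> \<le> (\<integral>\<^sup>+e. \<integral>\<^sup>+e'. ?n e * ?n e' \<partial>R \<partial>R)"
    by (intro nn_integral_mono nn_integral_mult_le_enorm2) auto
  also have "\<dots> = (\<integral>\<^sup>+e. ?n e \<partial>R)\<^sup>2"
    by (simp add: nn_integral_cmult nn_integral_multc power2_eq_square)
  finally show ?thesis by (simp add: enorm2_def[of M "\<lambda>x. \<integral>\<^sup>+e. f x e \<partial>R"] ennsqrt_le_iff)
qed

lemma L2_enorm_eq: "L2_enorm P Y = enorm2 P (\<lambda>\<omega>. ennreal \<bar>Y \<omega>\<bar>)"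
  by (simp add: L2_enorm_def enorm2_def ennreal_power)

section \<open>Maximal inequality\<close>

lemma square_integrable_mult:
  fixes f g :: "'a \<Rightarrow> real"
  assumes [measurable]: "f \<in> borel_measurable M" "g \<in> borel_measurable M"
    and "integrable M (\<lambda>x. (f x)\<^sup>2)" "integrable M (\<lambda>x. (g x)\<^sup>2)"
  shows "integrable M (\<lambda>x. f x * g x)"
proof (rule Bochner_Integration.integrable_bound)
  show "integrable M (\<lambda>x. (f x)\<^sup>2 + (g x)\<^sup>2)" using assms by simp
  have "\<bar>a * b\<bar> \<le> a\<^sup>2 + b\<^sup>2" for a b :: real
  proof -
    have "2 * (\<bar>a\<bar> * \<bar>b\<bar>) \<le> a\<^sup>2 + b\<^sup>2" using sum_squares_bound[of "\<bar>a\<bar>" "\<bar>b\<bar>"] by (simp add: mult.assoc)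
    moreover have "0 \<le> \<bar>a\<bar> * \<bar>b\<bar>" by simp
    ultimately show ?thesis unfolding abs_mult by linarith
  qed
  then show "AE x in M. norm (f x * g x) \<le> norm ((f x)\<^sup>2 + (g x)\<^sup>2)" by simp
qed simp

lemma square_integrable_add:
  fixes f g :: "'a \<Rightarrow> real"
  assumes [measurable]: "f \<in> borel_measurable M" "g \<in> borel_measurable M"
    and "integrable M (\<lambda>x. (f x)\<^sup>2)" "integrable M (\<lambda>x. (g x)\<^sup>2)"
  shows "integrable M (\<lambda>x. (f x + g x)\<^sup>2)"
  using square_integrable_mult[OF assms] assms(3,4) by (simp add: power2_sum mult.assoc)

fun running_max :: "(nat \<Rightarrow> real) \<Rightarrow> nat \<Rightarrow> real" where
  "running_max a 0 = a 0"
| "running_max a (Suc n) = max (running_max a n) (a (Suc n))"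

lemma running_max_ge: "i \<le> n \<Longrightarrow> a i \<le> running_max a n"
  by (induction n) (auto simp: le_Suc_eq)

context stochastic_basis
begin

lemma sigma_finite_subalgebra_F:
  assumes "0 \<le> t" shows "sigma_finite_subalgebra P (F t)"
  using subalgebra_F[OF assms] finite_measure_axioms
  by (intro finite_measure_subalgebra_is_sigma_finite) (simp add: finite_measure_subalgebra_def finite_measure_subalgebra_axioms_def)

lemma measurable_F_P:
  assumes "0 \<le> t" "f \<in> borel_measurable (F t)" shows "f \<in> borel_measurable P"
  using measurable_from_subalg[OF subalgebra_F] assms by blast

lemma measurable_F_mono:
  assumes "0 \<le> s" "s \<le> t" "f \<in> borel_measurable (F s)" shows "f \<in> borel_measurable (F t)"
  using assms F_mono[OF assms(1,2)] subalgebra_F[of s] subalgebra_F[of t]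
  by (auto simp: measurable_def subalgebra_def)

lemma martingale_on_integral_mult:
  assumes "martingale_on P F S Y" "s \<in> S" "t \<in> S" "0 \<le> s" "s \<le> t"
    and H: "H \<in> borel_measurable (F s)" and int: "integrable P (\<lambda>\<omega>. H \<omega> * Y t \<omega>)"
  shows "(\<integral>\<omega>. H \<omega> * Y t \<omega> \<partial>P) = (\<integral>\<omega>. H \<omega> * Y s \<omega> \<partial>P)"
proof -
  interpret sigma_finite_subalgebra P "F s" using sigma_finite_subalgebra_F[OF \<open>0 \<le> s\<close>] .
  have [measurable]: "Y t \<in> borel_measurable P" "Y s \<in> borel_measurable P" "H \<in> borel_measurable P"
    using assms measurable_F_P by (auto simp: martingale_on_def)
  have "(\<integral>\<omega>. H \<omega> * Y t \<omega> \<partial>P) = (\<integral>\<omega>. H \<omega> * real_cond_exp P (F s) (Y t) \<omega> \<partial>P)"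
    by (rule real_cond_exp_intg(2)[symmetric, OF int H]) simp
  also have "\<dots> = (\<integral>\<omega>. H \<omega> * Y s \<omega> \<partial>P)"
  proof (intro integral_cong_AE)
    have "AE \<omega> in P. real_cond_exp P (F s) (Y t) \<omega> = Y s \<omega>"
      using assms by (auto simp: martingale_on_def)
    then show "AE \<omega> in P. H \<omega> * real_cond_exp P (F s) (Y t) \<omega> = H \<omega> * Y s \<omega>"
      by eventually_elim simp
  qed auto
  finally show ?thesis .
qed

text \<open>With \<open>m\<close> the running maximum of \<open>\<bar>Y\<bar>\<close>, the increments of \<open>m * \<bar>Y\<bar> - m\<^sup>2 / 2\<close> dominate
  \<open>m\<^sub>n * sgn Y\<^sub>n * (Y\<^sub>n\<^sub>+\<^sub>1 - Y\<^sub>n)\<close>, which has mean zero.\<close>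

lemma doob_L2_discrete:
  assumes Y: "zero_mean_L2_martingale_on P F {0..T} Y"
    and \<tau>: "\<And>i. \<tau> i \<in> {0..T}" "mono \<tau>"
  defines "m \<equiv> \<lambda>n \<omega>. running_max (\<lambda>i. \<bar>Y (\<tau> i) \<omega>\<bar>) n"
  shows "m n \<in> borel_measurable (F (\<tau> n))" "integrable P (\<lambda>\<omega>. (m n \<omega>)\<^sup>2)"
    and "(\<integral>\<omega>. (m n \<omega>)\<^sup>2 \<partial>P) \<le> 4 * (\<integral>\<omega>. (Y (\<tau> n) \<omega>)\<^sup>2 \<partial>P)"
proof -
  have Ym: "Y (\<tau> i) \<in> borel_measurable (F (\<tau> i))" and Yi: "integrable P (\<lambda>\<omega>. (Y (\<tau> i) \<omega>)\<^sup>2)"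
    and M: "martingale_on P F {0..T} Y" for i
    using Y \<tau>(1)[of i] by (auto simp: zero_mean_L2_martingale_on_def martingale_on_def)
  have \<tau>0: "0 \<le> \<tau> i" for i using \<tau>(1)[of i] by simp
  have [measurable]: "Y (\<tau> i) \<in> borel_measurable P" for i using measurable_F_P[OF \<tau>0 Ym] .
  have mF: "m n \<in> borel_measurable (F (\<tau> n))" for n
  proof (induction n)
    case (Suc n)
    have [measurable]: "m n \<in> borel_measurable (F (\<tau> (Suc n)))"
      by (rule measurable_F_mono[OF \<tau>0 _ Suc]) (use \<tau>(2) in \<open>auto simp: mono_def\<close>)
    have [measurable]: "Y (\<tau> (Suc n)) \<in> borel_measurable (F (\<tau> (Suc n)))" by (rule Ym)
    have "(\<lambda>\<omega>. max (m n \<omega>) \<bar>Y (\<tau> (Suc n)) \<omega>\<bar>) \<in> borel_measurable (F (\<tau> (Suc n)))" by measurable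
    then show ?case by (simp add: m_def)
  qed (use Ym[of 0] in \<open>simp add: m_def\<close>)
  show "m n \<in> borel_measurable (F (\<tau> n))" by (rule mF)
  have [measurable]: "m n \<in> borel_measurable P" for n using measurable_F_P[OF \<tau>0 mF] .
  have m0: "0 \<le> m n \<omega>" for n \<omega> by (induction n) (auto simp: m_def)
  have mi: "integrable P (\<lambda>\<omega>. (m n \<omega>)\<^sup>2)" for n
  proof (induction n)
    case (Suc n)
    show ?case
    proof (rule Bochner_Integration.integrable_bound)
      show "integrable P (\<lambda>\<omega>. (m n \<omega>)\<^sup>2 + (Y (\<tau> (Suc n)) \<omega>)\<^sup>2)" using Suc Yi by simp
      show "AE \<omega> in P. norm ((m (Suc n) \<omega>)\<^sup>2) \<le> norm ((m n \<omega>)\<^sup>2 + (Y (\<tau> (Suc n)) \<omega>)\<^sup>2)"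
        by (auto simp: m_def max_def)
    qed simp
  qed (use Yi[of 0] in \<open>simp add: m_def\<close>)
  then show "integrable P (\<lambda>\<omega>. (m n \<omega>)\<^sup>2)" .
  have i1 [simp]: "integrable P (\<lambda>\<omega>. m n \<omega> * \<bar>Y (\<tau> k) \<omega>\<bar>)" for n k
    using square_integrable_mult[of "m n" P "\<lambda>\<omega>. \<bar>Y (\<tau> k) \<omega>\<bar>"] mi Yi by simp
  have pos: "0 \<le> (\<integral>\<omega>. m n \<omega> * \<bar>Y (\<tau> n) \<omega>\<bar> - (m n \<omega>)\<^sup>2 / 2 \<partial>P)" for n
  proof (induction n)
    case 0
    have "0 \<le> \<bar>y\<bar> * \<bar>y\<bar> - \<bar>y\<bar>\<^sup>2 / 2" for y :: real by (simp add: power2_eq_square)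
    then show ?case by (intro integral_nonneg_AE) (simp add: m_def)
  next
    case (Suc n)
    let ?H = "\<lambda>\<omega>. m n \<omega> * sgn (Y (\<tau> n) \<omega>)"
    have "sgn (Y (\<tau> n) \<omega>)^2 \<le> 1" for \<omega> by (simp add: sgn_if)
    then have "(?H \<omega>)^2 \<le> (m n \<omega>)^2" for \<omega> by (simp add: power_mult_distrib mult_left_le)
    then have "integrable P (\<lambda>\<omega>. (?H \<omega>)\<^sup>2)"
      by (intro Bochner_Integration.integrable_bound[OF mi[of n]]) (auto simp: borel_measurable_sgn)
    then have i2: "integrable P (\<lambda>\<omega>. ?H \<omega> * Y (\<tau> k) \<omega>)" for k
      by (intro square_integrable_mult Yi) (auto simp: borel_measurable_sgn)
    have [measurable]: "m n \<in> borel_measurable (F (\<tau> n))" "Y (\<tau> n) \<in> borel_measurable (F (\<tau> n))"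
      using mF Ym by auto
    have "(\<integral>\<omega>. ?H \<omega> * Y (\<tau> (Suc n)) \<omega> \<partial>P) = (\<integral>\<omega>. ?H \<omega> * Y (\<tau> n) \<omega> \<partial>P)"
      by (rule martingale_on_integral_mult[OF M \<tau>(1) \<tau>(1) \<tau>0 _ _ i2])
        (use \<tau>(2) in \<open>auto simp: mono_def borel_measurable_sgn\<close>)
    then have "0 = (\<integral>\<omega>. ?H \<omega> * Y (\<tau> (Suc n)) \<omega> - ?H \<omega> * Y (\<tau> n) \<omega> \<partial>P)"
      by (simp add: i2)
    also have "\<dots> \<le> (\<integral>\<omega>. (m (Suc n) \<omega> * \<bar>Y (\<tau> (Suc n)) \<omega>\<bar> - (m (Suc n) \<omega>)\<^sup>2 / 2)
        - (m n \<omega> * \<bar>Y (\<tau> n) \<omega>\<bar> - (m n \<omega>)\<^sup>2 / 2) \<partial>P)"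
    proof (intro integral_mono)
      fix \<omega>
      let ?a = "\<bar>Y (\<tau> (Suc n)) \<omega>\<bar>"
      have "?H \<omega> * Y (\<tau> (Suc n)) \<omega> \<le> m n \<omega> * ?a"
        unfolding mult.assoc by (intro mult_left_mono m0) (auto simp: sgn_if)
      moreover have "?H \<omega> * Y (\<tau> n) \<omega> = m n \<omega> * \<bar>Y (\<tau> n) \<omega>\<bar>"
        by (auto simp: sgn_if abs_if)
      \<comment> \<open>If the new value raises the maximum, the two sides differ by
        \<open>(?a - m n \<omega>)^2 / 2\<close>; otherwise the maximum is unchanged and they
        agree.\<close>
      moreover have "m n \<omega> * ?a \<le> m (Suc n) \<omega> * ?a - (m (Suc n) \<omega>)\<^sup>2 / 2 + (m n \<omega>)\<^sup>2 / 2"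
      proof (cases "m n \<omega> \<le> ?a")
        case True
        then have "m (Suc n) \<omega> = ?a" by (simp add: m_def)
        moreover have "0 \<le> (?a - m n \<omega>)\<^sup>2" by simp
        ultimately show ?thesis by (simp add: power2_eq_square algebra_simps)
      qed (simp add: m_def)
      ultimately show "?H \<omega> * Y (\<tau> (Suc n)) \<omega> - ?H \<omega> * Y (\<tau> n) \<omega>
        \<le> (m (Suc n) \<omega> * ?a - (m (Suc n) \<omega>)\<^sup>2 / 2) - (m n \<omega> * \<bar>Y (\<tau> n) \<omega>\<bar> - (m n \<omega>)\<^sup>2 / 2)"
        by linarith
    qed (use mi i2 in auto)
    finally show ?case using Suc mi by simp
  qed
  have "(\<integral>\<omega>. (m n \<omega>)\<^sup>2 \<partial>P) \<le> (\<integral>\<omega>. 2 * m n \<omega> * \<bar>Y (\<tau> n) \<omega>\<bar> \<partial>P)"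
    using pos[of n] mi by (simp add: mult.assoc)
  \<comment> \<open>The product is split unevenly so that half of the mean of \<open>m^2\<close>
    remains to be absorbed on the left, which its finiteness permits. This is the origin of the
    constant 4.\<close>
  also have "\<dots> \<le> (\<integral>\<omega>. (m n \<omega>)\<^sup>2 / 2 + 2 * (Y (\<tau> n) \<omega>)\<^sup>2 \<partial>P)"
  proof (intro integral_mono)
    fix \<omega>
    have "0 \<le> (m n \<omega> / 2 - \<bar>Y (\<tau> n) \<omega>\<bar>)\<^sup>2" by simp
    then show "2 * m n \<omega> * \<bar>Y (\<tau> n) \<omega>\<bar> \<le> (m n \<omega>)\<^sup>2 / 2 + 2 * (Y (\<tau> n) \<omega>)\<^sup>2"
      by (simp add: power2_diff power_divide)
  qed (use mi Yi in \<open>auto simp: mult.assoc\<close>)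
  also have "\<dots> = (\<integral>\<omega>. (m n \<omega>)\<^sup>2 \<partial>P) / 2 + 2 * (\<integral>\<omega>. (Y (\<tau> n) \<omega>)\<^sup>2 \<partial>P)"
    using mi Yi by simp
  finally show "(\<integral>\<omega>. (m n \<omega>)\<^sup>2 \<partial>P) \<le> 4 * (\<integral>\<omega>. (Y (\<tau> n) \<omega>)\<^sup>2 \<partial>P)" by simp
qed

end

section \<open>Cadlag paths on grids and the maximal inequality in continuous time\<close>

definition grid_index :: "real \<Rightarrow> real \<Rightarrow> nat \<Rightarrow> nat" where
  "grid_index T t n = nat \<lceil>t * real (Suc n) / T\<rceil>"

lemma grid_index_le:
  assumes t: "t \<in> {0..T}" and T: "0 < T"
  shows "grid_index T t n \<le> Suc n"
proof -
  have "t * real (Suc n) / T \<le> of_int (int (Suc n))"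
    using mult_right_mono[of t T "real (Suc n)"] t T by (simp add: field_simps)
  then have "\<lceil>t * real (Suc n) / T\<rceil> \<le> int (Suc n)" by (rule ceiling_le)
  then show ?thesis unfolding grid_index_def by (metis nat_int nat_mono)
qed

lemma grid_point_mem:
  assumes "k \<le> Suc n" and T: "0 < T"
  shows "real k * T / real (Suc n) \<in> {0..T}"
proof -
  have "real k * T \<le> real (Suc n) * T" using assms by (intro mult_right_mono) auto
  then show ?thesis using T by (simp add: pos_divide_le_eq mult.commute del: of_nat_Suc)
qed

text \<open>Rounding the index up keeps the grid points in \<open>[t, t + T / Suc n]\<close>, the
  side on which a cadlag path is continuous, while \<open>grid_index_le\<close> keeps them from
  passing \<open>T\<close>.\<close>

lemma cadlag_on_tendsto_grid:
  assumes f: "cadlag_on {0..T} f" and t: "t \<in> {0..T}" and T: "0 < T"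
  shows "(\<lambda>n. f (real (grid_index T t n) * T / real (Suc n))) \<longlonglongrightarrow> f t"
proof -
  define x where "x n = real (grid_index T t n) * T / real (Suc n)" for n
  have "0 \<le> t * real (Suc n) / T" for n using t T by simp
  then have k: "real (grid_index T t n) = of_int \<lceil>t * real (Suc n) / T\<rceil>" for n
    by (simp add: grid_index_def del: of_nat_Suc)
  have lo: "t \<le> x n" for n
  proof -
    have "t * real (Suc n) / T \<le> real (grid_index T t n)" unfolding k by simp
    then show ?thesis using T by (simp add: x_def field_simps)
  qed
  have up: "x n \<le> t + T / real (Suc n)" for n
  proof -
    have "real (grid_index T t n) \<le> t * real (Suc n) / T + 1" unfolding k by linarith
    then have "real (grid_index T t n) * (T / real (Suc n)) \<le> (t * real (Suc n) / T + 1) * (T / real (Suc n))"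
      using T by (intro mult_right_mono) auto
    moreover have "(t * real (Suc n) / T + 1) * (T / real (Suc n)) = t + T / real (Suc n)"
      using T by (simp add: field_simps del: of_nat_Suc)
    ultimately show ?thesis by (simp add: x_def del: of_nat_Suc)
  qed
  have xT: "x n \<le> T" for n
    using grid_point_mem[OF grid_index_le[OF t T] T] by (simp add: x_def)
  have "x \<longlonglongrightarrow> t"
  proof (rule tendsto_sandwich[OF _ _ tendsto_const])
    have "(\<lambda>n. t + T * inverse (real (Suc n))) \<longlonglongrightarrow> t + T * 0"
      by (intro tendsto_intros LIMSEQ_inverse_real_of_nat)
    then show "(\<lambda>n. t + T / real (Suc n)) \<longlonglongrightarrow> t" by (simp add: divide_inverse)
  qed (use lo up in auto)
  \<comment> \<open>A grid point may coincide with \<open>t\<close>. The filter at \<open>t\<close>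
    ignores \<open>t\<close> itself, so right continuity also serves on the half line closed at
    \<open>t\<close>.\<close>
  moreover have "continuous (at t within {0..T} \<inter> {t..}) f"
  proof -
    have "at t within {0..T} \<inter> {t..} = at t within {0..T} \<inter> {t<..}"
      unfolding at_within_def by (rule arg_cong[where f="\<lambda>A. inf (nhds t) (principal A)"]) auto
    then show ?thesis using f t by (simp add: continuous_within cadlag_on_def)
  qed
  moreover have "x n \<in> {0..T} \<inter> {t..}" for n using lo[of n] xT[of n] t by auto
  ultimately have "(f \<circ> x) \<longlonglongrightarrow> f t" using continuous_within_sequentially by blast
  then show ?thesis by (simp add: x_def comp_def)
qed

context stochastic_basis
begin

text \<open>The supremum over all times need not be measurable, so a measurable majorant
  \<open>W\<close> takes its place. It is the lower limit of the squared grid maxima: successive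
  grids are not nested, so these maxima need not increase, and Fatou's lemma rather than monotone
  convergence carries the discrete bound over.\<close>

lemma doob_L2:
  assumes "Y \<in> M2_space P F T" and T: "0 < T"
  obtains W where "W \<in> borel_measurable P"
    and "\<And>\<omega> t. \<omega> \<in> space P \<Longrightarrow> t \<in> {0..T} \<Longrightarrow> ennreal ((Y t \<omega>)\<^sup>2) \<le> W \<omega>"
    and "(\<integral>\<^sup>+\<omega>. W \<omega> \<partial>P) \<le> 4 * (\<integral>\<^sup>+\<omega>. ennreal ((Y T \<omega>)\<^sup>2) \<partial>P)"
proof
  have Y: "zero_mean_L2_martingale_on P F {0..T} Y" and cad: "\<And>\<omega>. \<omega> \<in> space P \<Longrightarrow> cadlag_on {0..T} (\<lambda>t. Y t \<omega>)"
    using assms by (auto simp: M2_space_def)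
  \<comment> \<open>Freezing the grid at \<open>T\<close> yields a monotone sequence in
    \<open>[0,T]\<close>, the form in which the discrete inequality takes its times.\<close>
  define \<tau> where "\<tau> n i = min T (real i * T / real (Suc n))" for n i
  have \<tau>: "\<tau> n i \<in> {0..T}" "mono (\<tau> n)" "\<tau> n (Suc n) = T" for n i
  proof -
    show "mono (\<tau> n)" unfolding \<tau>_def using T
      by (intro monoI min.mono order_refl divide_right_mono mult_right_mono) auto
    show "\<tau> n i \<in> {0..T}" using T by (simp add: \<tau>_def)
    show "\<tau> n (Suc n) = T" by (simp add: \<tau>_def del: of_nat_Suc)
  qed
  define m where "m n \<omega> = running_max (\<lambda>i. \<bar>Y (\<tau> n i) \<omega>\<bar>) (Suc n)" for n \<omega>
  have D: "m n \<in> borel_measurable (F T)" "integrable P (\<lambda>\<omega>. (m n \<omega>)\<^sup>2)"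
    "(\<integral>\<omega>. (m n \<omega>)\<^sup>2 \<partial>P) \<le> 4 * (\<integral>\<omega>. (Y T \<omega>)\<^sup>2 \<partial>P)" for n
    using doob_L2_discrete[where \<tau>="\<tau> n" and n="Suc n", OF Y \<tau>(1,2)]
    unfolding m_def \<tau>(3) by blast+
  have [measurable]: "m n \<in> borel_measurable P" for n
    using D(1)[of n] T measurable_F_P[of T] by simp
  let ?W = "\<lambda>\<omega>. liminf (\<lambda>n. ennreal ((m n \<omega>)\<^sup>2))"
  show "?W \<in> borel_measurable P" by measurable
  show "ennreal ((Y t \<omega>)\<^sup>2) \<le> ?W \<omega>" if "\<omega> \<in> space P" and t: "t \<in> {0..T}" for \<omega> t
  proof -
    let ?k = "grid_index T t"
    have kn: "?k n \<le> Suc n" for n by (rule grid_index_le[OF t T])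
    have "\<tau> n (?k n) = real (?k n) * T / real (Suc n)" for n
      using grid_point_mem[OF kn T] by (simp add: \<tau>_def min_absorb2)
    then have "(\<lambda>n. Y (\<tau> n (?k n)) \<omega>) \<longlonglongrightarrow> Y t \<omega>"
      using cadlag_on_tendsto_grid[OF cad[OF that(1)] t T] by simp
    then have "(\<lambda>n. ennreal ((Y (\<tau> n (?k n)) \<omega>)\<^sup>2)) \<longlonglongrightarrow> ennreal ((Y t \<omega>)\<^sup>2)"
      by (intro tendsto_intros)
    then have "ennreal ((Y t \<omega>)\<^sup>2) = liminf (\<lambda>n. ennreal ((Y (\<tau> n (?k n)) \<omega>)\<^sup>2))"
      by (intro lim_imp_Liminf[symmetric] sequentially_bot)
    also have "\<dots> \<le> ?W \<omega>"
    proof (intro Liminf_mono always_eventually allI ennreal_leI)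
      fix n
      have "\<bar>Y (\<tau> n (?k n)) \<omega>\<bar> \<le> m n \<omega>"
        unfolding m_def using kn[of n] by (rule running_max_ge[where a="\<lambda>i. \<bar>Y (\<tau> n i) \<omega>\<bar>"])
      then show "(Y (\<tau> n (?k n)) \<omega>)\<^sup>2 \<le> (m n \<omega>)\<^sup>2"
        using abs_le_square_iff[of "Y (\<tau> n (?k n)) \<omega>" "m n \<omega>"] by auto
    qed
    finally show ?thesis .
  qed
  have sqT: "integrable P (\<lambda>\<omega>. (Y T \<omega>)\<^sup>2)" using Y T by (auto simp: zero_mean_L2_martingale_on_def)
  have "(\<integral>\<^sup>+\<omega>. ?W \<omega> \<partial>P) \<le> liminf (\<lambda>n. \<integral>\<^sup>+\<omega>. ennreal ((m n \<omega>)\<^sup>2) \<partial>P)"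
    by (rule nn_integral_liminf) simp
  also have "\<dots> \<le> liminf (\<lambda>n. ennreal (4 * (\<integral>\<omega>. (Y T \<omega>)\<^sup>2 \<partial>P)))"
    by (intro Liminf_mono always_eventually allI)
       (subst nn_integral_eq_integral, use D in \<open>auto intro!: ennreal_leI\<close>)
  also have "\<dots> = 4 * (\<integral>\<^sup>+\<omega>. ennreal ((Y T \<omega>)\<^sup>2) \<partial>P)"
    by (subst nn_integral_eq_integral[OF sqT]) (auto simp: ennreal_mult Liminf_const)
  finally show "(\<integral>\<^sup>+\<omega>. ?W \<omega> \<partial>P) \<le> 4 * (\<integral>\<^sup>+\<omega>. ennreal ((Y T \<omega>)\<^sup>2) \<partial>P)" .
qed

text \<open>Monotonicity of the nonnegative integral holds for a possibly non-measurable supremum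
  too, so the majorant suffices. The factor 2 is the square root of Doob's 4.\<close>

lemma M2_enorm_le:
  assumes "Y \<in> M2_space P F T" and "0 < T"
  shows "M2_enorm P T Y \<le> 2 * L2_enorm P (Y T)"
proof -
  obtain W where W: "W \<in> borel_measurable P"
    "\<And>\<omega> t. \<omega> \<in> space P \<Longrightarrow> t \<in> {0..T} \<Longrightarrow> ennreal ((Y t \<omega>)\<^sup>2) \<le> W \<omega>"
    "(\<integral>\<^sup>+\<omega>. W \<omega> \<partial>P) \<le> 4 * (\<integral>\<^sup>+\<omega>. ennreal ((Y T \<omega>)\<^sup>2) \<partial>P)"
    using doob_L2[OF assms] by blast
  have "(\<integral>\<^sup>+\<omega>. (SUP t\<in>{0..T}. ennreal ((Y t \<omega>)\<^sup>2)) \<partial>P) \<le> (\<integral>\<^sup>+\<omega>. W \<omega> \<partial>P)"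
    by (intro nn_integral_mono SUP_least W(2))
  also note W(3)
  also have "4 * (\<integral>\<^sup>+\<omega>. ennreal ((Y T \<omega>)\<^sup>2) \<partial>P) = (2 * L2_enorm P (Y T))\<^sup>2"
    by (simp add: L2_enorm_def power_mult_distrib)
  finally show ?thesis by (simp add: M2_enorm_def ennsqrt_le_iff)
qed

lemma L2_enorm_le_M2_enorm: "t \<in> {0..T} \<Longrightarrow> L2_enorm P (Y t) \<le> M2_enorm P T Y"
  unfolding L2_enorm_def M2_enorm_def by (intro ennsqrt_mono nn_integral_mono SUP_upper)

end

section \<open>Measurable fields of Hilbert spaces\<close>

lemma closure_add:
  fixes S :: "'a::real_normed_vector set"
  assumes S: "subspace S" and "x \<in> closure S" "y \<in> closure S"
  shows "x + y \<in> closure S"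
proof -
  obtain f g where "\<And>n. f n \<in> S" "f \<longlonglongrightarrow> x" "\<And>n. g n \<in> S" "g \<longlonglongrightarrow> y"
    using assms(2,3) unfolding closure_sequential by metis
  then show ?thesis
    unfolding closure_sequential
    by (intro exI[of _ "\<lambda>n. f n + g n"]) (auto intro: tendsto_add subspace_add[OF S])
qed

lemma closure_scaleR_mem:
  fixes S :: "'a::real_normed_vector set"
  assumes S: "subspace S" and "x \<in> closure S"
  shows "c *\<^sub>R x \<in> closure S"
proof -
  obtain f where "\<And>n. f n \<in> S" "f \<longlonglongrightarrow> x"
    using assms(2) unfolding closure_sequential by metis
  then show ?thesis
    unfolding closure_sequential
    by (intro exI[of _ "\<lambda>n. c *\<^sub>R f n"]) (auto intro: tendsto_scaleR subspace_scale[OF S])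
qed

text \<open>The terms equal \<open>(norm x)^2 - (norm (x - a))^2\<close>, and \<open>x\<close> is a
  limit of members of \<open>A\<close>. The norm is thereby expressed through inner products with a
  dense set alone.\<close>

lemma norm_power2_eq_SUP:
  fixes x :: "'a::real_inner"
  assumes x: "x \<in> closure A"
  shows "(norm x)\<^sup>2 = (SUP a\<in>A. 2 * inner x a - (norm a)\<^sup>2)"
    and "bdd_above ((\<lambda>a. 2 * inner x a - (norm a)\<^sup>2) ` A)"
proof -
  have eq: "2 * inner x a - (norm a)\<^sup>2 = (norm x)\<^sup>2 - (norm (x - a))\<^sup>2" for a
    by (simp add: power2_norm_eq_inner inner_diff inner_commute algebra_simps)
  show "bdd_above ((\<lambda>a. 2 * inner x a - (norm a)\<^sup>2) ` A)"
    unfolding eq by (intro bdd_aboveI[of _ "(norm x)\<^sup>2"]) auto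
  have ne: "A \<noteq> {}" using x by auto
  obtain f where f: "\<And>n. f n \<in> A" "f \<longlonglongrightarrow> x"
    using x unfolding closure_sequential by metis
  have "(SUP a\<in>A. (norm x)\<^sup>2 - (norm (x - a))\<^sup>2) = (norm x)\<^sup>2"
  proof (rule antisym)
    show "(SUP a\<in>A. (norm x)\<^sup>2 - (norm (x - a))\<^sup>2) \<le> (norm x)\<^sup>2"
      using ne by (intro cSUP_least) auto
    have "(\<lambda>n. (norm x)\<^sup>2 - (norm (x - f n))\<^sup>2) \<longlonglongrightarrow> (norm x)\<^sup>2 - (norm (x - x))\<^sup>2"
      by (intro tendsto_intros f)
    then show "(norm x)\<^sup>2 \<le> (SUP a\<in>A. (norm x)\<^sup>2 - (norm (x - a))\<^sup>2)"
    proof (intro LIMSEQ_le_const2[of _ "(norm x)\<^sup>2"] exI allI impI)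
      fix n
      show "(norm x)\<^sup>2 - (norm (x - f n))\<^sup>2 \<le> (SUP a\<in>A. (norm x)\<^sup>2 - (norm (x - a))\<^sup>2)"
        by (intro cSUP_upper f bdd_aboveI[of _ "(norm x)\<^sup>2"]) auto
    qed simp
  qed
  then show "(norm x)\<^sup>2 = (SUP a\<in>A. 2 * inner x a - (norm a)\<^sup>2)" unfolding eq by simp
qed

fun argmin_upto :: "(nat \<Rightarrow> real) \<Rightarrow> nat \<Rightarrow> nat" where
  "argmin_upto a 0 = 0"
| "argmin_upto a (Suc n) = (if a (Suc n) < a (argmin_upto a n) then Suc n else argmin_upto a n)"

lemma argmin_upto_le: "argmin_upto a n \<le> n"
  by (induction n) (auto simp: le_SucI)

lemma argmin_upto_min: "i \<le> n \<Longrightarrow> a (argmin_upto a n) \<le> a i"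
  by (induction n) (auto simp: le_Suc_eq)

lemma measurable_argmin_upto [measurable]:
  assumes [measurable]: "\<And>i. (\<lambda>z. a i z) \<in> borel_measurable N"
  shows "(\<lambda>z. argmin_upto (\<lambda>i. a i z) n) \<in> N \<rightarrow>\<^sub>M count_space UNIV"
proof (induction n)
  case (Suc n)
  note [measurable] = Suc
  have "(\<lambda>z. if a (Suc n) z < a (argmin_upto (\<lambda>i. a i z) n) z then Suc n else argmin_upto (\<lambda>i. a i z) n)
     \<in> N \<rightarrow>\<^sub>M count_space UNIV"
    by measurable
  then show ?case by simp
qed simp

text \<open>Measurability is asked only of inner products with the generators
  \<open>j x \<phi>\<close>: the fibres vary with \<open>x\<close>, and
  \<open>x \<mapsto> j x \<phi>\<close> need not be measurable into the ambient space.\<close>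

definition field_section ::
  "('x \<Rightarrow> 'f::real_vector \<Rightarrow> 'h::real_inner) \<Rightarrow> 'x measure \<Rightarrow> ('x \<Rightarrow> 'h) \<Rightarrow> bool" where
  "field_section j N X \<longleftrightarrow>
     (\<forall>x\<in>space N. X x \<in> closure (range (j x))) \<and>
     (\<forall>\<phi>. (\<lambda>x. inner (X x) (j x \<phi>)) \<in> borel_measurable N)"

text \<open>A measurable field of Hilbert spaces with fundamental sequence \<open>j x (d i)\<close>.
  The zero vector stands first so that the nearest member of any initial segment is at most as far
  from \<open>X x\<close> as 0 is.\<close>

locale hilbert_field =
  fixes \<nu> :: "'x measure" and j :: "'x \<Rightarrow> 'f::real_vector \<Rightarrow> 'h::{real_inner, banach, second_countable_topology}"
    and d :: "nat \<Rightarrow> 'f"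
  assumes lin: "x \<in> space \<nu> \<Longrightarrow> linear (j x)"
    and inner_meas: "(\<lambda>x. inner (j x \<phi>) (j x \<psi>)) \<in> borel_measurable \<nu>"
    and d0: "d 0 = 0"
    and dense: "x \<in> space \<nu> \<Longrightarrow> range (j x) \<subseteq> closure (range (\<lambda>i. j x (d i)))"
begin

text \<open>The countable dense family turns the squared norm into a supremum of countably many
  functions that are measurable by assumption.\<close>

lemma field_section_norm:
  assumes "field_section j \<nu> X"
  shows "(\<lambda>x. norm (X x)) \<in> borel_measurable \<nu>"
proof -
  let ?f = "\<lambda>x i. 2 * inner (X x) (j x (d i)) - (norm (j x (d i)))\<^sup>2"
  have [measurable]: "(\<lambda>x. inner (X x) (j x \<phi>)) \<in> borel_measurable \<nu>" for \<phi>
    using assms by (simp add: field_section_def)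
  have [measurable]: "(\<lambda>x. (norm (j x \<phi>))\<^sup>2) \<in> borel_measurable \<nu>" for \<phi>
    using inner_meas[of \<phi> \<phi>] by (simp add: power2_norm_eq_inner)
  have X: "X x \<in> closure (range (\<lambda>i. j x (d i)))" if "x \<in> space \<nu>" for x
    using assms dense[OF that] closure_minimal[of "range (j x)" "closure (range (\<lambda>i. j x (d i)))"] that
    by (auto simp: field_section_def)
  note S = norm_power2_eq_SUP[OF X, unfolded image_image]
  have "(\<lambda>x. SUP i. ?f x i) \<in> borel_measurable \<nu>"
  proof (rule borel_measurable_cSUP)
    show "bdd_above ((\<lambda>i. ?f x i) ` UNIV)" if "x \<in> space \<nu>" for x using S(2)[OF that] by simp
  qed simp_all
  then have "(\<lambda>x. sqrt (SUP i. ?f x i)) \<in> borel_measurable \<nu>" by measurable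
  moreover have "sqrt (SUP i. ?f x i) = norm (X x)" if "x \<in> space \<nu>" for x
    using S(1)[OF that] by (metis norm_ge_zero real_sqrt_unique)
  ultimately show ?thesis by (simp cong: measurable_cong)
qed

lemma field_section_generator: "field_section j \<nu> (\<lambda>x. j x \<phi>)"
  using inner_meas closure_subset by (fastforce simp: field_section_def)

lemma field_section_add:
  assumes "field_section j \<nu> X" "field_section j \<nu> Y"
  shows "field_section j \<nu> (\<lambda>x. X x + Y x)"
proof -
  have "subspace (range (j x))" if "x \<in> space \<nu>" for x
    by (rule linear_subspace_image[OF lin[OF that] subspace_UNIV])
  with assms show ?thesis by (auto simp: field_section_def inner_add_left intro!: closure_add borel_measurable_add)
qed

lemma field_section_scaleR:
  assumes "field_section j \<nu> X" and [measurable]: "a \<in> borel_measurable \<nu>"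
  shows "field_section j \<nu> (\<lambda>x. a x *\<^sub>R X x)"
proof -
  have "subspace (range (j x))" if "x \<in> space \<nu>" for x
    by (rule linear_subspace_image[OF lin[OF that] subspace_UNIV])
  with assms show ?thesis by (auto simp: field_section_def intro!: closure_scaleR_mem borel_measurable_times)
qed

lemma field_section_zero: "field_section j \<nu> (\<lambda>x. 0)"
  using field_section_scaleR[OF field_section_generator, of "\<lambda>_. 0"] by simp

lemma field_section_diff:
  assumes "field_section j \<nu> X" "field_section j \<nu> Y"
  shows "field_section j \<nu> (\<lambda>x. X x - Y x)"
  using field_section_add[OF assms(1) field_section_scaleR[OF assms(2), of "\<lambda>_. -1"]] by simp

lemma field_section_sum:
  assumes "\<And>i. i \<in> I \<Longrightarrow> field_section j \<nu> (X i)"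
  shows "field_section j \<nu> (\<lambda>x. \<Sum>i\<in>I. X i x)"
  using assms by (induction I rule: infinite_finite_induct) (auto intro: field_section_add field_section_zero)

text \<open>The selection is recorded as an index in a countable set, where measurability makes
  sense however the fibres vary.\<close>

definition nearest :: "('x \<Rightarrow> 'h) \<Rightarrow> nat \<Rightarrow> 'x \<Rightarrow> nat" where
  "nearest X n x = argmin_upto (\<lambda>i. norm (X x - j x (d i))) n"

lemma nearest_le: "nearest X n x \<le> n"
  by (simp add: nearest_def argmin_upto_le)

lemma measurable_nearest:
  assumes "field_section j \<nu> X"
  shows "nearest X n \<in> \<nu> \<rightarrow>\<^sub>M count_space UNIV"
proof -
  have "(\<lambda>x. norm (X x - j x (d i))) \<in> borel_measurable \<nu>" for i
    by (intro field_section_norm field_section_diff assms field_section_generator)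
  from measurable_argmin_upto[OF this] show ?thesis
    unfolding nearest_def[abs_def] .
qed

lemma nearest_dist:
  assumes "x \<in> space \<nu>"
  shows "norm (X x - j x (d (nearest X n x))) \<le> norm (X x)"
  using argmin_upto_min[of 0 n "\<lambda>i. norm (X x - j x (d i))"] d0 linear_0[OF lin[OF assms]]
  by (simp add: nearest_def)

lemma nearest_tendsto:
  assumes "field_section j \<nu> X" and x: "x \<in> space \<nu>"
  shows "(\<lambda>n. j x (d (nearest X n x))) \<longlonglongrightarrow> X x"
proof (rule LIMSEQ_I)
  fix e :: real assume "0 < e"
  have "X x \<in> closure (range (\<lambda>i. j x (d i)))"
    using assms dense[OF x] closure_minimal[of "range (j x)" "closure (range (\<lambda>i. j x (d i)))"]
    by (auto simp: field_section_def)
  then obtain i where i: "norm (X x - j x (d i)) < e"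
    using \<open>0 < e\<close> unfolding closure_approachable by (auto simp: dist_norm norm_minus_commute)
  show "\<exists>no. \<forall>n\<ge>no. norm (j x (d (nearest X n x)) - X x) < e"
  proof (intro exI allI impI)
    fix n assume "i \<le> n"
    from argmin_upto_min[OF this, of "\<lambda>i. norm (X x - j x (d i))"] i
    show "norm (j x (d (nearest X n x)) - X x) < e" by (simp add: nearest_def norm_minus_commute)
  qed
qed

text \<open>Pulled back along \<open>fst\<close>, the field lives over the product with the
  parameter space, so sections depending on a parameter are covered by the same lemmas.\<close>

lemma field_section_compose:
  assumes "f \<in> N \<rightarrow>\<^sub>M \<nu>" shows "hilbert_field N (\<lambda>z. j (f z)) d"
proof (rule hilbert_field.intro)
  fix x assume "x \<in> space N"
  then have "f x \<in> space \<nu>" by (rule measurable_space[OF assms])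
  then show "linear (j (f x))" "range (j (f x)) \<subseteq> closure (range (\<lambda>i. j (f x) (d i)))"
    by (rule lin, rule dense)
qed (use d0 measurable_compose[OF assms inner_meas] in auto)

definition fnorm :: "('x \<Rightarrow> 'h) \<Rightarrow> ennreal" where
  "fnorm X = enorm2 \<nu> (\<lambda>x. ennreal (norm (X x)))"

definition L2_sections :: "('x \<Rightarrow> 'h) set" where
  "L2_sections = {X. field_section j \<nu> X \<and> fnorm X < \<infinity>}"

lemma fnorm_triangle_diff:
  assumes X: "field_section j \<nu> X" and Y: "field_section j \<nu> Y" and Z: "field_section j \<nu> Z"
  shows "fnorm (\<lambda>x. X x - Z x) \<le> fnorm (\<lambda>x. X x - Y x) + fnorm (\<lambda>x. Y x - Z x)"
proof -
  have [measurable]: "(\<lambda>x. norm (X x - Y x)) \<in> borel_measurable \<nu>" "(\<lambda>x. norm (Y x - Z x)) \<in> borel_measurable \<nu>"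
    by (intro field_section_norm field_section_diff assms)+
  have "norm (X x - Z x) \<le> norm (X x - Y x) + norm (Y x - Z x)" for x
    using norm_triangle_ineq[of "X x - Y x" "Y x - Z x"] by simp
  then have "fnorm (\<lambda>x. X x - Z x) \<le> enorm2 \<nu> (\<lambda>x. ennreal (norm (X x - Y x)) + ennreal (norm (Y x - Z x)))"
    unfolding fnorm_def by (intro enorm2_mono) (simp add: ennreal_plus[symmetric] ennreal_leI del: ennreal_plus)
  also have "\<dots> \<le> fnorm (\<lambda>x. X x - Y x) + fnorm (\<lambda>x. Y x - Z x)"
    unfolding fnorm_def by (intro enorm2_triangle) simp_all
  finally show ?thesis .
qed

lemma fnorm_mono: "(\<And>x. x \<in> space \<nu> \<Longrightarrow> norm (X x) \<le> norm (Y x)) \<Longrightarrow> fnorm X \<le> fnorm Y"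
  unfolding fnorm_def by (intro enorm2_mono) (auto intro: ennreal_leI)

lemma fnorm_scaleR: "fnorm (\<lambda>x. c *\<^sub>R X x) = ennreal \<bar>c\<bar> * fnorm X" if "field_section j \<nu> X"
proof -
  have [measurable]: "(\<lambda>x. norm (X x)) \<in> borel_measurable \<nu>" using that by (rule field_section_norm)
  have "(\<integral>\<^sup>+x. (ennreal \<bar>c\<bar> * ennreal (norm (X x)))\<^sup>2 \<partial>\<nu>) = (ennreal \<bar>c\<bar>)\<^sup>2 * (\<integral>\<^sup>+x. (ennreal (norm (X x)))\<^sup>2 \<partial>\<nu>)"
    by (simp add: power_mult_distrib nn_integral_cmult)
  then show ?thesis by (simp add: fnorm_def enorm2_def ennreal_mult ennsqrt_mult)
qed

lemma fnorm_add:
  assumes X: "field_section j \<nu> X" and Y: "field_section j \<nu> Y"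
  shows "fnorm (\<lambda>x. X x + Y x) \<le> fnorm X + fnorm Y"
  using fnorm_triangle_diff[OF X field_section_zero field_section_scaleR[OF Y, of "\<lambda>_. -1"]] by simp

lemma L2_sections_add: "X \<in> L2_sections \<Longrightarrow> Y \<in> L2_sections \<Longrightarrow> (\<lambda>x. X x + Y x) \<in> L2_sections"
  using fnorm_add[of X Y] field_section_add[of X Y]
  by (auto simp: L2_sections_def less_top[symmetric] top_unique)

lemma L2_sections_scaleR: "X \<in> L2_sections \<Longrightarrow> (\<lambda>x. c *\<^sub>R X x) \<in> L2_sections"
  unfolding L2_sections_def using fnorm_scaleR field_section_scaleR[of X "\<lambda>_. c"]
  by (auto simp: ennreal_mult_less_top)

lemma L2_sections_diff: "X \<in> L2_sections \<Longrightarrow> Y \<in> L2_sections \<Longrightarrow> (\<lambda>x. X x - Y x) \<in> L2_sections"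
  using L2_sections_add[OF _ L2_sections_scaleR[of Y "-1"]] by simp

lemma L2_sections_zero: "(\<lambda>x. 0) \<in> L2_sections"
  by (simp add: L2_sections_def field_section_zero fnorm_def enorm2_def)

end

text \<open>In a single fibre the field is constant, and weak measurability becomes strong: the
  nearest members of the dense sequence are measurable approximations with finitely many values,
  dominated by \<open>2 * norm (f e)\<close>. Their integrals lie in \<open>range j\<close>, so the
  limit lies in its closure.\<close>

lemma borel_measurable_closed_range:
  fixes f :: "'e \<Rightarrow> 'h::{real_inner, banach, second_countable_topology}"
    and j :: "'f::real_vector \<Rightarrow> 'h" and d :: "nat \<Rightarrow> 'f"
  assumes j: "linear j" and d: "d 0 = 0" "range j \<subseteq> closure (range (\<lambda>i. j (d i)))"
    and f: "\<And>e. e \<in> space R \<Longrightarrow> f e \<in> closure (range j)"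
    and m: "\<And>\<phi>. (\<lambda>e. inner (f e) (j \<phi>)) \<in> borel_measurable R"
  shows "f \<in> borel_measurable R" and "integral\<^sup>L R f \<in> closure (range j)"
proof -
  interpret hilbert_field R "\<lambda>_. j" d
    by (rule hilbert_field.intro) (use assms in auto)
  have sec: "field_section (\<lambda>_. j) R f" using f m by (simp add: field_section_def)
  note [measurable] = measurable_nearest[OF sec]
  let ?Z = "\<lambda>n e. j (d (nearest f n e))"
  have Z [measurable]: "?Z n \<in> borel_measurable R" for n
    by (rule measurable_compose[OF measurable_nearest[OF sec]]) simp
  show fm [measurable]: "f \<in> borel_measurable R"
    by (rule borel_measurable_LIMSEQ_metric[OF Z]) (rule nearest_tendsto[OF sec])
  have sub: "subspace (range j)" by (rule linear_subspace_image[OF j subspace_UNIV])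
  \<comment> \<open>Covers the convention that a non-integrable function has integral 0.\<close>
  have 0: "0 \<in> closure (range j)" by (rule subsetD[OF closure_subset subspace_0[OF sub]])
  show "integral\<^sup>L R f \<in> closure (range j)"
  proof (cases "integrable R f")
    case True
    have bnd: "norm (?Z n e) \<le> 2 * norm (f e)" if "e \<in> space R" for n e
      using nearest_dist[OF that, of f n] norm_triangle_ineq2[of "?Z n e" "f e"] by (simp add: norm_minus_commute)
    have conv: "(\<lambda>n. integral\<^sup>L R (?Z n)) \<longlonglongrightarrow> integral\<^sup>L R f"
    proof (rule integral_dominated_convergence[where w="\<lambda>e. 2 * norm (f e)"])
      show "AE e in R. (\<lambda>n. ?Z n e) \<longlonglongrightarrow> f e" by (intro AE_I2 nearest_tendsto sec)
      show "AE e in R. norm (?Z n e) \<le> 2 * norm (f e)" for n by (intro AE_I2 bnd)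
    qed (use True in auto)
    have "integral\<^sup>L R (?Z n) \<in> range j" for n
    proof -
      let ?g = "\<lambda>i e. indicator {e \<in> space R. nearest f n e = i} e *\<^sub>R j (d i)"
      have gm: "?g i \<in> borel_measurable R" for i by measurable
      have gi: "integrable R (?g i)" for i
      proof (rule Bochner_Integration.integrable_bound[OF integrable_mult_right[OF integrable_norm[OF True], of 2] gm])
        show "AE e in R. norm (?g i e) \<le> norm (2 * norm (f e))"
          using bnd[of _ n] by (intro AE_I2) (auto split: split_indicator)
      qed
      \<comment> \<open>A zero value may be taken on a set of infinite measure; integrability of
        \<open>?g i\<close> yields that of the indicator only when \<open>j (d i)\<close> is
        nonzero.\<close>
      have "integral\<^sup>L R (?g i) \<in> range j" for i
      proof (cases "j (d i) = 0")
        case False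
        have "integral\<^sup>L R (?g i) = measure R {e \<in> space R. nearest f n e = i} *\<^sub>R j (d i)"
        proof (subst integral_scaleR_left)
          have "integrable R (\<lambda>e. norm (?g i e) / norm (j (d i)))"
            by (intro integrable_divide integrable_norm gi)
          then show "integrable R (indicator {e \<in> space R. nearest f n e = i} :: _ \<Rightarrow> real)"
            using False by simp
        qed simp
        then show ?thesis by (simp add: subspace_scale[OF sub])
      qed (simp add: subspace_0[OF sub])
      moreover have "integral\<^sup>L R (?Z n) = (\<integral>e. (\<Sum>i\<le>n. ?g i e) \<partial>R)"
      proof (intro Bochner_Integration.integral_cong refl)
        fix e assume e: "e \<in> space R"
        have "(\<Sum>i\<le>n. ?g i e) = (\<Sum>i\<le>n. if i = nearest f n e then j (d i) else 0)"
          using e by (intro sum.cong) auto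
        then show "?Z n e = (\<Sum>i\<le>n. ?g i e)" using nearest_le[of f n e] by simp
      qed
      moreover have "\<dots> = (\<Sum>i\<le>n. integral\<^sup>L R (?g i))"
        using gi by (intro Bochner_Integration.integral_sum) auto
      ultimately show ?thesis by (simp only: subspace_sum[OF sub])
    qed
    then show ?thesis
      unfolding closure_sequential by (intro exI[of _ "\<lambda>n. integral\<^sup>L R (?Z n)"] conjI allI conv)
  qed (use 0 in \<open>simp add: not_integrable_integral_eq\<close>)
qed


section \<open>Sections with a parameter and their approximation by simple functions\<close>

lemma field_section_cong:
  "(\<And>x. x \<in> space N \<Longrightarrow> X x = Y x) \<Longrightarrow> field_section j N X \<longleftrightarrow> field_section j N Y"
  unfolding field_section_def by (intro conj_cong ball_cong all_cong1 measurable_cong) auto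

locale hilbert_field_pair = hilbert_field \<nu> j d + \<nu>: sigma_finite_measure \<nu> + \<rho>: sigma_finite_measure \<rho>
  for \<nu> :: "'x measure" and j :: "'x \<Rightarrow> 'f::real_vector \<Rightarrow> 'h::{real_inner, banach, second_countable_topology}"
    and d and \<rho> :: "'e measure"

sublocale hilbert_field_pair \<subseteq> prod: hilbert_field "\<nu> \<Otimes>\<^sub>M \<rho>" "\<lambda>z. j (fst z)" d
  by (rule field_section_compose[OF measurable_fst])

context hilbert_field_pair
begin

abbreviation pair_section :: "('x \<times> 'e \<Rightarrow> 'h) \<Rightarrow> bool" where
  "pair_section X \<equiv> field_section (\<lambda>z. j (fst z)) (\<nu> \<Otimes>\<^sub>M \<rho>) X"

text \<open>The norm of L1 in the parameter with values in the square integrable sections. For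
  integrands it is the quantity required to be finite in \<open>Xi12w\<close>.\<close>

definition pair_norm :: "('x \<times> 'e \<Rightarrow> 'h) \<Rightarrow> ennreal" where
  "pair_norm X = (\<integral>\<^sup>+e. fnorm (\<lambda>x. X (x, e)) \<partial>\<rho>)"

lemma section_fst:
  assumes "pair_section X" "e \<in> space \<rho>"
  shows "field_section j \<nu> (\<lambda>x. X (x, e))"
  unfolding field_section_def
proof (intro conjI ballI allI)
  show "X (x, e) \<in> closure (range (j x))" if "x \<in> space \<nu>" for x
    using assms that by (auto simp: field_section_def space_pair_measure)
  have "(\<lambda>z. inner (X z) (j (fst z) \<phi>)) \<in> borel_measurable (\<nu> \<Otimes>\<^sub>M \<rho>)" for \<phi>
    using assms by (simp add: field_section_def)
  from measurable_compose[OF measurable_Pair2'[OF assms(2)] this]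
  show "(\<lambda>x. inner (X (x, e)) (j x \<phi>)) \<in> borel_measurable \<nu>" for \<phi> by simp
qed

lemma section_snd:
  assumes "pair_section X" "x \<in> space \<nu>"
  shows "\<And>e. e \<in> space \<rho> \<Longrightarrow> X (x, e) \<in> closure (range (j x))"
    and "(\<lambda>e. inner (X (x, e)) (j x \<phi>)) \<in> borel_measurable \<rho>"
proof -
  show "X (x, e) \<in> closure (range (j x))" if "e \<in> space \<rho>" for e
    using assms that by (auto simp: field_section_def space_pair_measure)
  have "(\<lambda>z. inner (X z) (j (fst z) \<phi>)) \<in> borel_measurable (\<nu> \<Otimes>\<^sub>M \<rho>)"
    using assms by (simp add: field_section_def)
  from measurable_compose[OF measurable_Pair1'[OF assms(2)] this]
  show "(\<lambda>e. inner (X (x, e)) (j x \<phi>)) \<in> borel_measurable \<rho>" by simp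
qed

lemma pair_section_fst:
  assumes "field_section j \<nu> Y" shows "pair_section (\<lambda>z. Y (fst z))"
  unfolding field_section_def
proof (intro conjI ballI allI)
  show "Y (fst z) \<in> closure (range (j (fst z)))" if "z \<in> space (\<nu> \<Otimes>\<^sub>M \<rho>)" for z
    using assms that by (auto simp: field_section_def space_pair_measure)
  have "(\<lambda>x. inner (Y x) (j x \<phi>)) \<in> borel_measurable \<nu>" for \<phi>
    using assms by (simp add: field_section_def)
  from measurable_compose[OF measurable_fst this]
  show "(\<lambda>z. inner (Y (fst z)) (j (fst z) \<phi>)) \<in> borel_measurable (\<nu> \<Otimes>\<^sub>M \<rho>)" for \<phi> .
qed

lemma measurable_fnorm_section:
  assumes "pair_section X"
  shows "(\<lambda>e. fnorm (\<lambda>x. X (x, e))) \<in> borel_measurable \<rho>"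
proof -
  have [measurable]: "(\<lambda>z. norm (X z)) \<in> borel_measurable (\<nu> \<Otimes>\<^sub>M \<rho>)"
    by (rule prod.field_section_norm[OF assms])
  show ?thesis unfolding fnorm_def enorm2_def by measurable
qed

lemma measurable_section_snd:
  assumes "pair_section X" "x \<in> space \<nu>"
  shows "(\<lambda>e. X (x, e)) \<in> borel_measurable \<rho>" "(\<integral>e. X (x, e) \<partial>\<rho>) \<in> closure (range (j x))"
  using borel_measurable_closed_range[OF lin[OF assms(2)] d0 dense[OF assms(2)] section_snd[OF assms]]
  by blast+

lemma pair_norm_triangle_diff:
  assumes X: "pair_section X" and Y: "pair_section Y" and Z: "pair_section Z"
  shows "pair_norm (\<lambda>z. X z - Z z) \<le> pair_norm (\<lambda>z. X z - Y z) + pair_norm (\<lambda>z. Y z - Z z)"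
proof -
  have [measurable]: "(\<lambda>e. fnorm (\<lambda>x. X (x, e) - Y (x, e))) \<in> borel_measurable \<rho>"
     "(\<lambda>e. fnorm (\<lambda>x. Y (x, e) - Z (x, e))) \<in> borel_measurable \<rho>"
    by (intro measurable_fnorm_section prod.field_section_diff assms)+
  have "pair_norm (\<lambda>z. X z - Z z) \<le>
      (\<integral>\<^sup>+e. fnorm (\<lambda>x. X (x, e) - Y (x, e)) + fnorm (\<lambda>x. Y (x, e) - Z (x, e)) \<partial>\<rho>)"
    unfolding pair_norm_def by (intro nn_integral_mono fnorm_triangle_diff section_fst assms)
  also have "\<dots> = pair_norm (\<lambda>z. X z - Y z) + pair_norm (\<lambda>z. Y z - Z z)"
    unfolding pair_norm_def by (intro nn_integral_add) simp_all
  finally show ?thesis .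
qed

lemma pair_norm_minus: "pair_norm (\<lambda>z. X z - Y z) = pair_norm (\<lambda>z. Y z - X z)"
  by (simp add: pair_norm_def fnorm_def norm_minus_commute)

text \<open>Dominated convergence is used twice: over \<open>\<nu>\<close> for each parameter at
  which the dominating section has finite norm, and then over \<open>\<rho>\<close>, where these
  norms are integrable.\<close>

lemma pair_norm_dominated:
  assumes X: "pair_section X" "\<And>n. pair_section (Xn n)" and G: "pair_section G" "pair_norm G < \<infinity>"
    and lim: "\<And>z. z \<in> space (\<nu> \<Otimes>\<^sub>M \<rho>) \<Longrightarrow> (\<lambda>n. Xn n z) \<longlonglongrightarrow> X z"
    and bnd: "\<And>n z. z \<in> space (\<nu> \<Otimes>\<^sub>M \<rho>) \<Longrightarrow> norm (X z - Xn n z) \<le> norm (G z)"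
  shows "(\<lambda>n. pair_norm (\<lambda>z. X z - Xn n z)) \<longlonglongrightarrow> 0"
proof -
  have dm: "pair_section (\<lambda>z. X z - Xn n z)" for n by (intro prod.field_section_diff X)
  note [measurable] = measurable_fnorm_section[OF dm] measurable_fnorm_section[OF G(1)]
  have fin: "AE e in \<rho>. fnorm (\<lambda>x. G (x, e)) \<noteq> \<infinity>"
    using G(2) by (intro nn_integral_PInf_AE) (auto simp: pair_norm_def)
  have "(\<lambda>n. \<integral>\<^sup>+e. fnorm (\<lambda>x. X (x, e) - Xn n (x, e)) \<partial>\<rho>) \<longlonglongrightarrow> (\<integral>\<^sup>+e. 0 \<partial>\<rho>)"
  proof (rule nn_integral_dominated_convergence[where w="\<lambda>e. fnorm (\<lambda>x. G (x, e))"])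
    show "AE e in \<rho>. fnorm (\<lambda>x. X (x, e) - Xn n (x, e)) \<le> fnorm (\<lambda>x. G (x, e))" for n
      by (intro AE_I2 fnorm_mono bnd) (simp add: space_pair_measure)
    show "AE e in \<rho>. (\<lambda>n. fnorm (\<lambda>x. X (x, e) - Xn n (x, e))) \<longlonglongrightarrow> 0"
      using fin AE_space
    proof eventually_elim
      fix e assume fin: "fnorm (\<lambda>x. G (x, e)) \<noteq> \<infinity>" and e: "e \<in> space \<rho>"
      have [measurable]: "(\<lambda>x. norm (X (x, e) - Xn n (x, e))) \<in> borel_measurable \<nu>"
        "(\<lambda>x. norm (G (x, e))) \<in> borel_measurable \<nu>" for n
        using field_section_norm[OF section_fst[OF dm e]] field_section_norm[OF section_fst[OF G(1) e]] by auto
      have "(\<lambda>n. \<integral>\<^sup>+x. (ennreal (norm (X (x, e) - Xn n (x, e))))\<^sup>2 \<partial>\<nu>) \<longlonglongrightarrow> (\<integral>\<^sup>+x. 0 \<partial>\<nu>)"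
      proof (rule nn_integral_dominated_convergence[where w="\<lambda>x. (ennreal (norm (G (x, e))))\<^sup>2"])
        show "AE x in \<nu>. (ennreal (norm (X (x, e) - Xn n (x, e))))\<^sup>2 \<le> (ennreal (norm (G (x, e))))\<^sup>2" for n
          using e by (intro AE_I2) (simp add: ennreal_power2_mono_iff ennreal_leI bnd space_pair_measure)
        show "(\<integral>\<^sup>+x. (ennreal (norm (G (x, e))))\<^sup>2 \<partial>\<nu>) < \<infinity>"
          using fin by (simp add: fnorm_def enorm2_def less_top)
        show "AE x in \<nu>. (\<lambda>n. (ennreal (norm (X (x, e) - Xn n (x, e))))\<^sup>2) \<longlonglongrightarrow> 0"
        proof (intro AE_I2)
          fix x assume "x \<in> space \<nu>"
          then have "(\<lambda>n. Xn n (x, e)) \<longlonglongrightarrow> X (x, e)" using e lim by (simp add: space_pair_measure)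
          then have "(\<lambda>n. ennreal ((norm (X (x, e) - Xn n (x, e)))\<^sup>2)) \<longlonglongrightarrow> ennreal ((norm (X (x, e) - X (x, e)))\<^sup>2)"
            by (intro tendsto_intros)
          then show "(\<lambda>n. (ennreal (norm (X (x, e) - Xn n (x, e))))\<^sup>2) \<longlonglongrightarrow> 0"
            by (simp add: ennreal_power)
        qed
      qed simp_all
      then show "(\<lambda>n. fnorm (\<lambda>x. X (x, e) - Xn n (x, e))) \<longlonglongrightarrow> 0"
        unfolding fnorm_def enorm2_def by (intro tendsto_ennsqrt_0) simp
    qed
  qed (use G(2) in \<open>simp_all add: pair_norm_def\<close>)
  then show ?thesis by (simp add: pair_norm_def)
qed

abbreviation simple_sections :: "('e \<Rightarrow> 'x \<Rightarrow> 'h) \<Rightarrow> bool" where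
  "simple_sections S \<equiv> Bochner_Integration.simple_bochner_integrable \<rho> S \<and> S ` space \<rho> \<subseteq> L2_sections"

text \<open>Joint measurability is not evident for a function of \<open>e\<close> whose values are
  functions of \<open>x\<close>. It results from writing \<open>S\<close> as the finite sum of its
  values, each multiplied by the indicator of its level set.\<close>

lemma simple_sections_pair_section:
  assumes "simple_sections S"
  shows "pair_section (\<lambda>z. S (snd z) (fst z))"
proof -
  have sf: "simple_function \<rho> S" using assms by (auto elim: simple_bochner_integrable.cases)
  then have fin: "finite (S ` space \<rho>)" and m: "\<And>Y. S -` {Y} \<inter> space \<rho> \<in> sets \<rho>"
    by (auto simp: simple_functionD)
  have "pair_section (\<lambda>z. \<Sum>Y\<in>S ` space \<rho>. indicator (S -` {Y} \<inter> space \<rho>) (snd z) *\<^sub>R Y (fst z))"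
  proof (intro prod.field_section_sum prod.field_section_scaleR pair_section_fst)
    show "field_section j \<nu> Y" if "Y \<in> S ` space \<rho>" for Y using assms that by (auto simp: L2_sections_def)
    show "(\<lambda>z. indicat_real (S -` {Y} \<inter> space \<rho>) (snd z)) \<in> borel_measurable (\<nu> \<Otimes>\<^sub>M \<rho>)" for Y
      by (rule measurable_compose[OF measurable_snd borel_measurable_indicator[OF m]])
  qed
  moreover have "(\<Sum>Y\<in>S ` space \<rho>. indicator (S -` {Y} \<inter> space \<rho>) (snd z) *\<^sub>R Y (fst z)) = S (snd z) (fst z)"
    if "z \<in> space (\<nu> \<Otimes>\<^sub>M \<rho>)" for z
  proof -
    have e: "snd z \<in> space \<rho>" using that by (auto simp: space_pair_measure)
    then have "(\<Sum>Y\<in>S ` space \<rho>. indicator (S -` {Y} \<inter> space \<rho>) (snd z) *\<^sub>R Y (fst z)) =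
        (\<Sum>Y\<in>S ` space \<rho>. if Y = S (snd z) then Y (fst z) else 0)"
      by (intro sum.cong) auto
    then show ?thesis using fin e by simp
  qed
  ultimately show ?thesis by (rule field_section_cong[THEN iffD1, rotated])
qed

definition approximable :: "('x \<times> 'e \<Rightarrow> 'h) \<Rightarrow> bool" where
  "approximable X \<longleftrightarrow> pair_section X \<and>
     (\<forall>\<epsilon>>0. \<exists>S. simple_sections S \<and> pair_norm (\<lambda>z. X z - S (snd z) (fst z)) < \<epsilon>)"

lemma ennreal_top_power2: "(\<top>::ennreal)\<^sup>2 = \<top>"
  by (simp add: power2_eq_square)

lemma ennreal_half_pos: "(0::ennreal) < e \<Longrightarrow> 0 < e / 2"
  by (simp add: ennreal_zero_less_divide)

lemma ennreal_less_halves: "a < e / 2 \<Longrightarrow> b < e / 2 \<Longrightarrow> a + b < (e::ennreal)"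
proof (cases e; cases a; cases b)
  fix r s t :: real
  assume *: "0 \<le> r" "e = ennreal r" "0 \<le> s" "a = ennreal s" "0 \<le> t" "b = ennreal t"
    and "a < e / 2" "b < e / 2"
  moreover have "e / 2 = ennreal (r / 2)"
    using * divide_ennreal[of r 2] by simp
  ultimately have "s < r / 2" "t < r / 2" by (simp_all add: ennreal_less_iff)
  with * show "a + b < e" by (simp add: ennreal_plus[symmetric] ennreal_less_iff del: ennreal_plus)
qed (auto simp: ennreal_plus[symmetric] simp del: ennreal_plus)

lemma approximable_limit:
  assumes X: "pair_section X" and "\<And>\<epsilon>. 0 < \<epsilon> \<Longrightarrow> \<exists>Y. approximable Y \<and> pair_norm (\<lambda>z. X z - Y z) < \<epsilon>"
  shows "approximable X"
  unfolding approximable_def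
proof (intro conjI X allI impI)
  fix \<epsilon> :: ennreal assume "0 < \<epsilon>"
  then have e: "0 < \<epsilon> / 2" by (rule ennreal_half_pos)
  obtain Y where Y: "approximable Y" "pair_norm (\<lambda>z. X z - Y z) < \<epsilon> / 2" using assms(2)[OF e] by blast
  then obtain S where S: "simple_sections S" "pair_norm (\<lambda>z. Y z - S (snd z) (fst z)) < \<epsilon> / 2"
    using e by (auto simp: approximable_def)
  have "pair_norm (\<lambda>z. X z - S (snd z) (fst z)) < \<epsilon>"
    using pair_norm_triangle_diff[OF X _ simple_sections_pair_section[OF S(1)], of Y] Y
      ennreal_less_halves[OF Y(2) S(2)] by (auto simp: approximable_def intro: le_less_trans)
  with S show "\<exists>S. simple_sections S \<and> pair_norm (\<lambda>z. X z - S (snd z) (fst z)) < \<epsilon>" by blast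
qed

lemma simple_sections_diff:
  assumes "simple_sections S" "simple_sections S'"
  shows "simple_sections (\<lambda>e. S e - S' e)"
  using assms simple_bochner_integrable_compose2[of "(-)" \<rho> S S'] L2_sections_diff
  by (auto simp: fun_diff_def image_subset_iff)

lemma approximable_diff:
  assumes X: "approximable X" and Y: "approximable Y"
  shows "approximable (\<lambda>z. X z - Y z)"
  unfolding approximable_def
proof (intro conjI allI impI)
  show "pair_section (\<lambda>z. X z - Y z)"
    using assms by (intro prod.field_section_diff) (auto simp: approximable_def)
  fix \<epsilon> :: ennreal assume "0 < \<epsilon>"
  then have e: "0 < \<epsilon> / 2" by (rule ennreal_half_pos)
  obtain S where S: "simple_sections S" "pair_norm (\<lambda>z. X z - S (snd z) (fst z)) < \<epsilon> / 2"
    using X e by (auto simp: approximable_def)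
  obtain S' where S': "simple_sections S'" "pair_norm (\<lambda>z. Y z - S' (snd z) (fst z)) < \<epsilon> / 2"
    using Y e by (auto simp: approximable_def)
  let ?A = "\<lambda>z. X z - S (snd z) (fst z)" and ?B = "\<lambda>z. Y z - S' (snd z) (fst z)"
  have "pair_section ?A" "pair_section ?B"
    using assms S(1) S'(1) by (auto intro!: prod.field_section_diff simple_sections_pair_section simp: approximable_def)
  then have "pair_norm (\<lambda>z. ?A z - ?B z) \<le> pair_norm (\<lambda>z. ?A z - 0) + pair_norm (\<lambda>z. 0 - ?B z)"
    by (rule pair_norm_triangle_diff[OF _ prod.field_section_zero])
  also have "pair_norm (\<lambda>z. 0 - ?B z) = pair_norm (\<lambda>z. ?B z - 0)" by (rule pair_norm_minus)
  also have "pair_norm (\<lambda>z. ?A z - 0) + pair_norm (\<lambda>z. ?B z - 0) < \<epsilon>"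
    using ennreal_less_halves[OF S(2) S'(2)] by simp
  finally have "pair_norm (\<lambda>z. (X z - Y z) - (S (snd z) - S' (snd z)) (fst z)) < \<epsilon>"
    by (simp add: algebra_simps)
  with simple_sections_diff[OF S(1) S'(1)]
  show "\<exists>S. simple_sections S \<and> pair_norm (\<lambda>z. X z - Y z - S (snd z) (fst z)) < \<epsilon>" by blast
qed

lemma approximable_zero: "approximable (\<lambda>z. 0)"
proof -
  have "simple_sections (\<lambda>e. 0)"
    using L2_sections_zero by (auto simp: zero_fun_def simple_bochner_integrable.simps)
  then show ?thesis
    unfolding approximable_def
    by (intro conjI prod.field_section_zero allI impI exI[of _ "\<lambda>e. 0"])
      (auto simp: pair_norm_def fnorm_def enorm2_def)
qed

lemma approximable_add:
  assumes "approximable X" "approximable Y" shows "approximable (\<lambda>z. X z + Y z)"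
  using approximable_diff[OF assms(1) approximable_diff[OF approximable_zero assms(2)]] by simp

lemma approximable_sum:
  assumes "\<And>i. i \<in> I \<Longrightarrow> approximable (X i)" shows "approximable (\<lambda>z. \<Sum>i\<in>I. X i z)"
  using assms by (induction I rule: infinite_finite_induct) (auto intro: approximable_add approximable_zero)

lemma approximable_cong:
  assumes "\<And>z. z \<in> space (\<nu> \<Otimes>\<^sub>M \<rho>) \<Longrightarrow> X z = Y z" "approximable X" shows "approximable Y"
proof -
  have "pair_norm (\<lambda>z. X z - W z) = pair_norm (\<lambda>z. Y z - W z)" for W
    unfolding pair_norm_def
    by (intro nn_integral_cong antisym fnorm_mono) (use assms(1) in \<open>auto simp: space_pair_measure\<close>)
  moreover have "pair_section X = pair_section Y" by (rule field_section_cong[OF assms(1)])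
  ultimately show ?thesis using assms(2) unfolding approximable_def by metis
qed

text \<open>The rectangle is itself simple in \<open>e\<close>: one fixed section on
  \<open>B\<close>, zero elsewhere. Finite measure of \<open>B\<close> gives the finite support that
  simple integrability demands.\<close>

lemma approximable_rectangle:
  assumes A: "A \<in> sets \<nu>" and B: "B \<in> sets \<rho>" "emeasure \<rho> B < \<infinity>"
    and fin: "fnorm (\<lambda>x. indicator A x *\<^sub>R j x \<phi>) < \<infinity>"
  shows "approximable (\<lambda>z. indicator (A \<times> B) z *\<^sub>R j (fst z) \<phi>)"
proof -
  define Y where "Y = (\<lambda>x. indicator A x *\<^sub>R j x \<phi>)"
  have Y: "Y \<in> L2_sections"
    using A fin by (auto simp: L2_sections_def Y_def intro!: field_section_scaleR field_section_generator)
  define S where "S e = (if e \<in> B then Y else 0)" for e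
  have "simple_function \<rho> S"
    unfolding S_def[abs_def] using B by (intro simple_function_If_set) auto
  moreover have "emeasure \<rho> {e \<in> space \<rho>. S e \<noteq> 0} \<le> emeasure \<rho> B"
    using B by (intro emeasure_mono) (auto simp: S_def)
  ultimately have "Bochner_Integration.simple_bochner_integrable \<rho> S"
    using B(2) by (intro simple_bochner_integrable.intros) (auto simp: top_unique)
  moreover have "S ` space \<rho> \<subseteq> L2_sections"
    using Y L2_sections_zero by (auto simp: S_def zero_fun_def)
  ultimately have "simple_sections S" by blast
  moreover have "indicator (A \<times> B) z *\<^sub>R j (fst z) \<phi> = S (snd z) (fst z)" for z
    by (cases z) (auto simp: S_def Y_def split: split_indicator)
  ultimately show ?thesis
    using simple_sections_pair_section[of S]
    by (auto simp: approximable_def pair_norm_def fnorm_def enorm2_def intro!: exI[of _ S])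
qed

text \<open>Intersecting with one rectangle of finite norm makes the Dynkin steps possible: a
  complement becomes a difference from the section over \<open>A \<times> B\<close>, and the same
  section dominates the partial sums of a disjoint union.\<close>

lemma approximable_indicator:
  assumes A: "A \<in> sets \<nu>" and B: "B \<in> sets \<rho>" "emeasure \<rho> B < \<infinity>"
    and fin: "fnorm (\<lambda>x. indicator A x *\<^sub>R j x \<phi>) < \<infinity>"
    and C: "C \<in> sets (\<nu> \<Otimes>\<^sub>M \<rho>)"
  shows "approximable (\<lambda>z. indicator (C \<inter> A \<times> B) z *\<^sub>R j (fst z) \<phi>)"
  using C unfolding sets_pair_measure
proof (induct rule: sigma_sets_induct_disjoint[OF Int_stable_pair_measure_generator pair_measure_closed, consumes 1])
  case (1 C)
  then obtain a b where ab: "C = a \<times> b" "a \<in> sets \<nu>" "b \<in> sets \<rho>" by auto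
  have "fnorm (\<lambda>x. indicator (a \<inter> A) x *\<^sub>R j x \<phi>) \<le> fnorm (\<lambda>x. indicator A x *\<^sub>R j x \<phi>)"
    by (intro fnorm_mono) (auto split: split_indicator)
  moreover have "emeasure \<rho> (b \<inter> B) \<le> emeasure \<rho> B" using B by (intro emeasure_mono) auto
  ultimately have "approximable (\<lambda>z. indicator ((a \<inter> A) \<times> (b \<inter> B)) z *\<^sub>R j (fst z) \<phi>)"
    using ab A B fin by (intro approximable_rectangle) auto
  then show ?case by (simp add: ab Times_Int_Times)
next
  case 2
  show ?case by (simp add: approximable_zero)
next
  case (3 C)
  have "approximable (\<lambda>z. indicator (A \<times> B) z *\<^sub>R j (fst z) \<phi> - indicator (C \<inter> A \<times> B) z *\<^sub>R j (fst z) \<phi>)"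
    by (intro approximable_diff approximable_rectangle assms 3)
  then show ?case
    by (rule approximable_cong[rotated]) (auto simp: space_pair_measure split: split_indicator)
next
  case (4 C)
  let ?G = "\<lambda>C z. indicator (C \<inter> A \<times> B) z *\<^sub>R j (fst z) \<phi>"
  let ?S = "\<lambda>n z. \<Sum>i<n. ?G (C i) z"
  have C: "C i \<in> sets (\<nu> \<Otimes>\<^sub>M \<rho>)" for i using 4(2) by (auto simp: sets_pair_measure)
  have AB: "A \<times> B \<in> sets (\<nu> \<Otimes>\<^sub>M \<rho>)" using A B by simp
  have sec: "pair_section (?G D)" if "D \<in> sets (\<nu> \<Otimes>\<^sub>M \<rho>)" for D
    using that AB by (intro prod.field_section_scaleR prod.field_section_generator) simp
  have S: "?S n z = ?G (\<Union>i<n. C i) z" for n z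
    unfolding scaleR_sum_left[symmetric]
    using 4(1) by (subst indicator_UN_disjoint[symmetric])
      (auto simp: disjoint_family_on_def indicator_inter_arith sum_distrib_right[symmetric] split: split_indicator)
  have "(\<lambda>n. pair_norm (\<lambda>z. ?G (\<Union>i. C i) z - ?S n z)) \<longlonglongrightarrow> 0"
  proof (rule pair_norm_dominated[where G="\<lambda>z. indicator (A \<times> B) z *\<^sub>R j (fst z) \<phi>"])
    show "pair_section (\<lambda>z. indicator (A \<times> B) z *\<^sub>R j (fst z) \<phi>)"
      using AB by (intro prod.field_section_scaleR prod.field_section_generator) simp
    have "pair_norm (\<lambda>z. indicator (A \<times> B) z *\<^sub>R j (fst z) \<phi>) =
        (\<integral>\<^sup>+e. indicator B e * fnorm (\<lambda>x. indicator A x *\<^sub>R j x \<phi>) \<partial>\<rho>)"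
      unfolding pair_norm_def by (intro nn_integral_cong)
        (auto simp: indicator_times fnorm_def enorm2_def split: split_indicator)
    also have "\<dots> = emeasure \<rho> B * fnorm (\<lambda>x. indicator A x *\<^sub>R j x \<phi>)"
      using B by (simp add: nn_integral_multc)
    also have "\<dots> < \<infinity>" using B fin by (simp add: ennreal_mult_less_top)
    finally show "pair_norm (\<lambda>z. indicator (A \<times> B) z *\<^sub>R j (fst z) \<phi>) < \<infinity>" .
    show "(\<lambda>n. ?S n z) \<longlonglongrightarrow> ?G (\<Union>i. C i) z" for z
    proof (rule tendsto_eventually)
      have "\<exists>N. \<forall>n\<ge>N. z \<in> (\<Union>i<n. C i) \<longleftrightarrow> z \<in> (\<Union>i. C i)"
      proof (cases "z \<in> (\<Union>i. C i)")
        case True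
        then obtain i where "z \<in> C i" by auto
        then show ?thesis by (intro exI[of _ "Suc i"]) auto
      qed auto
      then obtain N where "\<And>n. N \<le> n \<Longrightarrow> z \<in> (\<Union>i<n. C i) \<longleftrightarrow> z \<in> (\<Union>i. C i)" by blast
      then have "?S n z = ?G (\<Union>i. C i) z" if "N \<le> n" for n
        unfolding S using that by (simp add: indicator_def)
      then show "\<forall>\<^sub>F n in sequentially. ?S n z = ?G (\<Union>i. C i) z"
        unfolding eventually_sequentially by blast
    qed
    show "norm (?G (\<Union>i. C i) z - ?S n z) \<le> norm (indicator (A \<times> B) z *\<^sub>R j (fst z) \<phi>)" for n z
      unfolding S by (auto split: split_indicator)
    show "pair_section (?S n)" for n by (intro prod.field_section_sum sec C)
    show "pair_section (?G (\<Union>i. C i))" using C by (intro sec) auto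
  qed
  then have lim: "\<exists>n. pair_norm (\<lambda>z. ?G (\<Union>i. C i) z - ?S n z) < \<epsilon>" if "0 < \<epsilon>" for \<epsilon>
    using that unfolding tendsto_ennreal_0_iff eventually_sequentially by blast
  show ?case
  proof (rule approximable_limit)
    show "pair_section (?G (\<Union>i. C i))" using C by (intro sec) auto
    show "\<exists>Y. approximable Y \<and> pair_norm (\<lambda>z. ?G (\<Union>i. C i) z - Y z) < \<epsilon>" if \<epsilon>: "0 < \<epsilon>" for \<epsilon>
    proof -
      obtain n where "pair_norm (\<lambda>z. ?G (\<Union>i. C i) z - ?S n z) < \<epsilon>" using lim[OF \<epsilon>] by blast
      then show ?thesis by (intro exI[of _ "?S n"] conjI approximable_sum 4(3))
    qed
  qed
qed

text \<open>The nearest members of the dense sequence need not be square integrable, so they are cut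
  off to sets of finite measure and to norm at most \<open>n\<close>. At each point an approximant
  is the nearest member or 0, so its error is at most \<open>norm (X z)\<close> and \<open>X\<close>
  itself dominates.\<close>

theorem approximable_if_integrable:
  assumes X: "pair_section X" and fin: "pair_norm X < \<infinity>"
  shows "approximable X"
proof -
  obtain A where A: "range A \<subseteq> sets \<nu>" "(\<Union>i. A i) = space \<nu>" "\<And>i. emeasure \<nu> (A i) \<noteq> \<infinity>" "incseq A"
    using \<nu>.sigma_finite_incseq by blast
  obtain B where B: "range B \<subseteq> sets \<rho>" "(\<Union>i. B i) = space \<rho>" "\<And>i. emeasure \<rho> (B i) \<noteq> \<infinity>" "incseq B"
    using \<rho>.sigma_finite_incseq by blast
  let ?k = "prod.nearest X"
  let ?A = "\<lambda>n i. A n \<inter> {x \<in> space \<nu>. norm (j x (d i)) \<le> real n}"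
  let ?C = "\<lambda>n i. {z \<in> space (\<nu> \<Otimes>\<^sub>M \<rho>). ?k n z = i}"
  define Y where "Y n z = (\<Sum>i\<le>n. indicator (?C n i \<inter> ?A n i \<times> B n) z *\<^sub>R j (fst z) (d i))" for n z
  have Y_eq: "Y n z = (if fst z \<in> A n \<and> snd z \<in> B n \<and> norm (j (fst z) (d (?k n z))) \<le> real n
      then j (fst z) (d (?k n z)) else 0)" if "z \<in> space (\<nu> \<Otimes>\<^sub>M \<rho>)" for n z
  proof -
    have "Y n z = (\<Sum>i\<le>n. if i = ?k n z then indicator (?A n i \<times> B n) z *\<^sub>R j (fst z) (d i) else 0)"
      unfolding Y_def using that by (intro sum.cong) (auto split: split_indicator)
    also have "\<dots> = indicator (?A n (?k n z) \<times> B n) z *\<^sub>R j (fst z) (d (?k n z))"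
      using prod.nearest_le[of X n z] by simp
    finally show ?thesis using that by (auto simp: space_pair_measure split: split_indicator)
  qed
  have [measurable]: "(\<lambda>x. norm (j x (d i))) \<in> borel_measurable \<nu>" for i
    by (rule field_section_norm[OF field_section_generator])
  have approx: "approximable (Y n)" for n
    unfolding Y_def
  proof (intro approximable_sum approximable_indicator)
    fix i
    show Am: "?A n i \<in> sets \<nu>" using A(1) by auto
    show "B n \<in> sets \<rho>" "emeasure \<rho> (B n) < \<infinity>" using B by (auto simp: less_top)
    have [measurable]: "A n \<in> sets \<nu>" using A(1) by auto
    have "(\<integral>\<^sup>+x. (ennreal (norm (indicator (?A n i) x *\<^sub>R j x (d i))))\<^sup>2 \<partial>\<nu>)
        \<le> (\<integral>\<^sup>+x. ennreal ((real n)\<^sup>2) * indicator (A n) x \<partial>\<nu>)"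
      by (intro nn_integral_mono) (auto simp: ennreal_power intro!: ennreal_leI power_mono split: split_indicator)
    also have "\<dots> < \<infinity>" using A(3)[of n] by (simp add: nn_integral_cmult ennreal_mult_less_top less_top)
    finally show "fnorm (\<lambda>x. indicator (?A n i) x *\<^sub>R j x (d i)) < \<infinity>"
      unfolding fnorm_def enorm2_def by simp
    show "?C n i \<in> sets (\<nu> \<Otimes>\<^sub>M \<rho>)"
      using measurable_sets[OF prod.measurable_nearest[OF X], of "{i}" n]
      by (simp add: vimage_def Int_def conj_commute)
  qed
  have "(\<lambda>n. pair_norm (\<lambda>z. X z - Y n z)) \<longlonglongrightarrow> 0"
  proof (rule pair_norm_dominated[OF X _ X fin])
    show "pair_section (Y n)" for n using approx by (simp add: approximable_def)
    fix z assume z: "z \<in> space (\<nu> \<Otimes>\<^sub>M \<rho>)"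
    show "norm (X z - Y n z) \<le> norm (X z)" for n
      using prod.nearest_dist[OF z, of X n] by (simp add: Y_eq[OF z])
    have lim: "(\<lambda>n. j (fst z) (d (?k n z))) \<longlonglongrightarrow> X z" by (rule prod.nearest_tendsto[OF X z])
    have "fst z \<in> (\<Union>i. A i)" "snd z \<in> (\<Union>i. B i)" using z A(2) B(2) by (auto simp: space_pair_measure)
    then obtain a b where ab: "fst z \<in> A a" "snd z \<in> B b" by auto
    \<comment> \<open>Nearest members have norm at most \<open>2 * norm (X z)\<close>. Once
      \<open>n\<close> reaches this bound and the indices of both exhausting sets, no cut-off is
      active.\<close>
    have "\<forall>\<^sub>F n in sequentially. Y n z = j (fst z) (d (?k n z))"
      using eventually_ge_at_top[of "max a (max b (nat \<lceil>2 * norm (X z)\<rceil>))"]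
    proof eventually_elim
      fix n assume n: "max a (max b (nat \<lceil>2 * norm (X z)\<rceil>)) \<le> n"
      have "fst z \<in> A n" "snd z \<in> B n" using n ab incseqD[OF A(4), of a n] incseqD[OF B(4), of b n] by auto
      moreover have "norm (j (fst z) (d (?k n z))) \<le> 2 * norm (X z)"
        using prod.nearest_dist[OF z, of X n] norm_triangle_ineq2[of "j (fst z) (d (?k n z))" "X z"]
        by (simp add: norm_minus_commute)
      moreover have "2 * norm (X z) \<le> real n" using n by linarith
      ultimately show "Y n z = j (fst z) (d (?k n z))" by (simp add: Y_eq[OF z])
    qed
    then show "(\<lambda>n. Y n z) \<longlonglongrightarrow> X z" using lim by (rule tendsto_cong[THEN iffD2])
  qed
  then have "\<exists>n. pair_norm (\<lambda>z. X z - Y n z) < \<epsilon>" if "0 < \<epsilon>" for \<epsilon>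
    using that unfolding tendsto_ennreal_0_iff eventually_sequentially by blast
  then show ?thesis using approx by (intro approximable_limit[OF X]) blast
qed

section \<open>The integral of a square integrable family\<close>

text \<open>Minkowski's inequality bounds the L2 norm over \<open>\<nu>\<close> of the integral of
  \<open>norm (X (x, e))\<close> over \<open>e\<close>, so this integral is finite for almost every
  \<open>x\<close>.\<close>

lemma AE_integrable_section:
  assumes X: "pair_section X" and fin: "pair_norm X < \<infinity>"
  shows "AE x in \<nu>. integrable \<rho> (\<lambda>e. X (x, e))"
proof -
  have [measurable]: "(\<lambda>z. norm (X z)) \<in> borel_measurable (\<nu> \<Otimes>\<^sub>M \<rho>)"
    by (rule prod.field_section_norm[OF X])
  have "enorm2 \<nu> (\<lambda>x. \<integral>\<^sup>+e. norm (X (x, e)) \<partial>\<rho>) \<le> pair_norm X"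
    unfolding pair_norm_def fnorm_def
    by (rule enorm2_nn_integral_le[OF \<nu>.sigma_finite_measure_axioms \<rho>.sigma_finite_measure_axioms]) simp
  then have "enorm2 \<nu> (\<lambda>x. \<integral>\<^sup>+e. norm (X (x, e)) \<partial>\<rho>) < \<infinity>" using fin by (rule le_less_trans)
  then have "AE x in \<nu>. (\<integral>\<^sup>+e. norm (X (x, e)) \<partial>\<rho>)\<^sup>2 \<noteq> \<infinity>"
    unfolding enorm2_def by (intro nn_integral_PInf_AE) (auto simp: less_top[symmetric])
  then show ?thesis
    using AE_space
  proof eventually_elim
    fix x assume "(\<integral>\<^sup>+e. norm (X (x, e)) \<partial>\<rho>)\<^sup>2 \<noteq> \<infinity>" "x \<in> space \<nu>"
    then have "(\<integral>\<^sup>+e. norm (X (x, e)) \<partial>\<rho>) < \<infinity>"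
      by (metis ennreal_top_power2 infinity_ennreal_def less_top)
    with \<open>x \<in> space \<nu>\<close> show "integrable \<rho> (\<lambda>e. X (x, e))"
      by (intro integrableI_bounded measurable_section_snd X)
  qed
qed

lemma fnorm_integral_le:
  assumes X: "pair_section X"
  shows "fnorm (\<lambda>x. \<integral>e. X (x, e) \<partial>\<rho>) \<le> pair_norm X"
proof -
  have [measurable]: "(\<lambda>z. norm (X z)) \<in> borel_measurable (\<nu> \<Otimes>\<^sub>M \<rho>)"
    by (rule prod.field_section_norm[OF X])
  \<comment> \<open>Valid for every \<open>x\<close>, because the integral is 0 by convention where
    \<open>X (x, e)\<close> is not integrable in \<open>e\<close>.\<close>
  have "ennreal (norm (\<integral>e. X (x, e) \<partial>\<rho>)) \<le> (\<integral>\<^sup>+e. norm (X (x, e)) \<partial>\<rho>)" for x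
    by (cases "integrable \<rho> (\<lambda>e. X (x, e))") (auto intro: integral_norm_bound_ennreal simp: not_integrable_integral_eq)
  then have "fnorm (\<lambda>x. \<integral>e. X (x, e) \<partial>\<rho>) \<le> enorm2 \<nu> (\<lambda>x. \<integral>\<^sup>+e. norm (X (x, e)) \<partial>\<rho>)"
    unfolding fnorm_def by (intro enorm2_mono)
  also have "\<dots> \<le> pair_norm X"
    unfolding pair_norm_def fnorm_def
    by (rule enorm2_nn_integral_le[OF \<nu>.sigma_finite_measure_axioms \<rho>.sigma_finite_measure_axioms]) simp
  finally show ?thesis .
qed

lemma integral_mem_L2_sections:
  assumes X: "pair_section X" and fin: "pair_norm X < \<infinity>"
  shows "(\<lambda>x. \<integral>e. X (x, e) \<partial>\<rho>) \<in> L2_sections"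
proof -
  have [measurable]: "(\<lambda>z. norm (X z)) \<in> borel_measurable (\<nu> \<Otimes>\<^sub>M \<rho>)"
    by (rule prod.field_section_norm[OF X])
  have [measurable]: "(\<lambda>z. inner (X z) (j (fst z) \<phi>)) \<in> borel_measurable (\<nu> \<Otimes>\<^sub>M \<rho>)" for \<phi>
    using X by (simp add: field_section_def)
  have "(\<lambda>x. inner (\<integral>e. X (x, e) \<partial>\<rho>) (j x \<phi>)) \<in> borel_measurable \<nu>" for \<phi>
  proof -
    \<comment> \<open>The inner product passes through the integral on \<open>?G\<close>. Off this
      set the vector integral is 0 by convention while the scalar one may differ from 0, hence the
      indicator.\<close>
    let ?G = "{x \<in> space \<nu>. (\<integral>\<^sup>+e. norm (X (x, e)) \<partial>\<rho>) < \<infinity>}"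
    have "(\<lambda>x. indicator ?G x * (\<integral>e. inner (X (x, e)) (j (fst (x, e)) \<phi>) \<partial>\<rho>)) \<in> borel_measurable \<nu>"
      by measurable
    moreover have "inner (\<integral>e. X (x, e) \<partial>\<rho>) (j x \<phi>) =
        indicator ?G x * (\<integral>e. inner (X (x, e)) (j (fst (x, e)) \<phi>) \<partial>\<rho>)" if x: "x \<in> space \<nu>" for x
    proof (cases "integrable \<rho> (\<lambda>e. X (x, e))")
      case True
      then have "x \<in> ?G" using x by (auto simp: integrable_iff_bounded)
      with True show ?thesis by simp
    next
      case False
      then have "x \<notin> ?G" using measurable_section_snd[OF X x] by (auto simp: integrable_iff_bounded)
      with False show ?thesis by (simp add: not_integrable_integral_eq)
    qed
    ultimately show ?thesis by (simp cong: measurable_cong)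
  qed
  moreover have "(\<integral>e. X (x, e) \<partial>\<rho>) \<in> closure (range (j x))" if "x \<in> space \<nu>" for x
    using measurable_section_snd[OF X that] by simp
  ultimately show ?thesis
    using fnorm_integral_le[OF X] fin by (auto simp: L2_sections_def field_section_def)
qed

text \<open>Evaluation at \<open>x\<close> is linear, so the simple integral, formed in a space of
  functions, is at each \<open>x\<close> an ordinary integral. Almost everywhere the difference is
  then, up to sign, the integral of \<open>X - S\<close>, to which the norm bound for integrals
  applies.\<close>

lemma fnorm_simple_integral_diff:
  assumes X: "pair_section X" and fin: "pair_norm X < \<infinity>" and S: "simple_sections S"
  shows "fnorm (\<lambda>x. Bochner_Integration.simple_bochner_integral \<rho> S x - (\<integral>e. X (x, e) \<partial>\<rho>))
    \<le> pair_norm (\<lambda>z. X z - S (snd z) (fst z))"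
proof -
  let ?D = "\<lambda>z. X z - S (snd z) (fst z)"
  have "norm (Bochner_Integration.simple_bochner_integral \<rho> S x - (\<integral>e. X (x, e) \<partial>\<rho>)) =
      norm (\<integral>e. ?D (x, e) \<partial>\<rho>)" if "integrable \<rho> (\<lambda>e. X (x, e))" for x
  proof -
    have "linear (\<lambda>f::'x \<Rightarrow> 'h. f x)" by (simp add: linear_iff scaleR_fun_def)
    from simple_bochner_integral_linear[OF this conjunct1[OF S]]
    have 1: "Bochner_Integration.simple_bochner_integral \<rho> (\<lambda>e. S e x) =
        Bochner_Integration.simple_bochner_integral \<rho> S x" .
    \<comment> \<open>Evaluation at \<open>x\<close> enters as a map of two arguments that ignores
      the second.\<close>
    have "Bochner_Integration.simple_bochner_integrable \<rho> (\<lambda>e. S e x)"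
      using simple_bochner_integrable_compose2[of "\<lambda>f g. f x" \<rho> S S] S by simp
    from has_bochner_integral_simple_bochner_integrable[OF this]
    have "has_bochner_integral \<rho> (\<lambda>e. S e x) (Bochner_Integration.simple_bochner_integral \<rho> S x)"
      by (simp add: 1)
    from has_bochner_integral_diff[OF has_bochner_integral_integrable[OF that] this]
    show ?thesis by (simp add: has_bochner_integral_integral_eq norm_minus_commute)
  qed
  then have "AE x in \<nu>. norm (Bochner_Integration.simple_bochner_integral \<rho> S x - (\<integral>e. X (x, e) \<partial>\<rho>)) =
      norm (\<integral>e. ?D (x, e) \<partial>\<rho>)"
    using AE_integrable_section[OF X fin] by auto
  then have "fnorm (\<lambda>x. Bochner_Integration.simple_bochner_integral \<rho> S x - (\<integral>e. X (x, e) \<partial>\<rho>)) =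
      fnorm (\<lambda>x. \<integral>e. ?D (x, e) \<partial>\<rho>)"
    unfolding fnorm_def by (intro enorm2_cong_AE) (auto elim: eventually_mono)
  also have "\<dots> \<le> pair_norm ?D"
    by (intro fnorm_integral_le prod.field_section_diff X simple_sections_pair_section S)
  finally show ?thesis .
qed

end

section \<open>Square integrable martingales\<close>

text \<open>One-sided limits may be interchanged with a uniform limit. On the left it must first be
  known that the left limits of the \<open>f n\<close> converge; uniform closeness makes them a
  Cauchy sequence.\<close>

lemma cadlag_on_uniform_limit:
  assumes f: "\<And>n. cadlag_on S (f n)" and u: "uniform_limit S f g sequentially"
  shows "cadlag_on S g"
  unfolding cadlag_on_def
proof (intro ballI conjI)
  fix t assume t: "t \<in> S"
  show "(g \<longlongrightarrow> g t) (at t within S \<inter> {t<..})"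
  proof (rule swap_uniform_limit)
    show "\<forall>\<^sub>F n in sequentially. (f n \<longlongrightarrow> f n t) (at t within S \<inter> {t<..})"
      using f t by (auto simp: cadlag_on_def)
    show "(\<lambda>n. f n t) \<longlonglongrightarrow> g t" using tendsto_uniform_limitI[OF u t] .
    show "uniform_limit (S \<inter> {t<..}) f g sequentially" by (rule uniform_limit_on_subset[OF u]) auto
  qed simp
  show "\<exists>l. (g \<longlongrightarrow> l) (at t within S \<inter> {..<t})"
  \<comment> \<open>Where \<open>S\<close> does not accumulate at \<open>t\<close> from the left,
    the filter is trivial and any number is a left limit. Elsewhere inequalities pass to limits
    along it.\<close>
  proof (cases "at t within S \<inter> {..<t} = bot")
    case False
    have "\<exists>l. (f n \<longlongrightarrow> l) (at t within S \<inter> {..<t})" for n using f t by (auto simp: cadlag_on_def)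
    then obtain l where l: "\<And>n. (f n \<longlongrightarrow> l n) (at t within S \<inter> {..<t})" by metis
    have "Cauchy l"
    proof (rule metric_CauchyI)
      fix e :: real assume "0 < e"
      then have "0 < e / 4" by simp
      then have "\<forall>\<^sub>F n in sequentially. \<forall>x\<in>S. dist (f n x) (g x) < e / 4"
        using u unfolding uniform_limit_iff by blast
      then obtain N where N: "\<And>n x. N \<le> n \<Longrightarrow> x \<in> S \<Longrightarrow> dist (f n x) (g x) < e / 4"
        by (auto simp: eventually_sequentially)
      have "dist (l m) (l n) \<le> e / 2" if "N \<le> m" "N \<le> n" for m n
      proof (rule tendsto_upperbound[OF tendsto_dist[OF l l] _ False])
        have "dist (f m x) (f n x) \<le> e / 2" if "x \<in> S" for x
          using N[OF \<open>N \<le> m\<close> that] N[OF \<open>N \<le> n\<close> that] dist_triangle2[of "f m x" "f n x" "g x"] by linarith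
        then show "\<forall>\<^sub>F x in at t within S \<inter> {..<t}. dist (f m x) (f n x) \<le> e / 2"
          by (auto simp: eventually_at_filter)
      qed
      moreover have "e / 2 < e" using \<open>0 < e\<close> by simp
      ultimately show "\<exists>M. \<forall>m\<ge>M. \<forall>n\<ge>M. dist (l m) (l n) < e"
        using le_less_trans by blast
    qed
    then obtain L where "l \<longlonglongrightarrow> L" using Cauchy_convergent convergentD by blast
    moreover have "uniform_limit (S \<inter> {..<t}) f g sequentially" by (rule uniform_limit_on_subset[OF u]) auto
    ultimately have "(g \<longlongrightarrow> L) (at t within S \<inter> {..<t})"
      by (intro swap_uniform_limit[of f l]) (auto simp: l)
    then show ?thesis ..
  qed simp
qed

lemma cadlag_on_lincomb:
  assumes f: "cadlag_on S f" and g: "cadlag_on S g"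
  shows "cadlag_on S (\<lambda>t. a * f t + b * g t)"
  unfolding cadlag_on_def
proof (intro ballI conjI)
  fix t assume t: "t \<in> S"
  show "((\<lambda>t. a * f t + b * g t) \<longlongrightarrow> a * f t + b * g t) (at t within S \<inter> {t<..})"
    using f g t by (auto simp: cadlag_on_def intro!: tendsto_intros)
  obtain l m where "(f \<longlongrightarrow> l) (at t within S \<inter> {..<t})" "(g \<longlongrightarrow> m) (at t within S \<inter> {..<t})"
    using f g t unfolding cadlag_on_def by blast
  then have "((\<lambda>t. a * f t + b * g t) \<longlongrightarrow> a * l + b * m) (at t within S \<inter> {..<t})"
    by (intro tendsto_intros)
  then show "\<exists>l. ((\<lambda>t. a * f t + b * g t) \<longlongrightarrow> l) (at t within S \<inter> {..<t})" ..
qed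

lemma cadlag_on_add: "cadlag_on S f \<Longrightarrow> cadlag_on S g \<Longrightarrow> cadlag_on S (\<lambda>t. f t + g t)"
  using cadlag_on_lincomb[of S f g 1 1] by simp

lemma cadlag_on_cmult: "cadlag_on S f \<Longrightarrow> cadlag_on S (\<lambda>t. c * f t)"
  using cadlag_on_lincomb[of S f f c 0] by simp

lemma cadlag_on_diff: "cadlag_on S f \<Longrightarrow> cadlag_on S g \<Longrightarrow> cadlag_on S (\<lambda>t. f t - g t)"
  using cadlag_on_lincomb[of S f g 1 "-1"] by simp

lemma cadlag_on_zero: "cadlag_on S (\<lambda>t. 0)"
  unfolding cadlag_on_def by auto

lemma cadlag_on_sum:
  assumes "\<And>i. i \<in> I \<Longrightarrow> cadlag_on S (f i)" shows "cadlag_on S (\<lambda>t. \<Sum>i\<in>I. f i t)"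
  using assms by (induction I rule: infinite_finite_induct) (auto intro: cadlag_on_add cadlag_on_zero)

lemma cadlag_on_min:
  assumes f: "cadlag_on {0..} f" and b: "0 \<le> b"
  shows "cadlag_on {0..T} (\<lambda>t. f (min b t))"
  unfolding cadlag_on_def
proof (intro ballI conjI)
  fix t assume t: "t \<in> {0..T}"
  let ?R = "at t within {0..T} \<inter> {t<..}" and ?L = "at t within {0..T} \<inter> {..<t}"
  show "((\<lambda>t. f (min b t)) \<longlongrightarrow> f (min b t)) ?R"
  proof (cases "t < b")
    case True
    have "(f \<longlongrightarrow> f t) ?R"
    proof (rule tendsto_within_subset)
      show "(f \<longlongrightarrow> f t) (at t within {0..} \<inter> {t<..})" using f t by (simp add: cadlag_on_def)
    qed auto
    moreover have "\<forall>\<^sub>F x in ?R. f x = f (min b x)"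
      using True eventually_at_right_less[of t] unfolding eventually_at
      by (intro exI[of _ "b - t"]) (auto simp: dist_real_def)
    ultimately show ?thesis using True by (simp add: tendsto_cong min_absorb2)
  next
    case False
    then have "\<forall>\<^sub>F x in ?R. f (min b t) = f (min b x)"
      unfolding eventually_at by (intro exI[of _ 1]) (auto simp: min_absorb1)
    then show ?thesis by (rule tendsto_eventually[OF eventually_mono]) simp
  qed
  show "\<exists>l. ((\<lambda>t. f (min b t)) \<longlongrightarrow> l) ?L"
  proof (cases "t \<le> b")
    case True
    have "\<exists>l. (f \<longlongrightarrow> l) (at t within {0..} \<inter> {..<t})" using f t by (auto simp: cadlag_on_def)
    then obtain l where "(f \<longlongrightarrow> l) (at t within {0..} \<inter> {..<t})" ..
    then have "(f \<longlongrightarrow> l) ?L" by (rule tendsto_within_subset) auto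
    moreover have "\<forall>\<^sub>F x in ?L. f x = f (min b x)"
      using True unfolding eventually_at by (intro exI[of _ 1]) (auto simp: min_absorb2)
    ultimately show ?thesis by (auto simp: tendsto_cong)
  next
    case False
    then have "\<forall>\<^sub>F x in ?L. f (min b x) = f b"
      unfolding eventually_at by (intro exI[of _ "t - b"]) (auto simp: dist_real_def)
    then have "((\<lambda>t. f (min b t)) \<longlongrightarrow> f b) ?L" by (rule tendsto_eventually)
    then show ?thesis ..
  qed
qed

text \<open>Each time is a limit from the right of grid points, \<open>T\<close> being a grid point
  itself, so countably many times determine a cadlag path. This turns equality almost surely at each
  time into equality of whole paths almost surely.\<close>

lemma cadlag_on_eq_if_eq_on_grid:
  assumes f: "cadlag_on {0..T} f" and g: "cadlag_on {0..T} g" and T: "0 < T"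
    and eq: "\<And>n k. k \<le> Suc n \<Longrightarrow> f (real k * T / real (Suc n)) = g (real k * T / real (Suc n))"
    and t: "t \<in> {0..T}"
  shows "f t = g t"
proof (rule LIMSEQ_unique)
  let ?x = "\<lambda>n. real (grid_index T t n) * T / real (Suc n)"
  show "(\<lambda>n. f (?x n)) \<longlonglongrightarrow> f t" by (rule cadlag_on_tendsto_grid[OF f t T])
  have "f (?x n) = g (?x n)" for n by (rule eq[OF grid_index_le[OF t T]])
  then show "(\<lambda>n. f (?x n)) \<longlonglongrightarrow> g t" using cadlag_on_tendsto_grid[OF g t T] by simp
qed

section \<open>Linear operations, elementary integrals and limits of martingales\<close>

context stochastic_basis
begin

lemma square_integrable_imp_integrable:
  fixes f :: "'w \<Rightarrow> real"
  assumes "f \<in> borel_measurable P" "integrable P (\<lambda>\<omega>. (f \<omega>)\<^sup>2)"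
  shows "integrable P f"
  using square_integrable_mult[of f P "\<lambda>_. 1"] assms by simp

lemma sets_F_imp_sets_P: "B \<in> sets (F s) \<Longrightarrow> 0 \<le> s \<Longrightarrow> B \<in> sets P"
  using subalgebra_F[of s] by (auto simp: subalgebra_def)

text \<open>Conditional expectations are replaced by integrals over the sets of \<open>F s\<close>.
  In this form the martingale property passes easily to linear combinations, modifications and L2
  limits.\<close>

lemma zero_mean_L2_martingale_onI:
  assumes S: "S \<subseteq> {0..}"
    and m: "\<And>t. t \<in> S \<Longrightarrow> Y t \<in> borel_measurable (F t)"
    and sq: "\<And>t. t \<in> S \<Longrightarrow> integrable P (\<lambda>\<omega>. (Y t \<omega>)\<^sup>2)"
    and mean: "\<And>t. t \<in> S \<Longrightarrow> (\<integral>\<omega>. Y t \<omega> \<partial>P) = 0"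
    and mart: "\<And>s t B. s \<in> S \<Longrightarrow> t \<in> S \<Longrightarrow> s \<le> t \<Longrightarrow> B \<in> sets (F s) \<Longrightarrow>
      (\<integral>\<omega>. indicator B \<omega> * Y t \<omega> \<partial>P) = (\<integral>\<omega>. indicator B \<omega> * Y s \<omega> \<partial>P)"
  shows "zero_mean_L2_martingale_on P F S Y"
  unfolding zero_mean_L2_martingale_on_def martingale_on_def
proof (intro conjI ballI impI)
  have int: "integrable P (Y t)" if "t \<in> S" for t
    using square_integrable_imp_integrable[OF measurable_F_P[OF _ m[OF that]] sq[OF that]] S that by auto
  then show "integrable P (Y t)" if "t \<in> S" for t using that .
  fix s t assume st: "s \<in> S" "t \<in> S" "s \<le> t"
  interpret sigma_finite_subalgebra P "F s" using sigma_finite_subalgebra_F[of s] S st by auto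
  show "AE \<omega> in P. real_cond_exp P (F s) (Y t) \<omega> = Y s \<omega>"
    using mart[OF st] int st m
    by (intro real_cond_exp_charact) (auto simp: set_lebesgue_integral_def)
qed (use assms in auto)

lemma zero_mean_L2_martingale_onD:
  assumes Y: "zero_mean_L2_martingale_on P F S Y" and S: "S \<subseteq> {0..}"
  shows "\<And>t. t \<in> S \<Longrightarrow> Y t \<in> borel_measurable (F t)"
    and "\<And>t. t \<in> S \<Longrightarrow> Y t \<in> borel_measurable P"
    and "\<And>t. t \<in> S \<Longrightarrow> integrable P (\<lambda>\<omega>. (Y t \<omega>)\<^sup>2)"
    and "\<And>t. t \<in> S \<Longrightarrow> integrable P (Y t)"
    and "\<And>t. t \<in> S \<Longrightarrow> (\<integral>\<omega>. Y t \<omega> \<partial>P) = 0"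
    and "\<And>s t B. s \<in> S \<Longrightarrow> t \<in> S \<Longrightarrow> s \<le> t \<Longrightarrow> B \<in> sets (F s) \<Longrightarrow>
      (\<integral>\<omega>. indicator B \<omega> * Y t \<omega> \<partial>P) = (\<integral>\<omega>. indicator B \<omega> * Y s \<omega> \<partial>P)"
proof -
  show m: "\<And>t. t \<in> S \<Longrightarrow> Y t \<in> borel_measurable (F t)" and int: "\<And>t. t \<in> S \<Longrightarrow> integrable P (Y t)"
    and "\<And>t. t \<in> S \<Longrightarrow> integrable P (\<lambda>\<omega>. (Y t \<omega>)\<^sup>2)" "\<And>t. t \<in> S \<Longrightarrow> (\<integral>\<omega>. Y t \<omega> \<partial>P) = 0"
    using Y by (auto simp: zero_mean_L2_martingale_on_def martingale_on_def)
  then show "\<And>t. t \<in> S \<Longrightarrow> Y t \<in> borel_measurable P" using measurable_F_P S by fastforce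
  fix s t B assume st: "s \<in> S" "t \<in> S" "s \<le> t" and B: "B \<in> sets (F s)"
  then have "0 \<le> s" using S by auto
  then have "integrable P (\<lambda>\<omega>. indicator B \<omega> * Y t \<omega>)"
    using integrable_mult_indicator[OF sets_F_imp_sets_P[OF B] int[OF st(2)]] by simp
  then show "(\<integral>\<omega>. indicator B \<omega> * Y t \<omega> \<partial>P) = (\<integral>\<omega>. indicator B \<omega> * Y s \<omega> \<partial>P)"
    using Y st B \<open>0 \<le> s\<close>
    by (intro martingale_on_integral_mult[of S]) (auto simp: zero_mean_L2_martingale_on_def)
qed

lemma zero_mean_L2_martingale_on_lincomb:
  assumes Y: "zero_mean_L2_martingale_on P F S Y" and Z: "zero_mean_L2_martingale_on P F S Z"
    and S: "S \<subseteq> {0..}"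
  shows "zero_mean_L2_martingale_on P F S (\<lambda>t \<omega>. a * Y t \<omega> + b * Z t \<omega>)"
proof (rule zero_mean_L2_martingale_onI[OF S])
  note DY = zero_mean_L2_martingale_onD[OF Y S] and DZ = zero_mean_L2_martingale_onD[OF Z S]
  fix t assume t: "t \<in> S"
  have [measurable]: "Y t \<in> borel_measurable (F t)" "Z t \<in> borel_measurable (F t)"
    "Y t \<in> borel_measurable P" "Z t \<in> borel_measurable P" using DY(1,2) DZ(1,2) t by auto
  show "(\<lambda>\<omega>. a * Y t \<omega> + b * Z t \<omega>) \<in> borel_measurable (F t)" by simp
  show "integrable P (\<lambda>\<omega>. (a * Y t \<omega> + b * Z t \<omega>)\<^sup>2)"
    by (intro square_integrable_add) (auto simp: power_mult_distrib DY(3) DZ(3) t)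
  show "(\<integral>\<omega>. a * Y t \<omega> + b * Z t \<omega> \<partial>P) = 0" by (simp add: DY(4,5) DZ(4,5) t)
  fix s B assume s: "s \<in> S" "s \<le> t" "B \<in> sets (F s)"
  then have "0 \<le> s" using S by auto
  have iY: "integrable P (\<lambda>\<omega>. indicator B \<omega> * Y r \<omega>)" and iZ: "integrable P (\<lambda>\<omega>. indicator B \<omega> * Z r \<omega>)" if "r \<in> S" for r
    using integrable_mult_indicator[OF sets_F_imp_sets_P[OF s(3) \<open>0 \<le> s\<close>] DY(4)[OF that]]
      integrable_mult_indicator[OF sets_F_imp_sets_P[OF s(3) \<open>0 \<le> s\<close>] DZ(4)[OF that]] by auto
  have "(\<integral>\<omega>. indicator B \<omega> * (a * Y r \<omega> + b * Z r \<omega>) \<partial>P) =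
      a * (\<integral>\<omega>. indicator B \<omega> * Y r \<omega> \<partial>P) + b * (\<integral>\<omega>. indicator B \<omega> * Z r \<omega> \<partial>P)" if "r \<in> S" for r
  proof -
    have "(\<lambda>\<omega>. indicator B \<omega> * (a * Y r \<omega> + b * Z r \<omega>)) =
        (\<lambda>\<omega>. a * (indicator B \<omega> * Y r \<omega>) + b * (indicator B \<omega> * Z r \<omega>))"
      by (simp add: fun_eq_iff algebra_simps)
    then show ?thesis using iY[OF that] iZ[OF that] by simp
  qed
  then show "(\<integral>\<omega>. indicator B \<omega> * (a * Y t \<omega> + b * Z t \<omega>) \<partial>P) =
      (\<integral>\<omega>. indicator B \<omega> * (a * Y s \<omega> + b * Z s \<omega>) \<partial>P)"
    using DY(6)[OF s(1) t s(2,3)] DZ(6)[OF s(1) t s(2,3)] s t by simp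
qed

lemma zero_mean_L2_martingale_on_zero: "zero_mean_L2_martingale_on P F S (\<lambda>t \<omega>. 0)" if "S \<subseteq> {0..}"
  using that by (intro zero_mean_L2_martingale_onI) auto

lemma zero_mean_L2_martingale_on_sum:
  assumes "\<And>i. i \<in> J \<Longrightarrow> zero_mean_L2_martingale_on P F S (Y i)" and S: "S \<subseteq> {0..}"
  shows "zero_mean_L2_martingale_on P F S (\<lambda>t \<omega>. \<Sum>i\<in>J. Y i t \<omega>)"
  using assms(1)
proof (induction J rule: infinite_finite_induct)
  case (insert i J)
  then show ?case
    using zero_mean_L2_martingale_on_lincomb[OF _ _ S, of "Y i" "\<lambda>t \<omega>. \<Sum>i\<in>J. Y i t \<omega>" 1 1] by simp
qed (simp_all add: zero_mean_L2_martingale_on_zero[OF S])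

lemma M2_space_lincomb:
  assumes "Y \<in> M2_space P F T" "Z \<in> M2_space P F T"
  shows "(\<lambda>t \<omega>. a * Y t \<omega> + b * Z t \<omega>) \<in> M2_space P F T"
  using assms zero_mean_L2_martingale_on_lincomb[of "{0..T}" Y Z a b]
  by (auto simp: M2_space_def intro!: cadlag_on_add cadlag_on_cmult)

lemma M2_space_zero: "(\<lambda>t \<omega>. 0) \<in> M2_space P F T"
  by (simp add: M2_space_def zero_mean_L2_martingale_on_zero cadlag_on_zero)

lemma M2_space_diff:
  assumes "Y \<in> M2_space P F T" "Z \<in> M2_space P F T"
  shows "(\<lambda>t \<omega>. Y t \<omega> - Z t \<omega>) \<in> M2_space P F T"
  using M2_space_lincomb[OF assms, of 1 "-1"] by simp

text \<open>The process is the elementary stochastic integral of the indicator of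
  \<open>]a,b] \<times> G\<close> against \<open>N\<close>. Its increment from \<open>s\<close> to
  \<open>t\<close> either vanishes or is, on \<open>G\<close>, an increment of \<open>N\<close> that
  starts at a time when both \<open>B\<close> and \<open>G\<close> are known.\<close>

lemma zero_mean_L2_martingale_on_stopped_increment:
  assumes N: "zero_mean_L2_martingale_on P F {0..} N" and ab: "0 \<le> a" "a < b" and G: "G \<in> sets (F a)"
  shows "zero_mean_L2_martingale_on P F {0..} (\<lambda>t \<omega>. indicator G \<omega> * (N (min b t) \<omega> - N (min a t) \<omega>))"
    (is "zero_mean_L2_martingale_on P F {0..} ?V")
proof (rule zero_mean_L2_martingale_onI)
  note D = zero_mean_L2_martingale_onD[OF N order_refl]
  have GP [measurable]: "G \<in> sets P" by (rule sets_F_imp_sets_P[OF G ab(1)])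
  have V0: "?V t \<omega> = 0" if "t \<le> a" for t \<omega>
  proof -
    have "min b t = t" "min a t = t" using that ab by auto
    then show ?thesis by simp
  qed
  have int: "integrable P (\<lambda>\<omega>. indicator C \<omega> * N t \<omega>)" if "C \<in> sets P" "0 \<le> t" for C t
    using integrable_mult_indicator[OF that(1) D(4)[of t]] that by auto
  have zero: "(\<integral>\<omega>. indicator C \<omega> * (N t \<omega> - N s \<omega>) \<partial>P) = 0" if "C \<in> sets (F s)" "0 \<le> s" "s \<le> t" for C s t
  proof -
    have "(\<integral>\<omega>. indicator C \<omega> * (N t \<omega> - N s \<omega>) \<partial>P) =
        (\<integral>\<omega>. indicator C \<omega> * N t \<omega> \<partial>P) - (\<integral>\<omega>. indicator C \<omega> * N s \<omega> \<partial>P)"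
      using int[OF sets_F_imp_sets_P[OF that(1,2)]] that by (simp add: right_diff_distrib)
    then show ?thesis using D(6)[of s t C] that by simp
  qed
  fix t :: real assume "t \<in> {0..}" then have t: "0 \<le> t" by simp
  \<comment> \<open>Before \<open>a\<close> the event \<open>G\<close> need not belong to
    \<open>F t\<close>, but there the process vanishes.\<close>
  show "?V t \<in> borel_measurable (F t)"
  proof (cases "t \<le> a")
    case False
    then have Gt: "G \<in> sets (F t)" using F_mono[of a t] G ab by auto
    have Nt: "N (min c t) \<in> borel_measurable (F t)" if "0 \<le> c" for c
      using D(1)[of "min c t"] t that by (intro measurable_F_mono[of "min c t" t]) auto
    show ?thesis
      using ab by (intro borel_measurable_times borel_measurable_diff borel_measurable_indicator Gt Nt) simp_all
  next
    case True
    show ?thesis unfolding V0[OF True] by simp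
  qed
  have sq: "integrable P (\<lambda>\<omega>. (N (min b t) \<omega> + (- 1) * N (min a t) \<omega>)\<^sup>2)"
  proof (rule square_integrable_add)
    have bt: "min b t \<in> {0..}" and at: "min a t \<in> {0..}" using t ab by auto
    show "N (min b t) \<in> borel_measurable P" by (rule D(2)[OF bt])
    show "(\<lambda>\<omega>. (- 1) * N (min a t) \<omega>) \<in> borel_measurable P"
      by (rule borel_measurable_times[OF borel_measurable_const D(2)[OF at]])
    show "integrable P (\<lambda>\<omega>. (N (min b t) \<omega>)\<^sup>2)" by (rule D(3)[OF bt])
    show "integrable P (\<lambda>\<omega>. ((- 1) * N (min a t) \<omega>)\<^sup>2)" using D(3)[OF at] by simp
  qed
  have "(\<lambda>\<omega>. (?V t \<omega>)\<^sup>2) = (\<lambda>\<omega>. indicator G \<omega> *\<^sub>R (N (min b t) \<omega> + (- 1) * N (min a t) \<omega>)\<^sup>2)"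
    by (auto simp: fun_eq_iff split: split_indicator)
  then show "integrable P (\<lambda>\<omega>. (?V t \<omega>)\<^sup>2)" using integrable_mult_indicator[OF GP sq] by simp
  have mart: "(\<integral>\<omega>. indicator B \<omega> * ?V t \<omega> \<partial>P) = (\<integral>\<omega>. indicator B \<omega> * ?V s \<omega> \<partial>P)"
    if s: "0 \<le> s" "s \<le> t" and B: "B \<in> sets (F s)" for s B
  proof -
    consider "t \<le> a" | "s \<le> a" "a < t" | "a < s" "s < b" | "b \<le> s" using ab s by linarith
    then show ?thesis
    proof cases
      case 1
      then have "s \<le> a" using s by simp
      show ?thesis unfolding V0[OF 1] V0[OF \<open>s \<le> a\<close>] ..
    next
      case 2
      have "B \<inter> G \<in> sets (F a)" using B G F_mono[of s a] s 2 by auto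
      from zero[OF this, of "min b t"] have "(\<integral>\<omega>. indicator B \<omega> * ?V t \<omega> \<partial>P) = 0"
        using 2 ab by (simp add: indicator_inter_arith mult.assoc)
      then show ?thesis unfolding V0[OF 2(1)] by simp
    next
      case 3
      have BG: "B \<inter> G \<in> sets (F s)" using B G F_mono[of a s] ab 3 by auto
      have "(\<integral>\<omega>. indicator (B \<inter> G) \<omega> * (N (min b t) \<omega> - N s \<omega>) \<partial>P) = 0"
        using zero[OF BG, of "min b t"] 3 s by simp
      moreover have "(\<lambda>\<omega>. indicator B \<omega> * ?V t \<omega>) = (\<lambda>\<omega>. indicator B \<omega> * ?V s \<omega> + indicator (B \<inter> G) \<omega> * (N (min b t) \<omega> - N s \<omega>))"
        using 3 s ab by (auto simp: fun_eq_iff split: split_indicator)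
      moreover have "integrable P (\<lambda>\<omega>. indicator (B \<inter> G) \<omega> * (N (min b t) \<omega> - N s \<omega>))"
        using int[OF sets_F_imp_sets_P[OF BG s(1)]] s ab by (simp add: right_diff_distrib)
      moreover have "integrable P (\<lambda>\<omega>. indicator B \<omega> * ?V s \<omega>)"
      proof -
        have "(\<lambda>\<omega>. indicator B \<omega> * ?V s \<omega>) = (\<lambda>\<omega>. indicator (B \<inter> G) \<omega> * N (min b s) \<omega> - indicator (B \<inter> G) \<omega> * N (min a s) \<omega>)"
          by (auto simp: fun_eq_iff split: split_indicator)
        then show ?thesis using int[OF sets_F_imp_sets_P[OF BG s(1)]] s ab by simp
      qed
      ultimately show ?thesis by simp
    next
      case 4
      then show ?thesis using s ab by (simp add: min_absorb1)
    qed
  qed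
  then show "(\<integral>\<omega>. indicator B \<omega> * ?V t \<omega> \<partial>P) = (\<integral>\<omega>. indicator B \<omega> * ?V s \<omega> \<partial>P)"
    if "s \<in> {0..}" "s \<le> t" "B \<in> sets (F s)" for s B using that by auto
  \<comment> \<open>The mean is read off from the martingale identity for the whole space and time
    0, where the process vanishes.\<close>
  have "space P \<in> sets (F 0)" using subalgebra_F[of 0] sets.top[of "F 0"] by (simp add: subalgebra_def)
  from mart[OF order_refl t this] have "(\<integral>\<omega>. indicator (space P) \<omega> * ?V t \<omega> \<partial>P) = 0"
    unfolding V0[OF ab(1)] by simp
  also have "(\<integral>\<omega>. indicator (space P) \<omega> * ?V t \<omega> \<partial>P) = (\<integral>\<omega>. ?V t \<omega> \<partial>P)"
    by (intro Bochner_Integration.integral_cong) auto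
  finally show "(\<integral>\<omega>. ?V t \<omega> \<partial>P) = 0" .
qed simp

lemma zero_mean_L2_martingale_on_subset:
  "zero_mean_L2_martingale_on P F S Y \<Longrightarrow> S' \<subseteq> S \<Longrightarrow> zero_mean_L2_martingale_on P F S' Y"
  by (auto simp: zero_mean_L2_martingale_on_def martingale_on_def subset_iff)

text \<open>Since the filtration contains all null sets, an almost surely cadlag martingale can be made
  cadlag everywhere without losing adaptedness.\<close>

lemma sets_F_if_AE:
  assumes "AE \<omega> in P. Q \<omega>" and "0 \<le> t"
  shows "{\<omega> \<in> space P. Q \<omega>} \<in> sets (F t)"
proof -
  obtain N where N: "{\<omega> \<in> space P. \<not> Q \<omega>} \<subseteq> N" "N \<in> null_sets P"
    using assms(1) by (auto elim!: AE_E intro: null_setsI)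
  then have "{\<omega> \<in> space P. \<not> Q \<omega>} \<in> null_sets P" by (rule complete2)
  then have "{\<omega> \<in> space P. \<not> Q \<omega>} \<in> sets (F t)"
    using F_complete F_mono[OF order_refl assms(2)] by blast
  then have "space (F t) - {\<omega> \<in> space P. \<not> Q \<omega>} \<in> sets (F t)" by (rule sets.compl_sets)
  moreover have "space (F t) - {\<omega> \<in> space P. \<not> Q \<omega>} = {\<omega> \<in> space P. Q \<omega>}"
    using subalgebra_F[OF assms(2)] by (auto simp: subalgebra_def)
  ultimately show ?thesis by simp
qed

lemma M2_space_modification:
  assumes Y: "zero_mean_L2_martingale_on P F {0..T} Y" and c: "AE \<omega> in P. cadlag_on {0..T} (\<lambda>t. Y t \<omega>)"
  obtains Z where "Z \<in> M2_space P F T" "\<And>t. AE \<omega> in P. Z t \<omega> = Y t \<omega>"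
proof
  let ?G = "{\<omega> \<in> space P. cadlag_on {0..T} (\<lambda>t. Y t \<omega>)}"
  define Z where "Z t \<omega> = indicator ?G \<omega> * Y t \<omega>" for t \<omega>
  note D = zero_mean_L2_martingale_onD[OF Y, simplified]
  have G: "?G \<in> sets (F t)" if "0 \<le> t" for t using sets_F_if_AE[OF c that] .
  show ae: "AE \<omega> in P. Z t \<omega> = Y t \<omega>" for t
    using c AE_space by eventually_elim (simp add: Z_def)
  have Zm: "Z t \<in> borel_measurable (F t)" if "0 \<le> t" "t \<le> T" for t
    unfolding Z_def using G that D(1)[of t] by (intro borel_measurable_times borel_measurable_indicator) auto
  have ZP [measurable]: "Z t \<in> borel_measurable P" if "0 \<le> t" "t \<le> T" for t
    using measurable_F_P[OF that(1) Zm[OF that]] .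
  have YP [measurable]: "Y t \<in> borel_measurable P" if "0 \<le> t" "t \<le> T" for t using D(2) that by auto
  have "zero_mean_L2_martingale_on P F {0..T} Z"
  proof (rule zero_mean_L2_martingale_onI)
    fix t assume "t \<in> {0..T}" then have t: "0 \<le> t" "t \<le> T" by auto
    show "Z t \<in> borel_measurable (F t)" using Zm t by simp
    show "integrable P (\<lambda>\<omega>. (Z t \<omega>)\<^sup>2)"
      using D(3)[of t] t ae[of t] ZP[OF t] YP[OF t] by (subst integrable_cong_AE[where g="\<lambda>\<omega>. (Y t \<omega>)\<^sup>2"]) auto
    show "(\<integral>\<omega>. Z t \<omega> \<partial>P) = 0"
      using D(5)[of t] t ae[of t] ZP[OF t] YP[OF t] by (subst integral_cong_AE[where g="Y t"]) auto
    fix s B assume s: "s \<in> {0..T}" "s \<le> t" "B \<in> sets (F s)"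
    then have [measurable]: "B \<in> sets P" using sets_F_imp_sets_P by auto
    have "(\<integral>\<omega>. indicator B \<omega> * Z r \<omega> \<partial>P) = (\<integral>\<omega>. indicator B \<omega> * Y r \<omega> \<partial>P)" if "0 \<le> r" "r \<le> T" for r
      using ae[of r] ZP[OF that] YP[OF that] by (intro integral_cong_AE) auto
    then show "(\<integral>\<omega>. indicator B \<omega> * Z t \<omega> \<partial>P) = (\<integral>\<omega>. indicator B \<omega> * Z s \<omega> \<partial>P)"
      using D(6)[of s t B] s t by simp
  qed auto
  moreover have "cadlag_on {0..T} (\<lambda>t. Z t \<omega>)" if "\<omega> \<in> space P" for \<omega>
    using that by (cases "\<omega> \<in> ?G") (auto simp: Z_def cadlag_on_zero)
  ultimately show "Z \<in> M2_space P F T" by (simp add: M2_space_def)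
qed

text \<open>Against an indicator, the integral of the difference is at most its L1 norm, hence at
  most its L2 norm because the total mass is 1.\<close>

lemma tendsto_integral_L2:
  assumes f: "\<And>n. f n \<in> L2_space P" and g: "g \<in> L2_space P" and B: "B \<in> sets P"
    and lim: "(\<lambda>n. L2_enorm P (\<lambda>\<omega>. f n \<omega> - g \<omega>)) \<longlonglongrightarrow> 0"
  shows "(\<lambda>n. \<integral>\<omega>. indicator B \<omega> * f n \<omega> \<partial>P) \<longlonglongrightarrow> (\<integral>\<omega>. indicator B \<omega> * g \<omega> \<partial>P)"
proof -
  have [measurable]: "f n \<in> borel_measurable P" "g \<in> borel_measurable P" "B \<in> sets P" for n
    using f g B by (auto simp: L2_space_def)
  have int: "integrable P (\<lambda>\<omega>. indicator B \<omega> * h \<omega>)" if "h \<in> L2_space P" for h :: "'w \<Rightarrow> real"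
    using integrable_mult_indicator[OF B square_integrable_imp_integrable[of h]] that by (simp add: L2_space_def)
  have le: "ennreal \<bar>(\<integral>\<omega>. indicator B \<omega> * f n \<omega> \<partial>P) - (\<integral>\<omega>. indicator B \<omega> * g \<omega> \<partial>P)\<bar> \<le> L2_enorm P (\<lambda>\<omega>. f n \<omega> - g \<omega>)" for n
  proof -
    have "ennreal (norm (\<integral>\<omega>. indicator B \<omega> * f n \<omega> - indicator B \<omega> * g \<omega> \<partial>P))
        \<le> (\<integral>\<^sup>+\<omega>. norm (indicator B \<omega> * f n \<omega> - indicator B \<omega> * g \<omega>) \<partial>P)"
      by (intro integral_norm_bound_ennreal Bochner_Integration.integrable_diff int f g)
    also have "\<dots> \<le> (\<integral>\<^sup>+\<omega>. ennreal \<bar>f n \<omega> - g \<omega>\<bar> * 1 \<partial>P)"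
      by (intro nn_integral_mono) (auto split: split_indicator)
    also have "\<dots> \<le> enorm2 P (\<lambda>\<omega>. ennreal \<bar>f n \<omega> - g \<omega>\<bar>) * enorm2 P (\<lambda>_. 1)"
      by (rule nn_integral_mult_le_enorm2) simp_all
    also have "enorm2 P (\<lambda>_. 1) = ennsqrt (1\<^sup>2)" by (simp add: enorm2_def emeasure_space_1)
    also have "ennsqrt (1\<^sup>2) = 1" by (rule ennsqrt_of_power2)
    finally show ?thesis using int f g by (simp add: L2_enorm_eq)
  qed
  have "(\<lambda>n. ennreal \<bar>(\<integral>\<omega>. indicator B \<omega> * f n \<omega> \<partial>P) - (\<integral>\<omega>. indicator B \<omega> * g \<omega> \<partial>P)\<bar>) \<longlonglongrightarrow> ennreal 0"
    by (rule tendsto_sandwich[OF _ _ tendsto_const lim[unfolded ennreal_0[symmetric]]]) (auto simp: le)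
  then have "(\<lambda>n. \<bar>(\<integral>\<omega>. indicator B \<omega> * f n \<omega> \<partial>P) - (\<integral>\<omega>. indicator B \<omega> * g \<omega> \<partial>P)\<bar>) \<longlonglongrightarrow> 0"
    by (subst (asm) tendsto_ennreal_iff) auto
  then show ?thesis by (rule LIM_zero_cancel[OF tendsto_rabs_zero_cancel])
qed

text \<open>By the maximal inequality the paths converge uniformly
  along a sequence whose terminal values converge fast enough.\<close>

lemma M2_space_complete:
  assumes Z: "\<And>n. Z n \<in> M2_space P F T" and T: "0 < T"
    and fast: "\<And>n. L2_enorm P (\<lambda>\<omega>. Z (Suc n) T \<omega> - Z n T \<omega>) \<le> ennreal (c * (1/4)^n)"
    and Y: "\<And>t. t \<in> {0..T} \<Longrightarrow> Y t \<in> L2_space P"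
    and lim: "\<And>t. t \<in> {0..T} \<Longrightarrow> (\<lambda>n. L2_enorm P (\<lambda>\<omega>. Z n t \<omega> - Y t \<omega>)) \<longlonglongrightarrow> 0"
  obtains Z' where "Z' \<in> M2_space P F T" "\<And>t. t \<in> {0..T} \<Longrightarrow> AE \<omega> in P. Z' t \<omega> = Y t \<omega>"
proof -
  define D where "D n = (\<lambda>t \<omega>. Z (Suc n) t \<omega> - Z n t \<omega>)" for n
  have D: "D n \<in> M2_space P F T" for n unfolding D_def by (intro M2_space_diff Z)
  have "\<exists>W. W \<in> borel_measurable P \<and> (\<forall>\<omega>\<in>space P. \<forall>t\<in>{0..T}. ennreal ((D n t \<omega>)\<^sup>2) \<le> W \<omega>) \<and>
      (\<integral>\<^sup>+\<omega>. W \<omega> \<partial>P) \<le> 4 * (\<integral>\<^sup>+\<omega>. ennreal ((D n T \<omega>)\<^sup>2) \<partial>P)" for n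
  proof (rule doob_L2[OF D T, of n])
    fix W assume W: "W \<in> borel_measurable P"
      "\<And>\<omega> t. \<omega> \<in> space P \<Longrightarrow> t \<in> {0..T} \<Longrightarrow> ennreal ((D n t \<omega>)\<^sup>2) \<le> W \<omega>"
      "(\<integral>\<^sup>+\<omega>. W \<omega> \<partial>P) \<le> 4 * (\<integral>\<^sup>+\<omega>. ennreal ((D n T \<omega>)\<^sup>2) \<partial>P)"
    show ?thesis by (intro exI[of _ W] conjI ballI W)
  qed
  then obtain W where W [measurable]: "\<And>n. W n \<in> borel_measurable P"
    and W1: "\<And>n \<omega> t. \<omega> \<in> space P \<Longrightarrow> t \<in> {0..T} \<Longrightarrow> ennreal ((D n t \<omega>)\<^sup>2) \<le> W n \<omega>"
    and W2: "\<And>n. (\<integral>\<^sup>+\<omega>. W n \<omega> \<partial>P) \<le> 4 * (\<integral>\<^sup>+\<omega>. ennreal ((D n T \<omega>)\<^sup>2) \<partial>P)"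
    by metis
  have W3: "(\<integral>\<^sup>+\<omega>. W n \<omega> \<partial>P) \<le> ennreal (4 * c\<^sup>2 * (1/16)^n)" for n
  proof -
    have "(\<integral>\<^sup>+\<omega>. ennreal ((D n T \<omega>)\<^sup>2) \<partial>P) = (L2_enorm P (D n T))\<^sup>2" by (simp add: L2_enorm_def)
    also have "\<dots> \<le> (ennreal (c * (1/4)^n))\<^sup>2"
      using fast[of n] by (simp add: ennreal_power2_mono_iff D_def)
    \<comment> \<open>An inequality and not an equation, as \<open>ennreal\<close> sends a negative
      bound to 0.\<close>
    also have "\<dots> \<le> ennreal ((c * (1/4)^n)\<^sup>2)"
      by (cases "0 \<le> c * (1/4)^n") (auto simp: ennreal_power ennreal_neg)
    also have "(c * (1/4)^n)\<^sup>2 = c\<^sup>2 * (1/16)^n"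
      by (simp add: power_mult_distrib power_mult[symmetric] mult.commute[of n] power_divide) (simp add: power_mult)
    finally have "(\<integral>\<^sup>+\<omega>. ennreal ((D n T \<omega>)\<^sup>2) \<partial>P) \<le> ennreal (c\<^sup>2 * (1/16)^n)" .
    from mult_left_mono[OF this, of 4] W2[of n] show ?thesis
      by (simp add: ennreal_mult mult.assoc)
  qed
  \<comment> \<open>The means of \<open>W n\<close> decay like \<open>(1/16)^n\<close>, so the
    weight \<open>4^n\<close> leaves a convergent series. Conversely, where \<open>?C\<close> is
    finite, the squared increments are bounded by a multiple of \<open>(1/4)^n\<close> and the
    increments by a multiple of \<open>(1/2)^n\<close>, which is summable.\<close>
  let ?C = "\<lambda>\<omega>. \<Sum>n. ennreal (4^n) * W n \<omega>"
  have "(\<integral>\<^sup>+\<omega>. ?C \<omega> \<partial>P) = (\<Sum>n. ennreal (4^n) * (\<integral>\<^sup>+\<omega>. W n \<omega> \<partial>P))"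
    by (simp add: nn_integral_suminf nn_integral_cmult)
  also have "\<dots> \<le> (\<Sum>n. ennreal (4 * c\<^sup>2 * (1/4)^n))"
  proof (intro suminf_le summableI)
    fix n
    have "ennreal (4^n) * (\<integral>\<^sup>+\<omega>. W n \<omega> \<partial>P) \<le> ennreal (4^n) * ennreal (4 * c\<^sup>2 * (1/16)^n)"
      by (intro mult_left_mono W3) simp
    also have "\<dots> = ennreal (4^n * (4 * c\<^sup>2 * (1/16)^n))" by (simp add: ennreal_mult)
    also have "(4::real)^n * (4 * c\<^sup>2 * (1/16)^n) = 4 * c\<^sup>2 * ((4::real)^n * (1/16)^n)" by simp
    also have "(4::real)^n * (1/16)^n = (1/4)^n" by (simp add: power_mult_distrib[symmetric])
    finally show "ennreal (4^n) * (\<integral>\<^sup>+\<omega>. W n \<omega> \<partial>P) \<le> ennreal (4 * c\<^sup>2 * (1/4)^n)" .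
  qed
  also have "\<dots> < \<infinity>"
  proof -
    have "summable (\<lambda>n. 4 * c\<^sup>2 * (1/4::real)^n)" by (intro summable_mult summable_geometric) simp
    then show ?thesis by (simp add: suminf_ennreal2 less_top[symmetric])
  qed
  finally have fin: "AE \<omega> in P. ?C \<omega> \<noteq> \<infinity>" by (intro nn_integral_PInf_AE) auto
  let ?G = "{\<omega> \<in> space P. ?C \<omega> \<noteq> \<infinity>}"
  have G: "?G \<in> sets (F t)" if "0 \<le> t" for t by (rule sets_F_if_AE[OF fin that])
  have unif: "\<exists>h. uniform_limit {0..T} (\<lambda>n t. Z n t \<omega>) h sequentially" if \<omega>: "\<omega> \<in> ?G" for \<omega>
  proof -
    obtain C where C: "?C \<omega> = ennreal C" "0 \<le> C" using \<omega> by (cases "?C \<omega>") auto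
    have bnd: "norm (D n t \<omega>) \<le> sqrt C * (1/2)^n" if t: "t \<in> {0..T}" for n t
    proof -
      have "ennreal (4^n * (D n t \<omega>)\<^sup>2) \<le> ennreal (4^n) * W n \<omega>"
        using W1[of \<omega> t n] \<omega> t by (simp add: ennreal_mult mult_left_mono)
      also have "\<dots> \<le> ?C \<omega>"
        using sum_le_suminf[of "\<lambda>n. ennreal (4^n) * W n \<omega>" "{n}"] by simp
      finally have "4^n * (D n t \<omega>)\<^sup>2 \<le> C" using C by simp
      then have "(D n t \<omega>)\<^sup>2 \<le> C / 4^n" by (simp add: field_simps)
      then have "sqrt ((D n t \<omega>)\<^sup>2) \<le> sqrt (C / 4^n)" by (rule real_sqrt_le_mono)
      moreover have "sqrt ((4::real)^n) = 2^n" by (simp add: real_sqrt_power)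
      ultimately show ?thesis by (simp add: real_sqrt_divide power_divide)
    qed
    have "uniform_limit {0..T} (\<lambda>n t. \<Sum>i<n. D i t \<omega>) (\<lambda>t. \<Sum>i. D i t \<omega>) sequentially"
    proof (rule Weierstrass_m_test[OF bnd])
      show "summable (\<lambda>n. sqrt C * (1/2)^n)" by (intro summable_mult summable_geometric) simp
    qed
    from uniform_limit_add[OF uniform_limit_const this]
    have "uniform_limit {0..T} (\<lambda>n t. Z 0 t \<omega> + (\<Sum>i<n. D i t \<omega>)) (\<lambda>t. Z 0 t \<omega> + (\<Sum>i. D i t \<omega>)) sequentially" .
    moreover have "Z 0 t \<omega> + (\<Sum>i<n. D i t \<omega>) = Z n t \<omega>" for n t
      by (induction n) (auto simp: D_def)
    ultimately show ?thesis by auto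
  qed
  \<comment> \<open>The set \<open>?G\<close> has probability one and so belongs to
    \<open>F t\<close> for every \<open>t \<ge> 0\<close>. The value 0 outside it keeps the limit
    adapted and makes the exceptional paths cadlag.\<close>
  define Z' where "Z' t \<omega> = (if \<omega> \<in> ?G then lim (\<lambda>n. Z n t \<omega>) else 0)" for t \<omega>
  have unif': "uniform_limit {0..T} (\<lambda>n t. Z n t \<omega>) (\<lambda>t. Z' t \<omega>) sequentially" if \<omega>: "\<omega> \<in> ?G" for \<omega>
  proof -
    obtain h where h: "uniform_limit {0..T} (\<lambda>n t. Z n t \<omega>) h sequentially" using unif[OF \<omega>] by blast
    have "h t = Z' t \<omega>" if "t \<in> {0..T}" for t
      using limI[OF tendsto_uniform_limitI[OF h that]] \<omega> by (simp add: Z'_def)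
    then show ?thesis using h by (subst (asm) uniform_limit_cong'[of "{0..T}" _ "\<lambda>n t. Z n t \<omega>" _ "\<lambda>t. Z' t \<omega>"]) auto
  qed
  have conv: "(\<lambda>n. indicator ?G \<omega> * Z n t \<omega>) \<longlonglongrightarrow> Z' t \<omega>" if t: "t \<in> {0..T}" for t \<omega>
  proof (cases "\<omega> \<in> ?G")
    case True
    from tendsto_uniform_limitI[OF unif'[OF this] t] True show ?thesis
      by (simp only: indicator_simps mult_1_left)
  next
    case False
    show ?thesis unfolding Z'_def indicator_simps(2)[OF False] if_not_P[OF False] by simp
  qed
  have ZD: "zero_mean_L2_martingale_on P F {0..T} (Z n)" for n using Z[of n] by (simp add: M2_space_def)
  have T0: "{0..T} \<subseteq> {0..}" by auto
  note D' = zero_mean_L2_martingale_onD[OF ZD T0]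
  have mF: "Z' t \<in> borel_measurable (F t)" if t: "t \<in> {0..T}" for t
  proof (rule borel_measurable_LIMSEQ_real)
    show "(\<lambda>n. indicator ?G \<omega> * Z n t \<omega>) \<longlonglongrightarrow> Z' t \<omega>" for \<omega> by (rule conv[OF t])
    show "(\<lambda>\<omega>. indicator ?G \<omega> * Z n t \<omega>) \<in> borel_measurable (F t)" for n
      using D'(1)[of t n] G[of t] t by (intro borel_measurable_times borel_measurable_indicator) auto
  qed
  have ZP [measurable]: "Z n t \<in> borel_measurable P" if "t \<in> {0..T}" for n t using D'(2) that by auto
  have Z'P [measurable]: "Z' t \<in> borel_measurable P" if "t \<in> {0..T}" for t
    using measurable_F_P[OF _ mF[OF that]] that by auto
  have YP [measurable]: "Y t \<in> borel_measurable P" if "t \<in> {0..T}" for t using Y[OF that] by (simp add: L2_space_def)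
  \<comment> \<open>Fatou's lemma identifies the limit along paths with the prescribed L2
    limit.\<close>
  have ae: "AE \<omega> in P. Z' t \<omega> = Y t \<omega>" if t: "t \<in> {0..T}" for t
  proof -
    note [measurable] = ZP[OF t] Z'P[OF t] YP[OF t]
    have "(\<integral>\<^sup>+\<omega>. ennreal ((Z' t \<omega> - Y t \<omega>)\<^sup>2) \<partial>P) \<le> (\<integral>\<^sup>+\<omega>. liminf (\<lambda>n. ennreal ((Z n t \<omega> - Y t \<omega>)\<^sup>2)) \<partial>P)"
    proof (rule nn_integral_mono_AE)
      show "AE \<omega> in P. ennreal ((Z' t \<omega> - Y t \<omega>)\<^sup>2) \<le> liminf (\<lambda>n. ennreal ((Z n t \<omega> - Y t \<omega>)\<^sup>2))"
        using fin AE_space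
      proof eventually_elim
        fix \<omega> assume "?C \<omega> \<noteq> \<infinity>" "\<omega> \<in> space P"
        then have "(\<lambda>n. Z n t \<omega>) \<longlonglongrightarrow> Z' t \<omega>" using conv[OF t, of \<omega>] by simp
        then have "(\<lambda>n. ennreal ((Z n t \<omega> - Y t \<omega>)\<^sup>2)) \<longlonglongrightarrow> ennreal ((Z' t \<omega> - Y t \<omega>)\<^sup>2)"
          by (intro tendsto_intros)
        from lim_imp_Liminf[OF sequentially_bot this]
        show "ennreal ((Z' t \<omega> - Y t \<omega>)\<^sup>2) \<le> liminf (\<lambda>n. ennreal ((Z n t \<omega> - Y t \<omega>)\<^sup>2))" by simp
      qed
    qed
    also have "\<dots> \<le> liminf (\<lambda>n. \<integral>\<^sup>+\<omega>. ennreal ((Z n t \<omega> - Y t \<omega>)\<^sup>2) \<partial>P)"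
      by (rule nn_integral_liminf) simp
    also have "\<dots> = 0"
    proof (rule lim_imp_Liminf[OF sequentially_bot])
      have "(\<lambda>n. L2_enorm P (\<lambda>\<omega>. Z n t \<omega> - Y t \<omega>) * L2_enorm P (\<lambda>\<omega>. Z n t \<omega> - Y t \<omega>)) \<longlonglongrightarrow> 0 * 0"
        by (intro tendsto_mult_ennreal lim t) auto
      then show "(\<lambda>n. \<integral>\<^sup>+\<omega>. ennreal ((Z n t \<omega> - Y t \<omega>)\<^sup>2) \<partial>P) \<longlonglongrightarrow> 0"
        by (simp add: L2_enorm_def power2_eq_square[symmetric])
    qed
    finally have "(\<integral>\<^sup>+\<omega>. ennreal ((Z' t \<omega> - Y t \<omega>)\<^sup>2) \<partial>P) = 0" by simp
    then have "AE \<omega> in P. ennreal ((Z' t \<omega> - Y t \<omega>)\<^sup>2) = 0"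
      by (subst (asm) nn_integral_0_iff_AE) auto
    then show ?thesis by eventually_elim (simp add: ennreal_eq_0_iff)
  qed
  have ZL: "Z n t \<in> L2_space P" if "t \<in> {0..T}" for n t using D'(2,3) that by (auto simp: L2_space_def)
  have intB: "(\<lambda>n. \<integral>\<omega>. indicator B \<omega> * Z n t \<omega> \<partial>P) \<longlonglongrightarrow> (\<integral>\<omega>. indicator B \<omega> * Z' t \<omega> \<partial>P)"
    if t: "t \<in> {0..T}" and B: "B \<in> sets P" for B t
  proof -
    have "(\<integral>\<omega>. indicator B \<omega> * Y t \<omega> \<partial>P) = (\<integral>\<omega>. indicator B \<omega> * Z' t \<omega> \<partial>P)"
      using ae[OF t] YP[OF t] Z'P[OF t] B by (intro integral_cong_AE) auto
    then show ?thesis using tendsto_integral_L2[OF ZL[OF t] Y[OF t] B lim[OF t]] by simp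
  qed
  have "zero_mean_L2_martingale_on P F {0..T} Z'"
  proof (rule zero_mean_L2_martingale_onI)
    fix t assume t: "t \<in> {0..T}"
    show "Z' t \<in> borel_measurable (F t)" by (rule mF[OF t])
    show "integrable P (\<lambda>\<omega>. (Z' t \<omega>)\<^sup>2)"
      using ae[OF t] YP[OF t] Z'P[OF t] Y[OF t]
      by (subst integrable_cong_AE[where g="\<lambda>\<omega>. (Y t \<omega>)\<^sup>2"]) (auto simp: L2_space_def)
    have sp: "(\<integral>\<omega>. indicator (space P) \<omega> * f \<omega> \<partial>P) = (\<integral>\<omega>. f \<omega> \<partial>P)" for f :: "'w \<Rightarrow> real"
      by (intro Bochner_Integration.integral_cong) auto
    have "(\<lambda>n. 0) \<longlonglongrightarrow> (\<integral>\<omega>. Z' t \<omega> \<partial>P)"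
      using intB[OF t sets.top] D'(5)[of t] t by (simp add: sp)
    then show "(\<integral>\<omega>. Z' t \<omega> \<partial>P) = 0" by (simp add: LIMSEQ_const_iff)
    fix s B assume s: "s \<in> {0..T}" "s \<le> t" "B \<in> sets (F s)"
    then have B: "B \<in> sets P" using sets_F_imp_sets_P by auto
    have "(\<integral>\<omega>. indicator B \<omega> * Z n t \<omega> \<partial>P) = (\<integral>\<omega>. indicator B \<omega> * Z n s \<omega> \<partial>P)" for n
      using D'(6)[of s t B n] s t by simp
    with intB[OF t B] intB[OF s(1) B]
    show "(\<integral>\<omega>. indicator B \<omega> * Z' t \<omega> \<partial>P) = (\<integral>\<omega>. indicator B \<omega> * Z' s \<omega> \<partial>P)"
      by (simp add: LIMSEQ_unique)
  qed auto
  moreover have "cadlag_on {0..T} (\<lambda>t. Z' t \<omega>)" if "\<omega> \<in> space P" for \<omega>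
  proof (cases "\<omega> \<in> ?G")
    case True
    show ?thesis
      by (rule cadlag_on_uniform_limit[OF _ unif'[OF True]]) (use Z that in \<open>auto simp: M2_space_def\<close>)
  qed (auto simp: Z'_def cadlag_on_zero)
  ultimately have "Z' \<in> M2_space P F T" by (simp add: M2_space_def)
  then show thesis using ae by (rule that)
qed

end

section \<open>The weak integral process\<close>

text \<open>Polarization determines the form, so the definite description must be the inner product
  of any completion. This carries measurability and boundedness of \<open>hform\<close> over to
  inner products in the ambient space.\<close>

lemma hform_eq_inner:
  assumes "hilbert_completion p j"
  shows "hform p \<phi> \<psi> = inner (j \<phi>) (j \<psi>)"
proof -
  have j: "linear j" and n: "\<And>x. norm (j x) = p x" using assms by (auto simp: hilbert_completion_def)
  have ex: "form_of_seminorm p (\<lambda>x y. inner (j x) (j y))"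
    unfolding form_of_seminorm_def bilinear_def linear_iff
    by (simp add: linear_add[OF j] linear_scale[OF j] inner_add_left inner_add_right inner_commute n[symmetric]
        power2_norm_eq_inner)
  moreover have "b = (\<lambda>x y. inner (j x) (j y))" if b: "form_of_seminorm p b" for b
  proof -
    have pol: "b x y = ((p (x + y))\<^sup>2 - (p x)\<^sup>2 - (p y)\<^sup>2) / 2" if "form_of_seminorm p b" for b x y
    proof -
      have bl: "bilinear b" and s: "\<And>x y. b x y = b y x" and q: "\<And>x. (p x)\<^sup>2 = b x x"
        using that by (auto simp: form_of_seminorm_def)
      show ?thesis unfolding q by (simp add: bilinear_ladd[OF bl] bilinear_radd[OF bl] s[of y x])
    qed
    show ?thesis by (intro ext) (simp only: pol[OF b] pol[OF ex])
  qed
  ultimately have "hform p = (\<lambda>x y. inner (j x) (j y))"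
    unfolding hform_def by (intro the_equality)
  then show ?thesis by simp
qed

section \<open>Predictable sets\<close>

context stochastic_basis
begin

lemma predictable_generator_subset:
  "{{s<..t} \<times> A | s t A. 0 \<le> s \<and> s \<le> t \<and> t \<le> T \<and> A \<in> sets (F s)} \<union> {{0} \<times> A | A. A \<in> sets (F 0)}
    \<subseteq> Pow ({0..T} \<times> space P)" if "0 < T"
proof -
  have "A \<subseteq> space P" if "0 \<le> s" "A \<in> sets (F s)" for s A
    using that subalgebra_F[of s] sets.sets_into_space[of A "F s"] by (auto simp: subalgebra_def)
  with that show ?thesis by fastforce
qed

lemma space_predictable: "0 < T \<Longrightarrow> space (predictable_algebra P F T) = {0..T} \<times> space P"
  unfolding predictable_algebra_def by (intro space_measure_of predictable_generator_subset)

lemma sets_predictable_Ioc: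
  assumes "0 \<le> s" "s \<le> t" "t \<le> T" "A \<in> sets (F s)" "0 < T"
  shows "{s<..t} \<times> A \<in> sets (predictable_algebra P F T)"
  unfolding predictable_algebra_def sets_measure_of[OF predictable_generator_subset[OF assms(5)]]
  using assms by (intro sigma_sets.Basic) blast

lemma sets_predictable_zero:
  assumes "A \<in> sets (F 0)" "0 < T"
  shows "{0} \<times> A \<in> sets (predictable_algebra P F T)"
  unfolding predictable_algebra_def sets_measure_of[OF predictable_generator_subset[OF assms(2)]]
  using assms by (intro sigma_sets.Basic) blast

lemma space_in_F: "0 \<le> t \<Longrightarrow> space P \<in> sets (F t)"
  using subalgebra_F[of t] sets.top[of "F t"] by (simp add: subalgebra_def)

text \<open>The sets of times up to \<open>a\<close> are a generator at time 0 together with one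
  half-open generator. The lemma lets \<open>q_measurable\<close> be composed with the time
  coordinate.\<close>

lemma measurable_fst_predictable:
  assumes T: "0 < T"
  shows "fst \<in> predictable_algebra P F T \<rightarrow>\<^sub>M restrict_space borel {0..}"
proof (rule measurable_restrict_space2)
  show "fst \<in> borel_measurable (predictable_algebra P F T)"
    unfolding borel_measurable_iff_le
  proof
    fix a :: real
    have "{w \<in> space (predictable_algebra P F T). fst w \<le> a} =
        (if 0 \<le> a then {0} \<times> space P \<union> {0<..min a T} \<times> space P else {})"
      using T by (auto simp: space_predictable)
    then show "{w \<in> space (predictable_algebra P F T). fst w \<le> a} \<in> sets (predictable_algebra P F T)"
      using sets_predictable_zero[OF space_in_F T] sets_predictable_Ioc[OF _ _ _ space_in_F T, of 0 "min a T"] T by auto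
  qed
qed (use T in \<open>auto simp: space_predictable\<close>)

text \<open>The generators of the predictable \<sigma>-algebra are measurable rectangles, so the
  product measure can be transported to it by the identity. Those at time 0 leave an empty trace on
  \<open>{0<..T}\<close>.\<close>

lemma measurable_id_predictable:
  assumes T: "0 < T" and L: "sets L = sets (restrict_space borel {0<..T})"
  shows "(\<lambda>x. x) \<in> L \<Otimes>\<^sub>M P \<rightarrow>\<^sub>M predictable_algebra P F T"
  unfolding predictable_algebra_def
proof (rule measurable_measure_of[OF predictable_generator_subset[OF T]])
  have sp: "space L = {0<..T}" using sets_eq_imp_space_eq[OF L] by simp
  then show "(\<lambda>x. x) \<in> space (L \<Otimes>\<^sub>M P) \<rightarrow> {0..T} \<times> space P" by (auto simp: space_pair_measure)
  fix y assume "y \<in> {{s<..t} \<times> A | s t A. 0 \<le> s \<and> s \<le> t \<and> t \<le> T \<and> A \<in> sets (F s)} \<union> {{0} \<times> A | A. A \<in> sets (F 0)}"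
  then have "\<exists>B s A. y = B \<times> A \<and> B \<in> sets borel \<and> 0 \<le> s \<and> A \<in> sets (F s)"
  proof
    assume "y \<in> {{s<..t} \<times> A | s t A. 0 \<le> s \<and> s \<le> t \<and> t \<le> T \<and> A \<in> sets (F s)}"
    then obtain s t A where "y = {s<..t} \<times> A" "0 \<le> s" "A \<in> sets (F s)" by blast
    then show ?thesis by (intro exI[of _ "{s<..t}"] exI[of _ s] exI[of _ A]) simp
  next
    assume "y \<in> {{0} \<times> A | A. A \<in> sets (F 0)}"
    then obtain A where "y = {0} \<times> A" "A \<in> sets (F 0)" by blast
    then show ?thesis by (intro exI[of _ "{0}"] exI[of _ 0] exI[of _ A]) simp
  qed
  then obtain B s A where y: "y = B \<times> A" "B \<in> sets borel" "0 \<le> s" "A \<in> sets (F s)" by blast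
  have A: "A \<in> sets P" using y by (auto intro: sets_F_imp_sets_P)
  have "B \<inter> {0<..T} \<in> sets L" unfolding L using y(2) by (auto simp: sets_restrict_space)
  then have "(B \<inter> {0<..T}) \<times> A \<in> sets (L \<Otimes>\<^sub>M P)" using A by simp
  moreover have "(\<lambda>x. x) -` y \<inter> space (L \<Otimes>\<^sub>M P) = (B \<inter> {0<..T}) \<times> A"
    using sets.sets_into_space[OF A] by (auto simp: y sp space_pair_measure)
  ultimately show "(\<lambda>x. x) -` y \<inter> space (L \<Otimes>\<^sub>M P) \<in> sets (L \<Otimes>\<^sub>M P)" by simp
qed

end

section \<open>Integrands as sections of a field of Hilbert spaces\<close>

locale weak_integrands = nuclear_cylindrical_mvm P F \<R> M \<mu> \<Lambda> q
  for P :: "'w measure" and F :: "real \<Rightarrow> 'w measure" and \<R> :: "'u::topological_space set set"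
    and M :: "real \<Rightarrow> 'u set \<Rightarrow> 'f::locally_convex_space \<Rightarrow> 'w \<Rightarrow> real"
    and \<mu> :: "'u measure" and \<Lambda> :: "real measure" and q :: "real \<Rightarrow> 'u \<Rightarrow> 'f \<Rightarrow> real" +
  fixes \<iota> :: "real \<Rightarrow> 'u \<Rightarrow> 'f \<Rightarrow> 'h::{real_inner, banach, second_countable_topology}"
    and T :: real and d :: "nat \<Rightarrow> 'f"
  assumes T_pos: "0 < T"
    and completion: "0 \<le> r \<Longrightarrow> hilbert_completion (q r u) (\<iota> r u)"
    and d_zero: "d 0 = 0"
    and d_dense: "r \<in> {0..T} \<Longrightarrow> completion_space (\<iota> r u) \<subseteq> closure (range (\<lambda>i. \<iota> r u (d i)))"
begin

abbreviation prd :: "(real \<times> 'w) measure" where "prd \<equiv> predictable_algebra P F T"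

definition base :: "((real \<times> 'w) \<times> 'u) measure" where
  "base = (restrict_space \<Lambda> {0<..T} \<Otimes>\<^sub>M P) \<Otimes>\<^sub>M \<mu>"

text \<open>The product measure on the predictable \<open>\<sigma>\<close>-algebra, so that measurability with respect to \<open>\<nu>\<close>
  includes predictability.\<close>

definition \<nu> :: "((real \<times> 'w) \<times> 'u) measure" where
  "\<nu> = distr base (prd \<Otimes>\<^sub>M borel) (\<lambda>x. x)"

definition fib :: "(real \<times> 'w) \<times> 'u \<Rightarrow> 'f \<Rightarrow> 'h" where
  "fib x = \<iota> (fst (fst x)) (snd x)"

definition unc :: "(real \<Rightarrow> 'w \<Rightarrow> 'u \<Rightarrow> 'h) \<Rightarrow> (real \<times> 'w) \<times> 'u \<Rightarrow> 'h" where
  "unc X x = X (fst (fst x)) (snd (fst x)) (snd x)"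

definition cur :: "((real \<times> 'w) \<times> 'u \<Rightarrow> 'h) \<Rightarrow> real \<Rightarrow> 'w \<Rightarrow> 'u \<Rightarrow> 'h" where
  "cur f r \<omega> u = f ((r, \<omega>), u)"

lemma unc_cur [simp]: "unc (cur f) = f" by (simp add: unc_def cur_def fun_eq_iff)

lemma \<Lambda>_sets: "sets (restrict_space \<Lambda> {0<..T}) = sets (restrict_space borel {0<..T})"
proof -
  have "sets (restrict_space \<Lambda> {0<..T}) = sets (restrict_space (restrict_space borel {0..}) {0<..T})"
    by (rule sets_restrict_space_cong[OF sets_Lambda])
  also have "\<dots> = sets (restrict_space borel ({0..} \<inter> {0<..T}))" by (simp add: restrict_restrict_space)
  also have "{0..} \<inter> {0<..T} = {0<..T}" by auto
  finally show ?thesis .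
qed

lemma space_\<Lambda>: "space \<Lambda> = {0..}"
  using sets_eq_imp_space_eq[OF sets_Lambda] by simp

lemma Ioc_\<Lambda>: "{0<..T} \<in> sets \<Lambda>"
  unfolding sets_Lambda sets_restrict_space by (auto intro!: image_eqI[of _ _ "{0<..T}"])

lemma space_\<mu> [simp]: "space \<mu> = UNIV"
  using sets_eq_imp_space_eq[OF sets_mu] by simp

lemma finite_\<Lambda>: "finite_measure (restrict_space \<Lambda> {0<..T})"
proof (rule finite_measureI)
  have "emeasure \<Lambda> {0<..T} \<le> emeasure \<Lambda> {0..T}"
    unfolding sets_Lambda by (intro emeasure_mono) (auto simp: sets_Lambda sets_restrict_space intro!: image_eqI[of _ _ "{0..T}"])
  also have "\<dots> < \<infinity>" by (rule finite_Lambda) simp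
  finally show "emeasure (restrict_space \<Lambda> {0<..T}) (space (restrict_space \<Lambda> {0<..T})) \<noteq> \<infinity>"
    using Ioc_\<Lambda> by (simp add: space_restrict_space emeasure_restrict_space space_\<Lambda> Int_absorb2 subset_iff)
qed

lemma measurable_base: "(\<lambda>x. x) \<in> base \<rightarrow>\<^sub>M prd \<Otimes>\<^sub>M borel"
proof -
  have "(\<lambda>x. (fst x, snd x)) \<in> base \<rightarrow>\<^sub>M prd \<Otimes>\<^sub>M borel"
    unfolding base_def
  proof (rule measurable_Pair)
    show "fst \<in> (restrict_space \<Lambda> {0<..T} \<Otimes>\<^sub>M P) \<Otimes>\<^sub>M \<mu> \<rightarrow>\<^sub>M prd"
      by (rule measurable_compose[OF measurable_fst measurable_id_predictable[OF T_pos \<Lambda>_sets]])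
    show "snd \<in> (restrict_space \<Lambda> {0<..T} \<Otimes>\<^sub>M P) \<Otimes>\<^sub>M \<mu> \<rightarrow>\<^sub>M borel"
      using measurable_snd measurable_cong_sets[OF refl sets_mu] by blast
  qed
  then show ?thesis by simp
qed

lemma sets_\<nu> [measurable_cong]: "sets \<nu> = sets (prd \<Otimes>\<^sub>M borel)"
  by (simp add: \<nu>_def)

lemma space_\<nu>: "space \<nu> = ({0..T} \<times> space P) \<times> UNIV"
  by (simp add: \<nu>_def space_pair_measure space_predictable[OF T_pos])

text \<open>Brings the integral into the order in which \<open>w_enorm\<close> iterates it, so that
  \<open>w_enorm\<close> becomes the L2 norm of a section.\<close>

lemma nn_integral_\<nu>:
  assumes f: "f \<in> borel_measurable \<nu>"
  shows "(\<integral>\<^sup>+x. f x \<partial>\<nu>) = (\<integral>\<^sup>+\<omega>. (\<integral>\<^sup>+r\<in>{0<..T}. (\<integral>\<^sup>+u. f ((r, \<omega>), u) \<partial>\<mu>) \<partial>\<Lambda>) \<partial>P)"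
proof -
  interpret \<mu>: sigma_finite_measure \<mu> by (rule sigma_finite_mu)
  interpret L: finite_measure "restrict_space \<Lambda> {0<..T}" by (rule finite_\<Lambda>)
  interpret LP: pair_sigma_finite "restrict_space \<Lambda> {0<..T}" P ..
  \<comment> \<open>A function measurable for \<open>\<nu>\<close> is predictable, hence measurable
    for the plain product, to which Fubini applies.\<close>
  have fb: "f \<in> borel_measurable (prd \<Otimes>\<^sub>M borel)"
    using f measurable_cong_sets[OF sets_\<nu> refl] by blast
  then have [measurable]: "f \<in> borel_measurable ((restrict_space \<Lambda> {0<..T} \<Otimes>\<^sub>M P) \<Otimes>\<^sub>M \<mu>)"
    using measurable_compose[OF measurable_base fb] by (simp add: base_def)
  have "(\<integral>\<^sup>+x. f x \<partial>\<nu>) = (\<integral>\<^sup>+x. f x \<partial>base)"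
    unfolding \<nu>_def by (rule nn_integral_distr[OF measurable_base f[unfolded \<nu>_def]])
  also have "\<dots> = (\<integral>\<^sup>+x. \<integral>\<^sup>+u. f (x, u) \<partial>\<mu> \<partial>(restrict_space \<Lambda> {0<..T} \<Otimes>\<^sub>M P))"
    unfolding base_def by (rule \<mu>.nn_integral_fst[symmetric]) simp
  also have "\<dots> = (\<integral>\<^sup>+\<omega>. \<integral>\<^sup>+r. (\<integral>\<^sup>+u. f ((r, \<omega>), u) \<partial>\<mu>) \<partial>restrict_space \<Lambda> {0<..T} \<partial>P)"
    by (rule LP.nn_integral_snd[symmetric]) simp
  also have "\<dots> = (\<integral>\<^sup>+\<omega>. (\<integral>\<^sup>+r\<in>{0<..T}. (\<integral>\<^sup>+u. f ((r, \<omega>), u) \<partial>\<mu>) \<partial>\<Lambda>) \<partial>P)"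
    by (subst nn_integral_restrict_space) (auto simp: Ioc_\<Lambda> sets.Int)
  finally show ?thesis .
qed

text \<open>Passing to a smaller \<sigma>-algebra can destroy \<sigma>-finiteness. Here the sets
  \<open>({0..T} \<times> space P) \<times> A i\<close> remain measurable and exhaust the space with
  finite measure.\<close>

lemma sigma_finite_\<nu>: "sigma_finite_measure \<nu>"
proof -
  interpret \<mu>: sigma_finite_measure \<mu> by (rule sigma_finite_mu)
  obtain A :: "nat \<Rightarrow> 'u set" where A: "range A \<subseteq> sets \<mu>" "(\<Union>i. A i) = space \<mu>" "\<And>i. emeasure \<mu> (A i) \<noteq> \<infinity>"
    using \<mu>.sigma_finite by blast
  let ?B = "\<lambda>i. ({0..T} \<times> space P) \<times> A i"
  have B: "?B i \<in> sets \<nu>" for i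
    using A(1) sets.top[of prd] unfolding sets_\<nu> space_predictable[OF T_pos] by (auto simp: sets_mu)
  interpret L: finite_measure "restrict_space \<Lambda> {0<..T}" by (rule finite_\<Lambda>)
  have fin: "emeasure \<nu> (?B i) \<noteq> \<infinity>" for i
  proof -
    have "emeasure \<nu> (?B i) = (\<integral>\<^sup>+x. indicator (?B i) x \<partial>\<nu>)" using B by simp
    also have "\<dots> = (\<integral>\<^sup>+\<omega>. (\<integral>\<^sup>+r\<in>{0<..T}. (\<integral>\<^sup>+u. indicator (?B i) ((r, \<omega>), u) \<partial>\<mu>) \<partial>\<Lambda>) \<partial>P)"
      by (rule nn_integral_\<nu>) (use B in simp)
    also have "\<dots> \<le> (\<integral>\<^sup>+\<omega>. (\<integral>\<^sup>+r\<in>{0<..T}. (\<integral>\<^sup>+u. indicator (A i) u \<partial>\<mu>) \<partial>\<Lambda>) \<partial>P)"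
      by (intro nn_integral_mono mult_right_mono) (auto split: split_indicator)
    also have "\<dots> = emeasure \<mu> (A i) * emeasure \<Lambda> {0<..T}"
    proof -
      have "A i \<in> sets \<mu>" using A(1) by auto
      then show ?thesis using Ioc_\<Lambda> by (simp add: nn_integral_cmult_indicator emeasure_space_1)
    qed
    also have "\<dots> < \<infinity>"
      using A(3)[of i] L.emeasure_finite[of "{0<..T}"] Ioc_\<Lambda>
      by (simp add: ennreal_mult_less_top less_top emeasure_restrict_space)
    finally show ?thesis by simp
  qed
  show ?thesis
  proof
    have "(\<Union>i. ?B i) = ({0..T} \<times> space P) \<times> (\<Union>i. A i)" by auto
    then show "\<exists>B. countable B \<and> B \<subseteq> sets \<nu> \<and> \<Union>B = space \<nu> \<and> (\<forall>b\<in>B. emeasure \<nu> b \<noteq> \<infinity>)"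
      using B fin A(2) by (intro exI[of _ "range ?B"]) (auto simp: space_\<nu>)
  qed
qed

lemma fib_inner_measurable: "(\<lambda>x. inner (fib x \<phi>) (fib x \<psi>)) \<in> borel_measurable \<nu>"
proof -
  have "(\<lambda>x. (fst (fst x), snd x)) \<in> prd \<Otimes>\<^sub>M borel \<rightarrow>\<^sub>M restrict_space borel {0..} \<Otimes>\<^sub>M (borel :: 'u measure)"
    by (intro measurable_Pair measurable_compose[OF measurable_fst measurable_fst_predictable[OF T_pos]] measurable_snd)
  from measurable_compose[OF this q_measurable]
  have "(\<lambda>x. hform (q (fst (fst x)) (snd x)) \<phi> \<psi>) \<in> borel_measurable \<nu>"
    by (simp add: measurable_cong_sets[OF sets_\<nu> refl])
  then show ?thesis
    by (rule measurable_cong[THEN iffD1, rotated])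
       (auto simp: space_\<nu> fib_def intro!: hform_eq_inner completion)
qed

sublocale hilbert_field \<nu> fib d
proof (rule hilbert_field.intro)
  fix x assume x: "x \<in> space \<nu>"
  then show "linear (fib x)"
    using completion[of "fst (fst x)"] by (auto simp: space_\<nu> fib_def hilbert_completion_def)
  have "fst (fst x) \<in> {0..T}" using x by (auto simp: space_\<nu>)
  from order_trans[OF closure_subset d_dense[OF this, unfolded completion_space_def]]
  show "range (fib x) \<subseteq> closure (range (\<lambda>i. fib x (d i)))" unfolding fib_def .
qed (rule fib_inner_measurable d_zero)+

abbreviation L2w :: "(real \<Rightarrow> 'w \<Rightarrow> 'u \<Rightarrow> 'h) set" where "L2w \<equiv> Lambda2w P F \<mu> \<Lambda> \<iota> T"

abbreviation W :: "(real \<Rightarrow> 'w \<Rightarrow> 'u \<Rightarrow> 'h) \<Rightarrow> ennreal" where "W \<equiv> w_enorm P \<mu> \<Lambda> T"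

lemma w_enorm_eq:
  assumes "field_section fib \<nu> (unc X)"
  shows "W X = fnorm (unc X)"
proof -
  have [measurable]: "(\<lambda>x. norm (unc X x)) \<in> borel_measurable \<nu>" by (rule field_section_norm[OF assms])
  have "(\<integral>\<^sup>+x. (ennreal (norm (unc X x)))\<^sup>2 \<partial>\<nu>) =
      (\<integral>\<^sup>+\<omega>. (\<integral>\<^sup>+r\<in>{0<..T}. (\<integral>\<^sup>+u. (ennreal (norm (unc X ((r, \<omega>), u))))\<^sup>2 \<partial>\<mu>) \<partial>\<Lambda>) \<partial>P)"
    by (rule nn_integral_\<nu>) simp
  then show ?thesis by (simp add: w_enorm_def fnorm_def enorm2_def ennreal_power unc_def)
qed

lemma Lambda2w_iff: "X \<in> L2w \<longleftrightarrow> unc X \<in> L2_sections"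
proof -
  have m: "(\<lambda>((r, \<omega>), u). inner (X r \<omega> u) (\<iota> r u \<phi>)) = (\<lambda>x. inner (unc X x) (fib x \<phi>))" for \<phi>
    by (auto simp: fun_eq_iff unc_def fib_def)
  have c: "(\<forall>r\<in>{0..T}. \<forall>\<omega>\<in>space P. \<forall>u. X r \<omega> u \<in> completion_space (\<iota> r u)) \<longleftrightarrow>
      (\<forall>x\<in>space \<nu>. unc X x \<in> closure (range (fib x)))"
    by (auto simp: space_\<nu> unc_def fib_def completion_space_def)
  have "X \<in> L2w \<longleftrightarrow> field_section fib \<nu> (unc X) \<and> W X < \<infinity>"
    by (simp add: Lambda2w_def m c field_section_def measurable_cong_sets[OF sets_\<nu> refl])
  then show ?thesis using w_enorm_eq by (auto simp: L2_sections_def)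
qed

lemma L2w_section: "X \<in> L2w \<Longrightarrow> field_section fib \<nu> (unc X)"
  by (simp add: Lambda2w_iff L2_sections_def)

lemma W_eq: "X \<in> L2w \<Longrightarrow> W X = fnorm (unc X)"
  by (simp add: w_enorm_eq L2w_section)

lemma L2w_lincomb: "X \<in> L2w \<Longrightarrow> Y \<in> L2w \<Longrightarrow> a *\<^sub>R X + b *\<^sub>R Y \<in> L2w"
  using L2_sections_add[OF L2_sections_scaleR[of "unc X" a] L2_sections_scaleR[of "unc Y" b]]
  by (simp add: Lambda2w_iff unc_def[abs_def] scaleR_fun_def plus_fun_def)

lemma L2w_diff: "X \<in> L2w \<Longrightarrow> Y \<in> L2w \<Longrightarrow> X - Y \<in> L2w"
  using L2w_lincomb[of X Y 1 "-1"] by simp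

lemma L2w_zero: "0 \<in> L2w"
  using L2_sections_zero by (simp add: Lambda2w_iff unc_def[abs_def] zero_fun_def)

text \<open>The integrand whose integral over \<open>[0,T]\<close> is the value at time
  \<open>t\<close> of the integral process of \<open>X\<close>.\<close>

definition cut :: "real \<Rightarrow> (real \<Rightarrow> 'w \<Rightarrow> 'u \<Rightarrow> 'h) \<Rightarrow> real \<Rightarrow> 'w \<Rightarrow> 'u \<Rightarrow> 'h" where
  "cut t X = (\<lambda>r \<omega> u. indicator {0..t} r *\<^sub>R X r \<omega> u)"

lemma cut_lincomb: "cut t (a *\<^sub>R X + b *\<^sub>R Y) = a *\<^sub>R cut t X + b *\<^sub>R cut t Y"
  by (simp add: cut_def fun_eq_iff scaleR_fun_def plus_fun_def scaleR_add_right mult.commute)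

lemma cut_diff: "cut t (X - Y) = cut t X - cut t Y"
  by (simp add: cut_def fun_eq_iff fun_diff_def scaleR_diff_right)

lemma cut_zero: "cut t 0 = 0"
  by (simp add: cut_def fun_eq_iff zero_fun_def)

lemma measurable_time: "(\<lambda>x. fst (fst x)) \<in> borel_measurable \<nu>"
proof -
  have "(\<lambda>x. x) \<in> restrict_space borel {0..} \<rightarrow>\<^sub>M (borel :: real measure)" by (rule measurable_restrict_space1) simp
  from measurable_compose[OF measurable_compose[OF measurable_fst measurable_fst_predictable[OF T_pos]] this]
  show ?thesis by (simp add: measurable_cong_sets[OF sets_\<nu> refl])
qed

lemma L2w_cut: assumes "X \<in> L2w" shows "cut t X \<in> L2w" "W (cut t X) \<le> W X"
proof -
  note [measurable] = measurable_time
  have eq: "unc (cut t X) = (\<lambda>x. indicator {0..t} (fst (fst x)) *\<^sub>R unc X x)"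
    by (simp add: unc_def cut_def fun_eq_iff)
  have "field_section fib \<nu> (unc (cut t X))"
    unfolding eq by (intro field_section_scaleR L2w_section assms) measurable
  moreover have le: "fnorm (unc (cut t X)) \<le> fnorm (unc X)"
    unfolding eq by (intro fnorm_mono) (auto split: split_indicator)
  ultimately show "cut t X \<in> L2w"
    using assms by (auto simp: Lambda2w_iff L2_sections_def intro: le_less_trans)
  then show "W (cut t X) \<le> W X" using le assms by (simp add: W_eq)
qed

lemma W_triangle: "X \<in> L2w \<Longrightarrow> Y \<in> L2w \<Longrightarrow> Z \<in> L2w \<Longrightarrow> W (X - Z) \<le> W (X - Y) + W (Y - Z)"
  using fnorm_triangle_diff[of "unc X" "unc Y" "unc Z"]
  by (simp add: W_eq L2w_diff L2w_section) (simp add: unc_def[abs_def] fun_diff_def)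

lemma W_minus: "W (X - Y) = W (Y - X)"
  by (simp add: w_enorm_def fun_diff_def norm_minus_commute)

lemma R_sets: "A \<in> \<R> \<Longrightarrow> A \<in> sets borel"
  using generates_R sigma_sets.Basic[of A \<R> UNIV] by simp

text \<open>The squared norm of \<open>fib x \<phi>\<close> is
  \<open>hform (q r u) \<phi> \<phi>\<close>, bounded on \<open>[0,T]\<close> by
  \<open>q_bounded\<close>, and the rectangle has finite measure since \<open>A\<close> and
  \<open>{0<..T}\<close> do.\<close>

lemma simple_term_L2_section:
  assumes s: "0 \<le> s" "s < t" "t \<le> T" and G: "G \<in> sets (F s)" and A: "A \<in> \<R>"
  shows "(\<lambda>x. (indicator {s<..t} (fst (fst x)) * indicator G (snd (fst x)) * indicator A (snd x)) *\<^sub>R fib x \<phi>)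
    \<in> L2_sections"
proof -
  let ?R = "({s<..t} \<times> G) \<times> A"
  have R: "?R \<in> sets \<nu>"
    unfolding sets_\<nu> using sets_predictable_Ioc[of s t T G] s G T_pos R_sets[OF A] by simp
  have GP: "G \<in> sets P" using G s by (intro sets_F_imp_sets_P)
  have eq: "(\<lambda>x. (indicator {s<..t} (fst (fst x)) * indicator G (snd (fst x)) * indicator A (snd x)) *\<^sub>R fib x \<phi>) =
      (\<lambda>x. indicator ?R x *\<^sub>R fib x \<phi>)"
    by (auto simp: fun_eq_iff split: split_indicator)
  have sec: "field_section fib \<nu> (\<lambda>x. indicator ?R x *\<^sub>R fib x \<phi>)"
    using R by (intro field_section_scaleR field_section_generator) simp
  obtain C where C: "\<And>r u. r \<in> {0..T} \<Longrightarrow> \<bar>hform (q r u) \<phi> \<phi>\<bar> \<le> C" using q_bounded[OF T_pos] by blast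
  have "(ennreal (norm (indicator ?R x *\<^sub>R fib x \<phi>)))\<^sup>2 \<le> ennreal C * indicator ?R x" if "x \<in> space \<nu>" for x
  proof -
    have r: "fst (fst x) \<in> {0..T}" using that by (auto simp: space_\<nu>)
    have "(norm (fib x \<phi>))\<^sup>2 = hform (q (fst (fst x)) (snd x)) \<phi> \<phi>"
      using hform_eq_inner[OF completion, of "fst (fst x)" "snd x" \<phi> \<phi>] r
      by (simp add: fib_def power2_norm_eq_inner)
    then have "(norm (fib x \<phi>))\<^sup>2 \<le> C" using C[OF r, of "snd x"] by simp
    then show ?thesis by (auto simp: ennreal_power ennreal_leI split: split_indicator)
  qed
  then have "(\<integral>\<^sup>+x. (ennreal (norm (indicator ?R x *\<^sub>R fib x \<phi>)))\<^sup>2 \<partial>\<nu>) \<le> (\<integral>\<^sup>+x. ennreal C * indicator ?R x \<partial>\<nu>)"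
    by (intro nn_integral_mono)
  also have "\<dots> = ennreal C * (\<integral>\<^sup>+x. indicator ?R x \<partial>\<nu>)" using R by (intro nn_integral_cmult) simp
  also have "(\<integral>\<^sup>+x. indicator ?R x \<partial>\<nu>) = (\<integral>\<^sup>+\<omega>. (\<integral>\<^sup>+r\<in>{0<..T}. (\<integral>\<^sup>+u. indicator ?R ((r, \<omega>), u) \<partial>\<mu>) \<partial>\<Lambda>) \<partial>P)"
    by (rule nn_integral_\<nu>) (use R in simp)
  also have "\<dots> \<le> (\<integral>\<^sup>+\<omega>. (\<integral>\<^sup>+r\<in>{0<..T}. (\<integral>\<^sup>+u. indicator A u \<partial>\<mu>) \<partial>\<Lambda>) \<partial>P)"
    by (intro nn_integral_mono mult_right_mono) (auto split: split_indicator)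
  also have "\<dots> = emeasure \<mu> A * emeasure \<Lambda> {0<..T}"
    using R_sets[OF A] Ioc_\<Lambda> by (simp add: nn_integral_cmult_indicator emeasure_space_1 sets_mu)
  finally have "(\<integral>\<^sup>+x. (ennreal (norm (indicator ?R x *\<^sub>R fib x \<phi>)))\<^sup>2 \<partial>\<nu>) \<le> ennreal C * (emeasure \<mu> A * emeasure \<Lambda> {0<..T})"
    by (simp add: mult_left_mono)
  also have "\<dots> < \<infinity>"
  proof -
    interpret L: finite_measure "restrict_space \<Lambda> {0<..T}" by (rule finite_\<Lambda>)
    show ?thesis
      using finite_mu[OF A] L.emeasure_finite[of "{0<..T}"] Ioc_\<Lambda>
      by (simp add: ennreal_mult_less_top less_top emeasure_restrict_space)
  qed
  finally show ?thesis unfolding eq using sec by (simp add: L2_sections_def fnorm_def enorm2_def)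
qed

lemma L2_sections_sum: "(\<And>i. i \<in> J \<Longrightarrow> X i \<in> L2_sections) \<Longrightarrow> (\<lambda>x. \<Sum>i\<in>J. X i x) \<in> L2_sections"
  by (induction J rule: infinite_finite_induct) (auto intro: L2_sections_add L2_sections_zero)

lemma simple_integrand_L2w:
  assumes "simple_integral_pair F \<R> M \<iota> T S Y"
  shows "S \<in> L2w"
proof -
  obtain n m s t G A and \<phi> :: "nat \<Rightarrow> nat \<Rightarrow> 'f" where D: "simple_data F \<R> T n m s t G A"
    and S: "S = (\<lambda>r \<omega> u. \<Sum>i<n. \<Sum>j<m. (indicator {s j<..t j} r * indicator (G j) \<omega> * indicator (A i) u) *\<^sub>R \<iota> r u (\<phi> i j))"
    using assms unfolding simple_integral_pair_def by blast
  have "(\<lambda>x. \<Sum>i<n. \<Sum>j<m. (indicator {s j<..t j} (fst (fst x)) * indicator (G j) (snd (fst x)) * indicator (A i) (snd x))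
      *\<^sub>R fib x (\<phi> i j)) \<in> L2_sections"
    using D by (intro L2_sections_sum simple_term_L2_section) (auto simp: simple_data_def)
  then show ?thesis by (simp add: Lambda2w_iff unc_def[abs_def] S fib_def)
qed

text \<open>The candidate is a sum of stopped increments of \<open>M\<close>, a martingale by the
  elementary case, whose paths are cadlag almost surely and are then modified. Its value at
  \<open>t\<close> must also arise from a representation of \<open>cut t S\<close>, because it is
  through representations that \<open>I\<close> is known on simple integrands.\<close>

lemma simple_process:
  assumes "simple_integral_pair F \<R> M \<iota> T S Y"
  obtains Z where "Z \<in> M2_space P F T"
    and "\<And>t. t \<in> {0..T} \<Longrightarrow> \<exists>Y'. simple_integral_pair F \<R> M \<iota> T (cut t S) Y' \<and> (AE \<omega> in P. Z t \<omega> = Y' \<omega>)"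
proof -
  obtain n m s b G A and \<phi> :: "nat \<Rightarrow> nat \<Rightarrow> 'f" where D: "simple_data F \<R> T n m s b G A"
    and S: "S = (\<lambda>r \<omega> u. \<Sum>i<n. \<Sum>j<m. (indicator {s j<..b j} r * indicator (G j) \<omega> * indicator (A i) u) *\<^sub>R \<iota> r u (\<phi> i j))"
    using assms unfolding simple_integral_pair_def by blast
  note D' = conjunct1[OF D[unfolded simple_data_def]]
    conjunct1[OF conjunct2[OF D[unfolded simple_data_def]]] conjunct2[OF conjunct2[OF D[unfolded simple_data_def]]]
  have D1: "0 \<le> s j \<and> s j < b j \<and> b j \<le> T \<and> G j \<in> sets (F (s j))" if "j < m" for j
    using D'(1) that by blast
  have D2: "A i \<in> \<R>" if "i < n" for i using D'(2) that by blast
  note D3 = D'(3)[rule_format]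
  define V where "V = (\<lambda>t \<omega>. \<Sum>i<n. \<Sum>j<m. indicator (G j) \<omega> *
      (M (min (b j) t) (A i) (\<phi> i j) \<omega> - M (min (s j) t) (A i) (\<phi> i j) \<omega>))"
  have "zero_mean_L2_martingale_on P F {0..} V"
    unfolding V_def
  proof (rule zero_mean_L2_martingale_on_sum[OF zero_mean_L2_martingale_on_sum[OF _ order_refl] order_refl])
    fix i j assume "i \<in> {..<n}" "j \<in> {..<m}"
    then show "zero_mean_L2_martingale_on P F {0..} (\<lambda>t \<omega>. indicator (G j) \<omega> *
        (M (min (b j) t) (A i) (\<phi> i j) \<omega> - M (min (s j) t) (A i) (\<phi> i j) \<omega>))"
      using zero_mean_L2_martingale_on_stopped_increment[OF M_martingale, of "A i" "s j" "b j" "G j" "\<phi> i j"]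
        D1[of j] D2[of i] by blast
  qed
  then have V: "zero_mean_L2_martingale_on P F {0..T} V" by (rule zero_mean_L2_martingale_on_subset) auto
  have "AE \<omega> in P. \<forall>i\<in>{..<n}. \<forall>j\<in>{..<m}. cadlag_on {0..} (\<lambda>t. M t (A i) (\<phi> i j) \<omega>)"
    using M_cadlag D2 by (intro AE_finite_allI) auto
  then have "AE \<omega> in P. cadlag_on {0..T} (\<lambda>t. V t \<omega>)"
  proof eventually_elim
    fix \<omega> assume c: "\<forall>i\<in>{..<n}. \<forall>j\<in>{..<m}. cadlag_on {0..} (\<lambda>t. M t (A i) (\<phi> i j) \<omega>)"
    show "cadlag_on {0..T} (\<lambda>t. V t \<omega>)"
      unfolding V_def
    proof (rule cadlag_on_sum[OF cadlag_on_sum])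
      fix i j assume ij: "i \<in> {..<n}" "j \<in> {..<m}"
      then have cij: "cadlag_on {0..} (\<lambda>t. M t (A i) (\<phi> i j) \<omega>)" using c by blast
      have "0 \<le> s j" "0 \<le> b j" using D1[of j] ij by auto
      then show "cadlag_on {0..T} (\<lambda>t. indicator (G j) \<omega> *
          (M (min (b j) t) (A i) (\<phi> i j) \<omega> - M (min (s j) t) (A i) (\<phi> i j) \<omega>))"
        by (intro cadlag_on_cmult cadlag_on_diff cadlag_on_min[OF cij])
    qed
  qed
  with V obtain Z where Z: "Z \<in> M2_space P F T" "\<And>t. AE \<omega> in P. Z t \<omega> = V t \<omega>"
    by (rule M2_space_modification) blast
  have "simple_integral_pair F \<R> M \<iota> T (cut t S) (V t)" if t: "t \<in> {0..T}" for t
  proof -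
    text \<open>Terms with \<open>s j \<ge> t\<close> are not removed but made void, which preserves the indexing.\<close>
    define b' where "b' j = (if s j < t then min (b j) t else b j)" for j
    define G' where "G' j = (if s j < t then G j else {})" for j
    have "{s k<..b' k} = {s j<..b' j} \<and> G' k \<inter> G' j = {}"
      if jk: "j < m" "k < m" "k \<noteq> j" "{s k<..b' k} \<inter> {s j<..b' j} \<noteq> {}" for j k
    proof -
      have "{s k<..b k} \<inter> {s j<..b j} \<noteq> {}"
        using jk(4) by (auto simp: b'_def split: if_splits)
      from D3[OF jk(1-3) this] have *: "{s k<..b k} = {s j<..b j}" "G k \<inter> G j = {}" by auto
      \<comment> \<open>Both intervals are nonempty, so equal intervals have equal end points.
        Truncation at \<open>t\<close> then treats \<open>k\<close> and \<open>j\<close>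
        alike.\<close>
      then have "s k = s j" "b k = b j"
        using D1[OF jk(1)] D1[OF jk(2)] unfolding Ioc_inj by auto
      then show ?thesis using *(2) by (simp add: b'_def G'_def)
    qed
    moreover have "0 \<le> s j \<and> s j < b' j \<and> b' j \<le> T \<and> G' j \<in> sets (F (s j))" if "j < m" for j
      using D1[OF that] by (auto simp: b'_def G'_def)
    ultimately have "simple_data F \<R> T n m s b' G' A"
      unfolding simple_data_def using D2 by (intro conjI allI impI) blast+
    moreover have "cut t S = (\<lambda>r \<omega> u. \<Sum>i<n. \<Sum>j<m.
        (indicator {s j<..b' j} r * indicator (G' j) \<omega> * indicator (A i) u) *\<^sub>R \<iota> r u (\<phi> i j))"
    proof (intro ext)
      fix r \<omega> u
      have "cut t S r \<omega> u = (\<Sum>i<n. \<Sum>j<m. (indicator {0..t} r * (indicator {s j<..b j} r * indicator (G j) \<omega> * indicator (A i) u)) *\<^sub>R \<iota> r u (\<phi> i j))"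
        by (simp add: cut_def S scaleR_sum_right)
      also have "\<dots> = (\<Sum>i<n. \<Sum>j<m. (indicator {s j<..b' j} r * indicator (G' j) \<omega> * indicator (A i) u) *\<^sub>R \<iota> r u (\<phi> i j))"
      proof (intro sum.cong refl arg_cong2[where f="(*\<^sub>R)"])
        fix i j assume "j \<in> {..<m}"
        then have "0 \<le> s j" using D1[of j] by auto
        then show "indicator {0..t} r * (indicator {s j<..b j} r * indicator (G j) \<omega> * indicator (A i) u) =
            (indicator {s j<..b' j} r * indicator (G' j) \<omega> * indicator (A i) u :: real)"
          by (auto simp: b'_def G'_def split: split_indicator)
      qed
      finally show "cut t S r \<omega> u = (\<Sum>i<n. \<Sum>j<m. (indicator {s j<..b' j} r * indicator (G' j) \<omega> * indicator (A i) u) *\<^sub>R \<iota> r u (\<phi> i j))" .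
    qed
    moreover have "V t = (\<lambda>\<omega>. \<Sum>i<n. \<Sum>j<m. indicator (G' j) \<omega> * (M (b' j) (A i) (\<phi> i j) \<omega> - M (s j) (A i) (\<phi> i j) \<omega>))"
      unfolding V_def
    proof (intro ext sum.cong refl)
      fix \<omega> i j assume "j \<in> {..<m}"
      then have "s j < b j" using D1[of j] by auto
      then show "indicator (G j) \<omega> * (M (min (b j) t) (A i) (\<phi> i j) \<omega> - M (min (s j) t) (A i) (\<phi> i j) \<omega>) =
          indicator (G' j) \<omega> * (M (b' j) (A i) (\<phi> i j) \<omega> - M (s j) (A i) (\<phi> i j) \<omega>)"
        by (cases "s j < t") (auto simp: b'_def G'_def min_def)
    qed
    ultimately show ?thesis unfolding simple_integral_pair_def by blast
  qed
  with Z show thesis by (intro that) auto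
qed

end

section \<open>The weak integral and its cadlag version\<close>

locale weak_integral = weak_integrands P F \<R> M \<mu> \<Lambda> q \<iota> T d
  for P :: "'w measure" and F and \<R> :: "'u::topological_space set set"
    and M :: "real \<Rightarrow> 'u set \<Rightarrow> 'f::locally_convex_space \<Rightarrow> 'w \<Rightarrow> real"
    and \<mu> \<Lambda> q and \<iota> :: "real \<Rightarrow> 'u \<Rightarrow> 'f \<Rightarrow> 'h::{real_inner, banach, second_countable_topology}"
    and T d +
  fixes I :: "(real \<Rightarrow> 'w \<Rightarrow> 'u \<Rightarrow> 'h) \<Rightarrow> 'w \<Rightarrow> real"
  assumes weak_integral: "is_weak_integral P F \<R> M \<mu> \<Lambda> \<iota> T I"
begin

lemma simple_dense:
  assumes "X \<in> L2w" "0 < \<epsilon>"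
  obtains S Y where "simple_integral_pair F \<R> M \<iota> T S Y" "W (X - S) < \<epsilon>"
  using weak_integral assms unfolding is_weak_integral_def by blast

lemma I_simple: "simple_integral_pair F \<R> M \<iota> T S Y \<Longrightarrow> AE \<omega> in P. I S \<omega> = Y \<omega>"
  using weak_integral unfolding is_weak_integral_def by blast

lemma I_L2: "X \<in> L2w \<Longrightarrow> I X \<in> L2_space P" and I_norm: "X \<in> L2w \<Longrightarrow> L2_enorm P (I X) = W X"
  using weak_integral unfolding is_weak_integral_def by blast+

lemma I_lincomb: "X \<in> L2w \<Longrightarrow> Y \<in> L2w \<Longrightarrow> AE \<omega> in P. I (a *\<^sub>R X + b *\<^sub>R Y) \<omega> = a * I X \<omega> + b * I Y \<omega>"
  using weak_integral unfolding is_weak_integral_def by blast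

lemma L2_enorm_cong_AE: "AE \<omega> in P. f \<omega> = g \<omega> \<Longrightarrow> L2_enorm P f = L2_enorm P g"
  unfolding L2_enorm_eq by (intro enorm2_cong_AE) (auto elim: eventually_mono)

lemma I_diff_norm:
  assumes "X \<in> L2w" "Y \<in> L2w"
  shows "L2_enorm P (\<lambda>\<omega>. I X \<omega> - I Y \<omega>) = W (X - Y)"
proof -
  have "L2_enorm P (\<lambda>\<omega>. I X \<omega> - I Y \<omega>) = L2_enorm P (I (X - Y))"
    by (rule L2_enorm_cong_AE) (use I_lincomb[OF assms, of 1 "-1"] in \<open>auto elim: eventually_mono\<close>)
  then show ?thesis by (simp add: I_norm L2w_diff assms)
qed

lemma I_zero: "AE \<omega> in P. I 0 \<omega> = 0"
  using I_lincomb[OF L2w_zero L2w_zero, of 0 0] by simp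

text \<open>A choice operator defines \<open>weak_integral_process\<close>, so a witness has to be
  built. Cutting at \<open>t\<close> does not increase the norm; hence the integrals of simple
  approximants converge in L2 at every \<open>t\<close>, and \<open>M2_space_complete\<close> gives
  their martingales a cadlag limit.\<close>

lemma weak_integral_process_exists:
  assumes X: "X \<in> L2w"
  shows "\<exists>Z. Z \<in> M2_space P F T \<and> (\<forall>t\<in>{0..T}. AE \<omega> in P. Z t \<omega> = I (cut t X) \<omega>)"
proof -
  \<comment> \<open>The rate \<open>(1/4)^n\<close> is the one \<open>M2_space_complete\<close> asks
    for; the errors of two neighbouring approximants add up to at most
    \<open>2 * (1/4)^n\<close>.\<close>
  have "\<exists>S Y. simple_integral_pair F \<R> M \<iota> T S Y \<and> W (X - S) < ennreal ((1/4)^n)" for n :: nat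
  proof (rule simple_dense[OF X, of "ennreal ((1/4)^n)"])
    fix S Y assume "simple_integral_pair F \<R> M \<iota> T S Y" "W (X - S) < ennreal ((1/4)^n)"
    then show ?thesis by blast
  qed simp
  then obtain S Y where S: "\<And>n. simple_integral_pair F \<R> M \<iota> T (S n) (Y n)" "\<And>n. W (X - S n) < ennreal ((1/4)^n)"
    by metis
  have SL: "S n \<in> L2w" for n by (rule simple_integrand_L2w[OF S(1)])
  have "\<exists>Z. Z \<in> M2_space P F T \<and> (\<forall>t\<in>{0..T}. \<exists>Y'. simple_integral_pair F \<R> M \<iota> T (cut t (S n)) Y' \<and> (AE \<omega> in P. Z t \<omega> = Y' \<omega>))" for n
    by (rule simple_process[OF S(1)[of n]]) blast
  then obtain Z where Z: "\<And>n. Z n \<in> M2_space P F T"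
    and Z': "\<And>n t. t \<in> {0..T} \<Longrightarrow> \<exists>Y'. simple_integral_pair F \<R> M \<iota> T (cut t (S n)) Y' \<and> (AE \<omega> in P. Z n t \<omega> = Y' \<omega>)"
    by metis
  have ZI: "AE \<omega> in P. Z n t \<omega> = I (cut t (S n)) \<omega>" if t: "t \<in> {0..T}" for n t
  proof -
    obtain Y' where "simple_integral_pair F \<R> M \<iota> T (cut t (S n)) Y'" "AE \<omega> in P. Z n t \<omega> = Y' \<omega>"
      using Z'[OF t] by blast
    with I_simple[OF this(1)] show ?thesis by auto
  qed
  have fast: "L2_enorm P (\<lambda>\<omega>. Z (Suc n) T \<omega> - Z n T \<omega>) \<le> ennreal (2 * (1/4)^n)" for n
  proof -
    have T: "T \<in> {0..T}" using T_pos by simp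
    have "L2_enorm P (\<lambda>\<omega>. Z (Suc n) T \<omega> - Z n T \<omega>) = L2_enorm P (\<lambda>\<omega>. I (cut T (S (Suc n))) \<omega> - I (cut T (S n)) \<omega>)"
      using ZI[OF T, of "Suc n"] ZI[OF T, of n] by (intro L2_enorm_cong_AE) (auto elim: eventually_elim2)
    also have "\<dots> = W (cut T (S (Suc n) - S n))"
      by (simp add: I_diff_norm L2w_cut SL cut_diff)
    also have "\<dots> \<le> W (S (Suc n) - S n)" by (intro L2w_cut L2w_diff SL)
    also have "\<dots> \<le> W (S (Suc n) - X) + W (X - S n)" by (intro W_triangle SL X)
    also have "\<dots> \<le> ennreal ((1/4)^Suc n) + ennreal ((1/4)^n)"
      using S(2)[of "Suc n"] S(2)[of n] by (intro add_mono) (auto simp: W_minus[of _ X] less_imp_le)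
    also have "\<dots> \<le> ennreal (2 * (1/4)^n)"
      by (simp add: ennreal_plus[symmetric] del: ennreal_plus)
    finally show ?thesis .
  qed
  have lim: "(\<lambda>n. L2_enorm P (\<lambda>\<omega>. Z n t \<omega> - I (cut t X) \<omega>)) \<longlonglongrightarrow> 0" if t: "t \<in> {0..T}" for t
  proof (rule tendsto_sandwich[OF _ _ tendsto_const])
    have "(\<lambda>n. (1/4::real)^n) \<longlonglongrightarrow> 0" by (rule LIMSEQ_power_zero) simp
    then show "(\<lambda>n. ennreal ((1/4)^n)) \<longlonglongrightarrow> 0" using tendsto_ennrealI[of _ 0] by simp
    have "L2_enorm P (\<lambda>\<omega>. Z n t \<omega> - I (cut t X) \<omega>) \<le> ennreal ((1/4)^n)" for n
    proof -
      have "L2_enorm P (\<lambda>\<omega>. Z n t \<omega> - I (cut t X) \<omega>) = L2_enorm P (\<lambda>\<omega>. I (cut t (S n)) \<omega> - I (cut t X) \<omega>)"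
        using ZI[OF t, of n] by (intro L2_enorm_cong_AE) (auto elim: eventually_mono)
      also have "\<dots> = W (cut t (S n - X))"
        by (simp add: I_diff_norm L2w_cut SL X cut_diff)
      also have "\<dots> \<le> W (S n - X)" by (intro L2w_cut L2w_diff SL X)
      also have "\<dots> \<le> ennreal ((1/4)^n)" using S(2)[of n] by (simp add: W_minus[of _ X] less_imp_le)
      finally show ?thesis .
    qed
    then show "\<forall>\<^sub>F n in sequentially. L2_enorm P (\<lambda>\<omega>. Z n t \<omega> - I (cut t X) \<omega>) \<le> ennreal ((1/4)^n)" by simp
  qed simp
  show ?thesis
  proof (rule M2_space_complete[OF Z T_pos fast I_L2[OF L2w_cut(1)[OF X]] lim])
    fix Z' assume "Z' \<in> M2_space P F T" "\<And>t. t \<in> {0..T} \<Longrightarrow> AE \<omega> in P. Z' t \<omega> = I (cut t X) \<omega>"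
    then show ?thesis by blast
  qed
qed

abbreviation process :: "(real \<Rightarrow> 'w \<Rightarrow> 'u \<Rightarrow> 'h) \<Rightarrow> real \<Rightarrow> 'w \<Rightarrow> real" where
  "process \<equiv> weak_integral_process P F T I"

lemma process_M2: "X \<in> L2w \<Longrightarrow> process X \<in> M2_space P F T"
  and process_AE: "X \<in> L2w \<Longrightarrow> t \<in> {0..T} \<Longrightarrow> AE \<omega> in P. process X t \<omega> = I (cut t X) \<omega>"
  using someI_ex[OF weak_integral_process_exists[of X]]
  unfolding weak_integral_process_def cut_def by blast+

end

section \<open>Bochner integrals in seminormed spaces\<close>

lemma L2_enorm_triangle:
  assumes [measurable]: "f \<in> borel_measurable P" "g \<in> borel_measurable P" "h \<in> borel_measurable P"
  shows "L2_enorm P (f - h) \<le> L2_enorm P (f - g) + L2_enorm P (g - h)"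
proof -
  have "L2_enorm P (f - h) \<le> enorm2 P (\<lambda>\<omega>. ennreal \<bar>f \<omega> - g \<omega>\<bar> + ennreal \<bar>g \<omega> - h \<omega>\<bar>)"
    unfolding L2_enorm_eq by (intro enorm2_mono) (simp add: fun_diff_def ennreal_plus[symmetric] ennreal_leI del: ennreal_plus)
  also have "\<dots> \<le> L2_enorm P (f - g) + L2_enorm P (g - h)"
    unfolding L2_enorm_eq fun_diff_def by (intro enorm2_triangle) simp_all
  finally show ?thesis .
qed

lemma L2_enorm_minus: "L2_enorm P (f - g) = L2_enorm P (g - f)"
  by (simp add: L2_enorm_eq fun_diff_def abs_minus_commute)

lemma L2_enorm_scaleR:
  assumes [measurable]: "f \<in> borel_measurable P"
  shows "L2_enorm P (c *\<^sub>R f) = ennreal \<bar>c\<bar> * L2_enorm P f"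
proof -
  have "(\<integral>\<^sup>+\<omega>. (ennreal \<bar>c\<bar> * ennreal \<bar>f \<omega>\<bar>)\<^sup>2 \<partial>P) = (ennreal \<bar>c\<bar>)\<^sup>2 * (\<integral>\<^sup>+\<omega>. (ennreal \<bar>f \<omega>\<bar>)\<^sup>2 \<partial>P)"
    by (simp add: power_mult_distrib nn_integral_cmult)
  then show ?thesis by (simp add: L2_enorm_eq enorm2_def scaleR_fun_def abs_mult ennreal_mult ennsqrt_mult)
qed

lemma L2_enorm_zero: "L2_enorm P 0 = 0"
  by (simp add: L2_enorm_def zero_fun_def)

lemma L2_enorm_eq_0_imp_AE:
  assumes [measurable]: "f \<in> borel_measurable P" and "L2_enorm P f = 0"
  shows "AE \<omega> in P. f \<omega> = 0"
proof -
  have "(\<integral>\<^sup>+\<omega>. ennreal ((f \<omega>)\<^sup>2) \<partial>P) = 0" using assms(2) by (simp add: L2_enorm_def)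
  then have "AE \<omega> in P. ennreal ((f \<omega>)\<^sup>2) = 0" by (subst (asm) nn_integral_0_iff_AE) auto
  then show ?thesis by eventually_elim (simp add: ennreal_eq_0_iff)
qed

text \<open>Measurability is proved along with the bound because the triangle inequality in the
  induction step needs it for the partial sum.\<close>

lemma L2_enorm_sum_le:
  assumes "\<And>y. y \<in> A \<Longrightarrow> y \<in> borel_measurable P"
  shows "L2_enorm P (\<Sum>y\<in>A. c y *\<^sub>R y) \<le> (\<Sum>y\<in>A. ennreal \<bar>c y\<bar> * L2_enorm P y)
    \<and> (\<Sum>y\<in>A. c y *\<^sub>R y) \<in> borel_measurable P"
  using assms
proof (induction A rule: infinite_finite_induct)
  case (insert y A)
  let ?S = "\<Sum>y\<in>A. c y *\<^sub>R y"
  have [measurable]: "y \<in> borel_measurable P" "?S \<in> borel_measurable P" using insert by auto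
  have m: "c y *\<^sub>R y \<in> borel_measurable P" unfolding scaleR_fun_def by measurable
  have z: "(0::_ \<Rightarrow> real) \<in> borel_measurable P" by (simp add: zero_fun_def)
  have "c y *\<^sub>R y + ?S \<in> borel_measurable P" using m unfolding plus_fun_def by measurable
  moreover have "L2_enorm P (c y *\<^sub>R y - (- ?S)) \<le> L2_enorm P (c y *\<^sub>R y - 0) + L2_enorm P (0 - (- ?S))"
    by (rule L2_enorm_triangle[OF m z]) (simp add: fun_Compl_def)
  then have "L2_enorm P (c y *\<^sub>R y + ?S) \<le> ennreal \<bar>c y\<bar> * L2_enorm P y + L2_enorm P ?S"
    unfolding diff_minus_eq_add diff_0_right diff_0 minus_minus L2_enorm_scaleR[OF \<open>y \<in> borel_measurable P\<close>]
    by simp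
  from order_trans[OF this add_left_mono]
  have "L2_enorm P (c y *\<^sub>R y + ?S) \<le> ennreal \<bar>c y\<bar> * L2_enorm P y + (\<Sum>y\<in>A. ennreal \<bar>c y\<bar> * L2_enorm P y)"
    using insert by blast
  ultimately show ?case
    unfolding sum.insert[OF insert(1,2)] by (intro conjI)
qed (use L2_enorm_zero[of P] in \<open>simp_all add: zero_fun_def\<close>)

lemma L2_enorm_simple_integral_le:
  assumes S: "Bochner_Integration.simple_bochner_integrable R s" "s ` space R \<subseteq> L2_space P"
  shows "L2_enorm P (Bochner_Integration.simple_bochner_integral R s) \<le> (\<integral>\<^sup>+e. L2_enorm P (s e) \<partial>R)"
    and "Bochner_Integration.simple_bochner_integral R s \<in> borel_measurable P"
proof -
  let ?A = "\<lambda>y. {e \<in> space R. s e = y}"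
  have sf: "simple_function R s" and fin: "emeasure R {e \<in> space R. s e \<noteq> 0} \<noteq> \<infinity>"
    using S(1) by (auto elim: simple_bochner_integrable.cases)
  have A: "?A y \<in> sets R" for y
    using simple_functionD(2)[OF sf, of "{y}"] by (simp add: vimage_def Int_def conj_commute)
  have finite: "finite (s ` space R)" using sf by (rule simple_functionD)
  have eq: "Bochner_Integration.simple_bochner_integral R s = (\<Sum>y\<in>s ` space R. measure R (?A y) *\<^sub>R y)"
    by (rule simple_bochner_integral_def)
  have le: "L2_enorm P (\<Sum>y\<in>s ` space R. measure R (?A y) *\<^sub>R y) \<le> (\<Sum>y\<in>s ` space R. ennreal \<bar>measure R (?A y)\<bar> * L2_enorm P y)
    \<and> (\<Sum>y\<in>s ` space R. measure R (?A y) *\<^sub>R y) \<in> borel_measurable P"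
    using S(2) by (intro L2_enorm_sum_le) (auto simp: L2_space_def)
  then show "Bochner_Integration.simple_bochner_integral R s \<in> borel_measurable P" by (simp add: eq)
  have "(\<Sum>y\<in>s ` space R. ennreal \<bar>measure R (?A y)\<bar> * L2_enorm P y) = (\<Sum>y\<in>s ` space R. emeasure R (?A y) * L2_enorm P y)"
  proof (intro sum.cong refl)
    fix y
    \<comment> \<open>The level set of 0 may have infinite measure, where \<open>measure\<close> and
      \<open>emeasure\<close> disagree, but then the norm of \<open>y\<close> vanishes. Every other
      level set lies in the support, whose measure is finite.\<close>
    show "ennreal \<bar>measure R (?A y)\<bar> * L2_enorm P y = emeasure R (?A y) * L2_enorm P y"
    proof (cases "y = 0")
      case False
      then have "emeasure R (?A y) \<le> emeasure R {e \<in> space R. s e \<noteq> 0}"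
        using A[of 0] sets.compl_sets[OF A[of 0]]
        by (intro emeasure_mono) (auto simp: set_diff_eq conj_commute cong: conj_cong elim!: back_subst[where P="\<lambda>x. x \<in> sets R"])
      then have "emeasure R (?A y) \<noteq> \<infinity>" using fin by (auto simp: top_unique)
      then show ?thesis by (simp add: emeasure_eq_ennreal_measure)
    qed (simp add: L2_enorm_zero)
  qed
  also have "\<dots> = (\<integral>\<^sup>+e. (\<Sum>y\<in>s ` space R. L2_enorm P y * indicator (?A y) e) \<partial>R)"
    using A by (subst nn_integral_sum) (auto simp: nn_integral_cmult_indicator mult.commute)
  also have "\<dots> = (\<integral>\<^sup>+e. L2_enorm P (s e) \<partial>R)"
  proof (intro nn_integral_cong)
    fix e assume e: "e \<in> space R"
    have "(\<Sum>y\<in>s ` space R. L2_enorm P y * indicator (?A y) e) = (\<Sum>y\<in>s ` space R. if y = s e then L2_enorm P y else 0)"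
      using e by (intro sum.cong) auto
    then show "(\<Sum>y\<in>s ` space R. L2_enorm P y * indicator (?A y) e) = L2_enorm P (s e)" using finite e by simp
  qed
  finally show "L2_enorm P (Bochner_Integration.simple_bochner_integral R s) \<le> (\<integral>\<^sup>+e. L2_enorm P (s e) \<partial>R)"
    using le by (simp add: eq)
qed

text \<open>Two inequalities between sums express that \<open>a\<close> and \<open>b m\<close>
  differ by at most \<open>c m\<close>; differences in the extended half line are unreliable when
  both terms are infinite.\<close>

lemma tendsto_ennreal_sandwich_add:
  fixes a :: ennreal
  assumes c: "c \<longlonglongrightarrow> 0" and le: "\<And>m. a \<le> c m + b m" "\<And>m. b m \<le> c m + a"
  shows "b \<longlonglongrightarrow> a"
proof (rule order_tendstoI)
  fix l assume l: "l < a"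
  have "(\<lambda>m. c m + l) \<longlonglongrightarrow> 0 + l" by (intro tendsto_add c tendsto_const)
  then have "\<forall>\<^sub>F m in sequentially. c m + l < a" using l by (auto intro: order_tendstoD)
  then show "\<forall>\<^sub>F m in sequentially. l < b m"
  proof eventually_elim
    fix m assume m: "c m + l < a"
    show "l < b m"
    proof (rule ccontr)
      assume "\<not> l < b m"
      then have "c m + b m \<le> c m + l" by (intro add_left_mono) simp
      from order_trans[OF le(1)[of m] this] m have "a < a" by (rule le_less_trans)
      then show False by simp
    qed
  qed
next
  fix u assume u: "a < u"
  have "(\<lambda>m. c m + a) \<longlonglongrightarrow> 0 + a" by (intro tendsto_add c tendsto_const)
  then have "\<forall>\<^sub>F m in sequentially. c m + a < u" using u by (auto intro: order_tendstoD)
  then show "\<forall>\<^sub>F m in sequentially. b m < u"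
    by eventually_elim (rule le_less_trans[OF le(2)])
qed

text \<open>The integrands in the definition of the Bochner integral are almost everywhere limits of the
  simple functions \<open>N (s m e - s n e)\<close>; without their measurability the upper bound by a sum of two lower
  integrals would fail.\<close>

lemma AE_measurable_L2_enorm_diff:
  assumes f: "AE e in R. f e \<in> L2_space P"
    and s: "\<And>n. Bochner_Integration.simple_bochner_integrable R (s n) \<and> s n ` space R \<subseteq> L2_space P"
    and lim: "AE e in R. (\<lambda>n. L2_enorm P (f e - s n e)) \<longlonglongrightarrow> 0"
  obtains g where "g \<in> borel_measurable R" "AE e in R. L2_enorm P (f e - s n e) = g e"
proof
  let ?b = "\<lambda>m e. L2_enorm P (s m e - s n e)"
  have sf: "simple_function R (s m)" for m using s[of m] by (auto elim: simple_bochner_integrable.cases)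
  have [measurable]: "?b m \<in> borel_measurable R" for m
    by (intro borel_measurable_simple_function simple_function_compose2[OF sf sf])
  show "(\<lambda>e. liminf (\<lambda>m. ?b m e)) \<in> borel_measurable R" by measurable
  show "AE e in R. L2_enorm P (f e - s n e) = liminf (\<lambda>m. ?b m e)"
    using f lim AE_space
  proof eventually_elim
    fix e assume e: "f e \<in> L2_space P" "(\<lambda>n. L2_enorm P (f e - s n e)) \<longlonglongrightarrow> 0" "e \<in> space R"
    have [measurable]: "f e \<in> borel_measurable P" using e by (simp add: L2_space_def)
    have [measurable]: "s m e \<in> borel_measurable P" for m using s[of m] e(3) by (auto simp: L2_space_def)
    have "(\<lambda>m. ?b m e) \<longlonglongrightarrow> L2_enorm P (f e - s n e)"
    proof (rule tendsto_ennreal_sandwich_add[OF e(2)])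
      show "L2_enorm P (f e - s n e) \<le> L2_enorm P (f e - s m e) + ?b m e" for m
        by (rule L2_enorm_triangle) simp_all
      show "?b m e \<le> L2_enorm P (f e - s m e) + L2_enorm P (f e - s n e)" for m
        using L2_enorm_triangle[of "s m e" P "f e" "s n e"] by (simp add: L2_enorm_minus[of P "s m e"])
    qed
    from lim_imp_Liminf[OF sequentially_bot this]
    show "L2_enorm P (f e - s n e) = liminf (\<lambda>m. ?b m e)" by simp
  qed
qed

text \<open>The simple integral does not increase the norm, so the integrals of two approximating
  sequences differ by at most the sum of both approximation errors. In the limit the seminorm of
  \<open>y - y'\<close> vanishes, which for representatives means equality almost surely.\<close>

lemma has_bochner_integral_L2_unique:
  assumes y: "has_bochner_integral_in (L2_space P) (L2_enorm P) R f y"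
    and y': "has_bochner_integral_in (L2_space P) (L2_enorm P) R f y'"
  shows "AE \<omega> in P. y \<omega> = y' \<omega>"
proof -
  obtain s where f: "AE e in R. f e \<in> L2_space P" and yL: "y \<in> L2_space P"
    and s: "\<And>n. Bochner_Integration.simple_bochner_integrable R (s n) \<and> s n ` space R \<subseteq> L2_space P"
    and s1: "AE e in R. (\<lambda>n. L2_enorm P (f e - s n e)) \<longlonglongrightarrow> 0"
    and s2: "(\<lambda>n. \<integral>\<^sup>+e. L2_enorm P (f e - s n e) \<partial>R) \<longlonglongrightarrow> 0"
    and s3: "(\<lambda>n. L2_enorm P (Bochner_Integration.simple_bochner_integral R (s n) - y)) \<longlonglongrightarrow> 0"
    using y unfolding has_bochner_integral_in_def by blast
  obtain s' where y'L: "y' \<in> L2_space P"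
    and s': "\<And>n. Bochner_Integration.simple_bochner_integrable R (s' n) \<and> s' n ` space R \<subseteq> L2_space P"
    and s'1: "AE e in R. (\<lambda>n. L2_enorm P (f e - s' n e)) \<longlonglongrightarrow> 0"
    and s'2: "(\<lambda>n. \<integral>\<^sup>+e. L2_enorm P (f e - s' n e) \<partial>R) \<longlonglongrightarrow> 0"
    and s'3: "(\<lambda>n. L2_enorm P (Bochner_Integration.simple_bochner_integral R (s' n) - y')) \<longlonglongrightarrow> 0"
    using y' unfolding has_bochner_integral_in_def by blast
  have [measurable]: "y \<in> borel_measurable P" "y' \<in> borel_measurable P" using yL y'L by (auto simp: L2_space_def)
  let ?S = "\<lambda>n. Bochner_Integration.simple_bochner_integral R (s n)"
  let ?S' = "\<lambda>n. Bochner_Integration.simple_bochner_integral R (s' n)"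
  have [measurable]: "?S n \<in> borel_measurable P" "?S' n \<in> borel_measurable P" for n
    using L2_enorm_simple_integral_le(2) s s' by blast+
  have L2_diff: "a - b \<in> L2_space P" if "a \<in> L2_space P" "b \<in> L2_space P" for a b
    using that square_integrable_add[of a P "\<lambda>\<omega>. - b \<omega>"] by (auto simp: L2_space_def fun_diff_def)
  have mid: "L2_enorm P (?S n - ?S' n) \<le>
      (\<integral>\<^sup>+e. L2_enorm P (f e - s n e) \<partial>R) + (\<integral>\<^sup>+e. L2_enorm P (f e - s' n e) \<partial>R)" for n
  proof -
    obtain g where g [measurable]: "g \<in> borel_measurable R" and gAE: "AE e in R. L2_enorm P (f e - s n e) = g e"
      using AE_measurable_L2_enorm_diff[OF f s s1] by blast
    obtain g' where g' [measurable]: "g' \<in> borel_measurable R" and g'AE: "AE e in R. L2_enorm P (f e - s' n e) = g' e"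
      using AE_measurable_L2_enorm_diff[OF f s' s'1] by blast
    have d: "Bochner_Integration.simple_bochner_integrable R (\<lambda>e. s n e - s' n e)"
      by (rule simple_bochner_integrable_compose2[where p="(-)"]) (use s s' in auto)
    have "?S n - ?S' n = Bochner_Integration.simple_bochner_integral R (\<lambda>e. s n e - s' n e)"
      using s s' by (simp add: simple_bochner_integral_diff)
    then have "L2_enorm P (?S n - ?S' n) \<le> (\<integral>\<^sup>+e. L2_enorm P (s n e - s' n e) \<partial>R)"
      using L2_enorm_simple_integral_le(1)[OF d, of P] s s' L2_diff by (simp add: image_subset_iff)
    also have "\<dots> \<le> (\<integral>\<^sup>+e. g e + g' e \<partial>R)"
    proof (rule nn_integral_mono_AE)
      show "AE e in R. L2_enorm P (s n e - s' n e) \<le> g e + g' e"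
        using gAE g'AE f AE_space
      proof eventually_elim
        fix e assume *: "L2_enorm P (f e - s n e) = g e" "L2_enorm P (f e - s' n e) = g' e"
          "f e \<in> L2_space P" "e \<in> space R"
        have "f e \<in> borel_measurable P" "s n e \<in> borel_measurable P" "s' n e \<in> borel_measurable P"
          using * s[of n] s'[of n] by (auto simp: L2_space_def)
        from L2_enorm_triangle[OF this(2,1,3)] *
        show "L2_enorm P (s n e - s' n e) \<le> g e + g' e" by (simp add: L2_enorm_minus[of P "s n e"])
      qed
    qed
    also have "\<dots> = (\<integral>\<^sup>+e. g e \<partial>R) + (\<integral>\<^sup>+e. g' e \<partial>R)" by (rule nn_integral_add) simp_all
    also have "(\<integral>\<^sup>+e. g e \<partial>R) = (\<integral>\<^sup>+e. L2_enorm P (f e - s n e) \<partial>R)"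
      using gAE by (intro nn_integral_cong_AE) auto
    also have "(\<integral>\<^sup>+e. g' e \<partial>R) = (\<integral>\<^sup>+e. L2_enorm P (f e - s' n e) \<partial>R)"
      using g'AE by (intro nn_integral_cong_AE) auto
    finally show ?thesis .
  qed
  have "L2_enorm P (y - y') \<le> L2_enorm P (?S n - y) +
      ((\<integral>\<^sup>+e. L2_enorm P (f e - s n e) \<partial>R) + (\<integral>\<^sup>+e. L2_enorm P (f e - s' n e) \<partial>R)) + L2_enorm P (?S' n - y')" for n
  proof -
    have 1: "L2_enorm P (y - y') \<le> L2_enorm P (y - ?S n) + L2_enorm P (?S n - y')"
      by (rule L2_enorm_triangle) simp_all
    have 2: "L2_enorm P (?S n - y') \<le> L2_enorm P (?S n - ?S' n) + L2_enorm P (?S' n - y')"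
      by (rule L2_enorm_triangle) simp_all
    show ?thesis
      unfolding L2_enorm_minus[of P "?S n" y] add.assoc[of "L2_enorm P (y - ?S n)"]
      by (rule order_trans[OF 1 add_left_mono[OF order_trans[OF 2 add_right_mono[OF mid]]]])
  qed
  moreover have "(\<lambda>n. L2_enorm P (?S n - y) +
      ((\<integral>\<^sup>+e. L2_enorm P (f e - s n e) \<partial>R) + (\<integral>\<^sup>+e. L2_enorm P (f e - s' n e) \<partial>R)) + L2_enorm P (?S' n - y')) \<longlonglongrightarrow> 0 + (0 + 0) + 0"
    by (intro tendsto_add s2 s'2 s3 s'3)
  ultimately have "L2_enorm P (y - y') \<le> 0"
    by (intro tendsto_lowerbound[of _ "0::ennreal" sequentially]) (auto intro: always_eventually)
  then have "AE \<omega> in P. (y - y') \<omega> = 0"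
    by (intro L2_enorm_eq_0_imp_AE) (auto simp: fun_diff_def)
  then show ?thesis by eventually_elim (simp add: fun_diff_def)
qed

text \<open>Evaluation at \<open>t\<close> is linear on representatives themselves, so it commutes
  exactly with simple integrals, and it does not increase the norm. The approximating sequence for
  \<open>f\<close> can therefore be evaluated term by term.\<close>

lemma (in stochastic_basis) has_bochner_integral_M2_eval:
  assumes J: "has_bochner_integral_in (M2_space P F T) (M2_enorm P T) R f J" and t: "t \<in> {0..T}"
  shows "has_bochner_integral_in (L2_space P) (L2_enorm P) R (\<lambda>e. f e t) (J t)"
proof -
  have V: "Y t \<in> L2_space P" if "Y \<in> M2_space P F T" for Y
  proof -
    have "zero_mean_L2_martingale_on P F {0..T} Y" using that by (simp add: M2_space_def)
    moreover have "{0..T} \<subseteq> {0..}" by auto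
    ultimately show ?thesis using zero_mean_L2_martingale_onD(2,3) t unfolding L2_space_def by blast
  qed
  obtain s where f: "AE e in R. f e \<in> M2_space P F T" and JV: "J \<in> M2_space P F T"
    and s: "\<And>n. Bochner_Integration.simple_bochner_integrable R (s n) \<and> s n ` space R \<subseteq> M2_space P F T"
    and s1: "AE e in R. (\<lambda>n. M2_enorm P T (f e - s n e)) \<longlonglongrightarrow> 0"
    and s2: "(\<lambda>n. \<integral>\<^sup>+e. M2_enorm P T (f e - s n e) \<partial>R) \<longlonglongrightarrow> 0"
    and s3: "(\<lambda>n. M2_enorm P T (Bochner_Integration.simple_bochner_integral R (s n) - J)) \<longlonglongrightarrow> 0"
    using J unfolding has_bochner_integral_in_def by blast
  have le: "L2_enorm P (Y t - Z t) \<le> M2_enorm P T (Y - Z)" for Y Z :: "real \<Rightarrow> 'w \<Rightarrow> real"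
    using L2_enorm_le_M2_enorm[OF t, of "Y - Z"] by (simp add: fun_diff_def)
  have lin: "linear (\<lambda>Y::real \<Rightarrow> 'w \<Rightarrow> real. Y t)" by (simp add: linear_iff scaleR_fun_def)
  have int: "Bochner_Integration.simple_bochner_integral R (\<lambda>e. s n e t) = Bochner_Integration.simple_bochner_integral R (s n) t" for n
    by (rule simple_bochner_integral_linear[OF lin conjunct1[OF s]])
  show ?thesis
    unfolding has_bochner_integral_in_def
  proof (intro conjI exI[of _ "\<lambda>n e. s n e t"] allI)
    show "AE e in R. f e t \<in> L2_space P" using f by eventually_elim (rule V)
    show "J t \<in> L2_space P" by (rule V[OF JV])
    show "Bochner_Integration.simple_bochner_integrable R (\<lambda>e. s n e t)" for n
      using simple_bochner_integrable_compose2[of "\<lambda>f g. f t" R "s n" "s n"] s[of n] by simp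
    show "(\<lambda>e. s n e t) ` space R \<subseteq> L2_space P" for n using s[of n] V by blast
    show "AE e in R. (\<lambda>n. L2_enorm P (f e t - s n e t)) \<longlonglongrightarrow> 0"
      using s1
    proof eventually_elim
      fix e assume "(\<lambda>n. M2_enorm P T (f e - s n e)) \<longlonglongrightarrow> 0"
      then show "(\<lambda>n. L2_enorm P (f e t - s n e t)) \<longlonglongrightarrow> 0"
        by (rule tendsto_sandwich[OF _ _ tendsto_const, rotated 2]) (simp_all add: le)
    qed
    show "(\<lambda>n. \<integral>\<^sup>+e. L2_enorm P (f e t - s n e t) \<partial>R) \<longlonglongrightarrow> 0"
      by (rule tendsto_sandwich[OF _ _ tendsto_const s2]) (simp_all add: le nn_integral_mono)
    show "(\<lambda>n. L2_enorm P (Bochner_Integration.simple_bochner_integral R (\<lambda>e. s n e t) - J t)) \<longlonglongrightarrow> 0"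
      unfolding int by (rule tendsto_sandwich[OF _ _ tendsto_const s3]) (simp_all add: le)
  qed
qed

section \<open>The stochastic Fubini theorem\<close>

locale stochastic_fubini = weak_integral P F \<R> M \<mu> \<Lambda> q \<iota> T d I + \<rho>: sigma_finite_measure \<rho>
  for P :: "'w measure" and F and \<R> :: "'u::topological_space set set"
    and M :: "real \<Rightarrow> 'u set \<Rightarrow> 'f::locally_convex_space \<Rightarrow> 'w \<Rightarrow> real"
    and \<mu> \<Lambda> q and \<iota> :: "real \<Rightarrow> 'u \<Rightarrow> 'f \<Rightarrow> 'h::{real_inner, banach, second_countable_topology}"
    and T d I and \<rho> :: "'e measure" +
  fixes X :: "real \<Rightarrow> 'w \<Rightarrow> 'u \<Rightarrow> 'e \<Rightarrow> 'h"
  assumes X: "X \<in> Xi12w P F \<mu> \<Lambda> \<iota> \<rho> T"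

sublocale stochastic_fubini \<subseteq> hilbert_field_pair \<nu> fib d \<rho>
  by (intro hilbert_field_pair.intro hilbert_field_axioms sigma_finite_\<nu> \<rho>.sigma_finite_measure_axioms)

context stochastic_fubini
begin

abbreviation Xe :: "'e \<Rightarrow> real \<Rightarrow> 'w \<Rightarrow> 'u \<Rightarrow> 'h" where "Xe e \<equiv> \<lambda>r \<omega> u. X r \<omega> u e"

definition XX :: "((real \<times> 'w) \<times> 'u) \<times> 'e \<Rightarrow> 'h" where "XX z = unc (Xe (snd z)) (fst z)"

lemma XX_section: "pair_section XX"
  unfolding field_section_def
proof (intro conjI ballI allI)
  fix z assume z: "z \<in> space (\<nu> \<Otimes>\<^sub>M \<rho>)"
  then show "XX z \<in> closure (range (fib (fst z)))"
    using X by (auto simp: Xi12w_def space_pair_measure space_\<nu> XX_def unc_def fib_def completion_space_def)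
next
  fix \<phi>
  \<comment> \<open>In \<open>Xi12w\<close> the factor \<open>\<rho>\<close> is bracketed with
    \<open>borel\<close>, whereas here the parameter is split off last.\<close>
  have "(\<lambda>z. (fst (fst z), snd (fst z), snd z)) \<in> (prd \<Otimes>\<^sub>M borel) \<Otimes>\<^sub>M \<rho> \<rightarrow>\<^sub>M prd \<Otimes>\<^sub>M (borel \<Otimes>\<^sub>M \<rho>)"
    by measurable
  moreover have "(\<lambda>((r, \<omega>), u, e). inner (X r \<omega> u e) (\<iota> r u \<phi>)) \<in> borel_measurable (prd \<Otimes>\<^sub>M (borel \<Otimes>\<^sub>M \<rho>))"
    using X by (simp add: Xi12w_def)
  ultimately have "(\<lambda>z. inner (XX z) (fib (fst z) \<phi>)) \<in> borel_measurable ((prd \<Otimes>\<^sub>M borel) \<Otimes>\<^sub>M \<rho>)"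
    by (rule measurable_compose[THEN back_subst[where P="\<lambda>f. f \<in> _"]])
      (auto simp: XX_def unc_def fib_def split_beta)
  moreover have "sets (\<nu> \<Otimes>\<^sub>M \<rho>) = sets ((prd \<Otimes>\<^sub>M borel) \<Otimes>\<^sub>M \<rho>)"
    by (intro sets_pair_measure_cong sets_\<nu> refl)
  ultimately show "(\<lambda>z. inner (XX z) (fib (fst z) \<phi>)) \<in> borel_measurable (\<nu> \<Otimes>\<^sub>M \<rho>)"
    using measurable_cong_sets by blast
qed

lemma XX_unc: "(\<lambda>x. XX (x, e)) = unc (Xe e)"
  by (simp add: XX_def fun_eq_iff)

lemma XX_norm: "pair_norm XX < \<infinity>"
proof -
  have "pair_norm XX = (\<integral>\<^sup>+e. W (Xe e) \<partial>\<rho>)"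
    unfolding pair_norm_def using section_fst[OF XX_section]
    by (intro nn_integral_cong) (simp add: XX_unc w_enorm_eq)
  then show ?thesis using X by (simp add: Xi12w_def)
qed

text \<open>Finiteness of the integrated norm controls almost every \<open>e\<close> only. For the
  others \<open>process (Xe e)\<close> need not be a martingale, which the Bochner integral
  tolerates by asking for membership almost everywhere.\<close>

lemma AE_L2w: "AE e in \<rho>. Xe e \<in> L2w"
proof -
  have "AE e in \<rho>. fnorm (\<lambda>x. XX (x, e)) \<noteq> \<infinity>"
    using measurable_fnorm_section[OF XX_section] XX_norm
    by (intro nn_integral_PInf_AE) (auto simp: pair_norm_def)
  then show ?thesis
    using AE_space
    by eventually_elim
      (use section_fst[OF XX_section] in \<open>simp add: Lambda2w_iff L2_sections_def XX_unc less_top\<close>)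
qed

definition XI :: "real \<Rightarrow> 'w \<Rightarrow> 'u \<Rightarrow> 'h" where "XI = (\<lambda>r \<omega> u. \<integral>e. X r \<omega> u e \<partial>\<rho>)"

lemma unc_XI: "unc XI = (\<lambda>x. \<integral>e. XX (x, e) \<partial>\<rho>)"
  by (simp add: XI_def XX_def unc_def fun_eq_iff)

lemma XI_L2w: "XI \<in> L2w"
  using integral_mem_L2_sections[OF XX_section XX_norm] by (simp add: Lambda2w_iff unc_XI)

text \<open>The section lemma speaks of \<open>\<nu>\<close>. Null sets of an image measure pull
  back, here along the identity to the plain product.\<close>

lemma AE_integrable:
  "AE ((r, \<omega>), u) in (restrict_space \<Lambda> {0<..T} \<Otimes>\<^sub>M P) \<Otimes>\<^sub>M \<mu>. integrable \<rho> (\<lambda>e. X r \<omega> u e)"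
proof -
  have "AE x in base. integrable \<rho> (\<lambda>e. XX (x, e))"
    using AE_distrD[OF measurable_base AE_integrable_section[OF XX_section XX_norm, unfolded \<nu>_def]] .
  then show ?thesis unfolding base_def by eventually_elim (simp add: XX_def unc_def split_beta)
qed

text \<open>Vanishing at \<open>0\<close> keeps the support of a simple function finite.\<close>

definition J :: "((real \<times> 'w) \<times> 'u \<Rightarrow> 'h) \<Rightarrow> real \<Rightarrow> 'w \<Rightarrow> real" where
  "J Y = (if Y = 0 then 0 else process (cur Y))"

lemma cur_zero: "cur 0 = 0"
  by (simp add: cur_def fun_eq_iff zero_fun_def)

lemma J_M2: "Y \<in> L2_sections \<Longrightarrow> J Y \<in> M2_space P F T"
  using M2_space_zero process_M2[of "cur Y"] by (auto simp: J_def zero_fun_def Lambda2w_iff)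

lemma J_AE: "Y \<in> L2_sections \<Longrightarrow> t \<in> {0..T} \<Longrightarrow> AE \<omega> in P. J Y t \<omega> = I (cut t (cur Y)) \<omega>"
proof (cases "Y = 0")
  case True
  have e: "cut t (cur Y) = 0" by (simp only: True cur_zero cut_zero)
  have z: "J Y t \<omega> = 0" for \<omega> unfolding J_def True by (simp add: zero_fun_def)
  show ?thesis using I_zero unfolding e z by (auto elim: eventually_mono)
next
  case False
  assume "Y \<in> L2_sections" "t \<in> {0..T}"
  then show ?thesis using process_AE[of "cur Y" t] unfolding J_def if_not_P[OF False] by (simp only: Lambda2w_iff unc_cur)
qed

text \<open>Versions are chosen separately for each integrand, so \<open>J\<close> need not be
  linear. A finite combination of chosen versions is nevertheless, at each time almost surely, the
  integral of the combined integrand.\<close>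

lemma J_sum:
  assumes "finite A" "A \<subseteq> L2_sections"
  shows "(\<Sum>Y\<in>A. c Y *\<^sub>R Y) \<in> L2_sections \<and> (\<Sum>Y\<in>A. c Y *\<^sub>R J Y) \<in> M2_space P F T \<and>
    (\<forall>t\<in>{0..T}. AE \<omega> in P. (\<Sum>Y\<in>A. c Y *\<^sub>R J Y) t \<omega> = I (cut t (cur (\<Sum>Y\<in>A. c Y *\<^sub>R Y))) \<omega>)"
  using assms
proof (induction A)
  case empty
  then show ?case
    using L2_sections_zero M2_space_zero I_zero by (auto simp: zero_fun_def cur_zero[unfolded zero_fun_def] cut_zero[unfolded zero_fun_def])
next
  case (insert Y A)
  let ?S = "\<Sum>Y\<in>A. c Y *\<^sub>R Y" and ?J = "\<Sum>Y\<in>A. c Y *\<^sub>R J Y"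
  have Y: "Y \<in> L2_sections" and S: "?S \<in> L2_sections" and JM: "?J \<in> M2_space P F T"
    and AE: "\<And>t. t \<in> {0..T} \<Longrightarrow> AE \<omega> in P. ?J t \<omega> = I (cut t (cur ?S)) \<omega>"
    using insert by auto
  have sum: "(\<Sum>Y\<in>insert Y A. c Y *\<^sub>R Y) = c Y *\<^sub>R Y + ?S" "(\<Sum>Y\<in>insert Y A. c Y *\<^sub>R J Y) = c Y *\<^sub>R J Y + ?J"
    using insert by auto
  have lin: "cur (c Y *\<^sub>R Y + ?S) = c Y *\<^sub>R cur Y + 1 *\<^sub>R cur ?S"
    by (simp add: cur_def fun_eq_iff plus_fun_def scaleR_fun_def)
  have "c Y *\<^sub>R Y + ?S \<in> L2_sections"
    using L2_sections_add[OF L2_sections_scaleR[OF Y, of "c Y"] S] by (simp add: plus_fun_def scaleR_fun_def)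
  moreover have "c Y *\<^sub>R J Y + ?J \<in> M2_space P F T"
    using M2_space_lincomb[OF J_M2[OF Y] JM, of "c Y" 1] by (simp add: plus_fun_def scaleR_fun_def)
  moreover have "AE \<omega> in P. (c Y *\<^sub>R J Y + ?J) t \<omega> = I (cut t (cur (c Y *\<^sub>R Y + ?S))) \<omega>" if t: "t \<in> {0..T}" for t
  proof -
    have L: "cut t (cur Y) \<in> L2w" "cut t (cur ?S) \<in> L2w"
      by (intro L2w_cut, simp add: Lambda2w_iff Y)
        (intro L2w_cut, simp only: Lambda2w_iff unc_cur S)
    from I_lincomb[OF this, of "c Y" 1] J_AE[OF Y t] AE[OF t]
    show ?thesis
      unfolding lin cut_lincomb by eventually_elim (simp add: plus_fun_def scaleR_fun_def)
  qed
  ultimately show ?case unfolding sum by blast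
qed

text \<open>The maximal inequality reduces the distance to terminal values, where the isometry of
  \<open>I\<close> applies. Any cadlag martingales with the right terminal values may thus be
  compared, however their versions were chosen.\<close>

lemma M2_enorm_diff_le:
  assumes Y: "Y \<in> M2_space P F T" "AE \<omega> in P. Y T \<omega> = I (cut T A) \<omega>" and A: "A \<in> L2w"
    and Z: "Z \<in> M2_space P F T" "AE \<omega> in P. Z T \<omega> = I (cut T B) \<omega>" and B: "B \<in> L2w"
  shows "M2_enorm P T (Y - Z) \<le> 2 * W (A - B)"
proof -
  have D: "Y - Z \<in> M2_space P F T" using M2_space_diff[OF Y(1) Z(1)] by (simp add: fun_diff_def)
  have "L2_enorm P ((Y - Z) T) = L2_enorm P (\<lambda>\<omega>. I (cut T A) \<omega> - I (cut T B) \<omega>)"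
    using Y(2) Z(2) by (intro L2_enorm_cong_AE) (auto simp: fun_diff_def elim: eventually_elim2)
  also have "\<dots> = W (cut T (A - B))" by (simp add: I_diff_norm L2w_cut A B cut_diff)
  also have "\<dots> \<le> W (A - B)" by (intro L2w_cut L2w_diff A B)
  finally have le: "L2_enorm P ((Y - Z) T) \<le> W (A - B)" .
  show ?thesis by (rule order_trans[OF M2_enorm_le[OF D T_pos] mult_left_mono[OF le]]) simp
qed

lemma process_has_bochner_integral:
  "has_bochner_integral_in (M2_space P F T) (M2_enorm P T) \<rho> (\<lambda>e. process (Xe e)) (process XI)"
proof -
  have T: "T \<in> {0..T}" using T_pos by simp
  \<comment> \<open>Errors below \<open>(1/2)^n\<close> are summable, so convergence in mean brings
    along the convergence almost everywhere that the definition of the Bochner integral demands in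
    addition, without passing to a subsequence.\<close>
  have "\<forall>n::nat. \<exists>S. simple_sections S \<and> pair_norm (\<lambda>z. XX z - S (snd z) (fst z)) < ennreal ((1/2)^n)"
    using approximable_if_integrable[OF XX_section XX_norm] unfolding approximable_def by simp
  from choice[OF this] obtain S where
    S': "\<forall>n. simple_sections (S n) \<and> pair_norm (\<lambda>z. XX z - S n (snd z) (fst z)) < ennreal ((1/2)^n)" ..
  have S: "simple_sections (S n)" and Sn: "pair_norm (\<lambda>z. XX z - S n (snd z) (fst z)) < ennreal ((1/2)^n)" for n
    using spec[OF S', of n] by (rule conjunct1, rule conjunct2)
  define a where "a n e = fnorm (\<lambda>x. XX (x, e) - S n e x)" for n e
  have dm: "pair_section (\<lambda>z. XX z - S n (snd z) (fst z))" for n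
    by (intro prod.field_section_diff XX_section simple_sections_pair_section S)
  have [measurable]: "a n \<in> borel_measurable \<rho>" for n
    using measurable_fnorm_section[OF dm[of n]] by (simp add: a_def[abs_def])
  have an: "(\<integral>\<^sup>+e. a n e \<partial>\<rho>) \<le> ennreal ((1/2)^n)" for n
    using Sn[of n] by (simp add: pair_norm_def a_def)
  have half: "(\<lambda>n. ennreal ((1/2)^n)) \<longlonglongrightarrow> 0"
    using tendsto_ennrealI[OF LIMSEQ_power_zero[of "1/2::real"]] by simp
  have a_lim: "AE e in \<rho>. (\<lambda>n. a n e) \<longlonglongrightarrow> 0"
  proof -
    have "(\<integral>\<^sup>+e. (\<Sum>n. a n e) \<partial>\<rho>) = (\<Sum>n. \<integral>\<^sup>+e. a n e \<partial>\<rho>)" by (rule nn_integral_suminf) simp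
    also have "\<dots> \<le> (\<Sum>n. ennreal ((1/2)^n))" by (intro suminf_le summableI an)
    also have "\<dots> < \<infinity>"
    proof -
      have "summable (\<lambda>n. (1/2::real)^n)" by (rule summable_geometric) simp
      then show ?thesis by (simp add: suminf_ennreal2 less_top[symmetric])
    qed
    finally have "AE e in \<rho>. (\<Sum>n. a n e) \<noteq> \<infinity>" by (intro nn_integral_PInf_AE) auto
    then show ?thesis
    proof eventually_elim
      fix e assume fin: "(\<Sum>n. a n e) \<noteq> \<infinity>"
      have le: "a n e \<le> (\<Sum>n. a n e)" for n using sum_le_suminf[of "\<lambda>n. a n e" "{n}"] by simp
      have ne: "a n e < \<top>" for n using le[of n] fin by (auto simp: less_top[symmetric] top_unique)
      then have eq: "ennreal (enn2real (a n e)) = a n e" for n by (simp add: ennreal_enn2real)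
      have "summable (\<lambda>n. enn2real (a n e))" by (rule summable_suminf_not_top) (use fin in \<open>auto simp: eq\<close>)
      from tendsto_ennrealI[OF summable_LIMSEQ_zero[OF this]] show "(\<lambda>n. a n e) \<longlonglongrightarrow> 0" by (simp add: eq)
    qed
  qed
  define s where "s n e = J (S n e)" for n e
  have SL: "S n e \<in> L2_sections" if "e \<in> space \<rho>" for n e using S[of n] that by blast
  have sS: "Bochner_Integration.simple_bochner_integrable \<rho> (s n) \<and> s n ` space \<rho> \<subseteq> M2_space P F T" for n
  proof
    show "Bochner_Integration.simple_bochner_integrable \<rho> (s n)"
      using simple_bochner_integrable_compose2[of "\<lambda>f g. J f" \<rho> "S n" "S n"] S[of n] by (simp add: J_def s_def[abs_def])
    show "s n ` space \<rho> \<subseteq> M2_space P F T" using SL J_M2 by (auto simp: s_def)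
  qed
  \<comment> \<open>The exceptional set comes from \<open>Xe e\<close> alone, so one null set serves
    all \<open>n\<close>.\<close>
  have diff: "AE e in \<rho>. \<forall>n. M2_enorm P T (process (Xe e) - s n e) \<le> 2 * a n e"
    using AE_L2w AE_space
  proof eventually_elim
    fix e assume Xe: "Xe e \<in> L2w" and e: "e \<in> space \<rho>"
    have "M2_enorm P T (process (Xe e) - s n e) \<le> 2 * W (Xe e - cur (S n e))" for n
      unfolding s_def
      by (rule M2_enorm_diff_le[OF process_M2 process_AE _ J_M2 J_AE])
        (use Xe SL[OF e] T in \<open>auto simp: Lambda2w_iff\<close>)
    moreover have "W (Xe e - cur (S n e)) = a n e" for n
    proof -
      have "cur (S n e) \<in> L2w" using SL[OF e, of n] by (simp add: Lambda2w_iff)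
      note D = W_eq[OF L2w_diff[OF Xe this]]
      have "unc (Xe e - cur (S n e)) = (\<lambda>x. XX (x, e) - S n e x)"
        by (simp add: fun_eq_iff unc_def XX_def cur_def fun_diff_def)
      then show ?thesis unfolding D by (simp only: a_def)
    qed
    ultimately show "\<forall>n. M2_enorm P T (process (Xe e) - s n e) \<le> 2 * a n e" by simp
  qed
  have double: "(\<lambda>n. 2 * b n) \<longlonglongrightarrow> 0" if "b \<longlonglongrightarrow> 0" for b :: "nat \<Rightarrow> ennreal"
    using tendsto_add[OF that that] by (simp add: mult_2)
  show ?thesis
    unfolding has_bochner_integral_in_def
  proof (intro conjI exI[of _ s] allI)
    show "AE e in \<rho>. process (Xe e) \<in> M2_space P F T" using AE_L2w by eventually_elim (rule process_M2)
    show "process XI \<in> M2_space P F T" by (rule process_M2[OF XI_L2w])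
    show "AE e in \<rho>. (\<lambda>n. M2_enorm P T (process (Xe e) - s n e)) \<longlonglongrightarrow> 0"
      using diff a_lim
    proof eventually_elim
      fix e assume *: "\<forall>n. M2_enorm P T (process (Xe e) - s n e) \<le> 2 * a n e" "(\<lambda>n. a n e) \<longlonglongrightarrow> 0"
      show "(\<lambda>n. M2_enorm P T (process (Xe e) - s n e)) \<longlonglongrightarrow> 0"
        by (rule tendsto_sandwich[OF _ _ tendsto_const double[OF *(2)]]) (use *(1) in auto)
    qed
    show "(\<lambda>n. \<integral>\<^sup>+e. M2_enorm P T (process (Xe e) - s n e) \<partial>\<rho>) \<longlonglongrightarrow> 0"
    proof (rule tendsto_sandwich[OF _ _ tendsto_const double[OF half]])
      have "(\<integral>\<^sup>+e. M2_enorm P T (process (Xe e) - s n e) \<partial>\<rho>) \<le> 2 * ennreal ((1/2)^n)" for n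
      proof -
        have "(\<integral>\<^sup>+e. M2_enorm P T (process (Xe e) - s n e) \<partial>\<rho>) \<le> (\<integral>\<^sup>+e. 2 * a n e \<partial>\<rho>)"
          using diff by (intro nn_integral_mono_AE) auto
        also have "\<dots> = 2 * (\<integral>\<^sup>+e. a n e \<partial>\<rho>)" by (rule nn_integral_cmult) simp
        also have "\<dots> \<le> 2 * ennreal ((1/2)^n)" by (intro mult_left_mono an) simp
        finally show ?thesis .
      qed
      then show "\<forall>\<^sub>F n in sequentially. (\<integral>\<^sup>+e. M2_enorm P T (process (Xe e) - s n e) \<partial>\<rho>) \<le> 2 * ennreal ((1/2)^n)"
        by simp
    qed simp
    show "(\<lambda>n. M2_enorm P T (Bochner_Integration.simple_bochner_integral \<rho> (s n) - process XI)) \<longlonglongrightarrow> 0"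
    proof (rule tendsto_sandwich[OF _ _ tendsto_const double[OF half]])
      have "M2_enorm P T (Bochner_Integration.simple_bochner_integral \<rho> (s n) - process XI) \<le> 2 * ennreal ((1/2)^n)" for n
      proof -
        let ?c = "\<lambda>Y. measure \<rho> {e \<in> space \<rho>. S n e = Y}"
        let ?Y = "\<Sum>Y\<in>S n ` space \<rho>. ?c Y *\<^sub>R Y"
        have sf: "simple_function \<rho> (S n)" using S[of n] by (auto elim: simple_bochner_integrable.cases)
        have "finite (S n ` space \<rho>)" using sf by (rule simple_functionD)
        moreover have "S n ` space \<rho> \<subseteq> L2_sections" using S[of n] by blast
        ultimately have C: "?Y \<in> L2_sections" "(\<Sum>Y\<in>S n ` space \<rho>. ?c Y *\<^sub>R J Y) \<in> M2_space P F T"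
          "\<And>t. t \<in> {0..T} \<Longrightarrow> AE \<omega> in P. (\<Sum>Y\<in>S n ` space \<rho>. ?c Y *\<^sub>R J Y) t \<omega> = I (cut t (cur ?Y)) \<omega>"
          using J_sum[of "S n ` space \<rho>" ?c] by auto
        \<comment> \<open>The sum runs over the values of \<open>S n\<close> rather than of
          \<open>s n\<close>: \<open>J\<close> may send different sections to the same process, and
          in this form the sum matches \<open>int_S\<close> term by term.\<close>
        have int_s: "Bochner_Integration.simple_bochner_integral \<rho> (s n) = (\<Sum>Y\<in>S n ` space \<rho>. ?c Y *\<^sub>R J Y)"
          by (rule simple_bochner_integral_partition[OF conjunct1[OF sS] sf]) (auto simp: s_def)
        have int_S: "Bochner_Integration.simple_bochner_integral \<rho> (S n) = ?Y" by (rule simple_bochner_integral_def)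
        have M: "M2_enorm P T (Bochner_Integration.simple_bochner_integral \<rho> (s n) - process XI) \<le> 2 * W (cur ?Y - XI)"
          unfolding int_s
          by (rule M2_enorm_diff_le[OF C(2) C(3)[OF T] _ process_M2[OF XI_L2w] process_AE[OF XI_L2w T] XI_L2w])
            (use C(1) in \<open>simp add: Lambda2w_iff\<close>)
        have "W (cur ?Y - XI) = fnorm (\<lambda>x. ?Y x - (\<integral>e. XX (x, e) \<partial>\<rho>))"
        proof -
          have "cur ?Y - XI \<in> L2w" using C(1) XI_L2w by (intro L2w_diff) (simp_all add: Lambda2w_iff)
          moreover have "unc (cur ?Y - XI) = (\<lambda>x. ?Y x - (\<integral>e. XX (x, e) \<partial>\<rho>))"
            by (simp add: fun_eq_iff unc_def cur_def fun_diff_def XI_def XX_def)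
          ultimately show ?thesis by (simp only: W_eq)
        qed
        also have "\<dots> \<le> pair_norm (\<lambda>z. XX z - S n (snd z) (fst z))"
          using fnorm_simple_integral_diff[OF XX_section XX_norm S[of n]] by (simp only: int_S)
        also have "\<dots> \<le> ennreal ((1/2)^n)" using Sn[of n] by simp
        finally have w: "W (cur ?Y - XI) \<le> ennreal ((1/2)^n)" .
        show ?thesis by (rule order_trans[OF M mult_left_mono[OF w]]) simp
      qed
      then show "\<forall>\<^sub>F n in sequentially. M2_enorm P T (Bochner_Integration.simple_bochner_integral \<rho> (s n) - process XI) \<le> 2 * ennreal ((1/2)^n)"
        by simp
    qed simp
  qed (use sS in auto)
qed

text \<open>Uniqueness of Bochner integrals in L2 yields equality at each \<open>t\<close> with an
  exceptional set depending on \<open>t\<close>, the most one can say for unrelated representatives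
  \<open>Z t\<close>. If their paths are cadlag, equality on the countable set of grid points
  outside one null set extends to all times.\<close>

lemma process_XI_AE_eq:
  assumes Z: "\<And>t. t \<in> {0..T} \<Longrightarrow> has_bochner_integral_in (L2_space P) (L2_enorm P) \<rho> (\<lambda>e. process (Xe e) t) (Z t)"
  shows "\<And>t. t \<in> {0..T} \<Longrightarrow> AE \<omega> in P. process XI t \<omega> = Z t \<omega>"
    and "(\<And>\<omega>. \<omega> \<in> space P \<Longrightarrow> cadlag_on {0..T} (\<lambda>t. Z t \<omega>)) \<Longrightarrow>
      AE \<omega> in P. \<forall>t\<in>{0..T}. process XI t \<omega> = Z t \<omega>"
proof -
  show ae: "AE \<omega> in P. process XI t \<omega> = Z t \<omega>" if t: "t \<in> {0..T}" for t
    by (rule has_bochner_integral_L2_unique[OF has_bochner_integral_M2_eval[OF process_has_bochner_integral t] Z[OF t]])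
  assume c: "\<And>\<omega>. \<omega> \<in> space P \<Longrightarrow> cadlag_on {0..T} (\<lambda>t. Z t \<omega>)"
  have cI: "cadlag_on {0..T} (\<lambda>t. process XI t \<omega>)" if "\<omega> \<in> space P" for \<omega>
    using process_M2[OF XI_L2w] that by (simp add: M2_space_def)
  have "AE \<omega> in P. \<forall>n k. k \<le> Suc n \<longrightarrow> process XI (real k * T / real (Suc n)) \<omega> = Z (real k * T / real (Suc n)) \<omega>"
    unfolding AE_all_countable
  proof (intro allI)
    fix n k
    show "AE \<omega> in P. k \<le> Suc n \<longrightarrow> process XI (real k * T / real (Suc n)) \<omega> = Z (real k * T / real (Suc n)) \<omega>"
      using ae[OF grid_point_mem[OF _ T_pos, of k n]] by (cases "k \<le> Suc n") auto
  qed
  then show "AE \<omega> in P. \<forall>t\<in>{0..T}. process XI t \<omega> = Z t \<omega>"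
    using AE_space
  proof eventually_elim
    fix \<omega> assume eq: "\<forall>n k. k \<le> Suc n \<longrightarrow> process XI (real k * T / real (Suc n)) \<omega> = Z (real k * T / real (Suc n)) \<omega>"
      and \<omega>: "\<omega> \<in> space P"
    show "\<forall>t\<in>{0..T}. process XI t \<omega> = Z t \<omega>"
    proof
      fix t assume t: "t \<in> {0..T}"
      show "process XI t \<omega> = Z t \<omega>"
        by (rule cadlag_on_eq_if_eq_on_grid[OF cI[OF \<omega>] c[OF \<omega>] T_pos _ t]) (use eq in blast)
    qed
  qed
qed

end

theorem theorem4p25:
  fixes P :: "'w measure" and F :: "real \<Rightarrow> 'w measure"
    and \<R> :: "'u::topological_space set set"
    and M :: "real \<Rightarrow> 'u set \<Rightarrow> 'f::locally_convex_space \<Rightarrow> 'w \<Rightarrow> real"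
    and \<mu> :: "'u measure" and \<Lambda> :: "real measure"
    and q :: "real \<Rightarrow> 'u \<Rightarrow> 'f \<Rightarrow> real"
    and \<iota> :: "real \<Rightarrow> 'u \<Rightarrow> 'f \<Rightarrow> 'h::{real_inner, banach, second_countable_topology}"
    and I :: "(real \<Rightarrow> 'w \<Rightarrow> 'u \<Rightarrow> 'h) \<Rightarrow> 'w \<Rightarrow> real"
    and \<rho> :: "'e measure" and T :: real
    and X :: "real \<Rightarrow> 'w \<Rightarrow> 'u \<Rightarrow> 'e \<Rightarrow> 'h"
  assumes "nuclear_cylindrical_mvm P F \<R> M \<mu> \<Lambda> q"
    and "\<And>r u. 0 \<le> r \<Longrightarrow> hilbert_completion (q r u) (\<iota> r u)"
    and "\<And>S. 0 < S \<Longrightarrow> \<exists>D. countable D \<and>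
           (\<forall>r\<in>{0..S}. \<forall>u. completion_space (\<iota> r u) \<subseteq> closure (\<iota> r u ` D))"
    and "0 < T"
    and "is_weak_integral P F \<R> M \<mu> \<Lambda> \<iota> T I"
    and "sigma_finite_measure \<rho>"
    and "X \<in> Xi12w P F \<mu> \<Lambda> \<iota> \<rho> T"
  shows
    "((AE ((r, \<omega>), u) in (restrict_space \<Lambda> {0<..T} \<Otimes>\<^sub>M P) \<Otimes>\<^sub>M \<mu>. integrable \<rho> (\<lambda>e. X r \<omega> u e)) \<and>
     (\<lambda>r \<omega> u. \<integral>e. X r \<omega> u e \<partial>\<rho>) \<in> Lambda2w P F \<mu> \<Lambda> \<iota> T)
   \<and>
     (bochner_integrable_in (M2_space P F T) (M2_enorm P T) \<rho>
       (\<lambda>e. weak_integral_process P F T I (\<lambda>r \<omega> u. X r \<omega> u e)) \<and>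
     (\<forall>J. has_bochner_integral_in (M2_space P F T) (M2_enorm P T) \<rho>
         (\<lambda>e. weak_integral_process P F T I (\<lambda>r \<omega> u. X r \<omega> u e)) J \<longrightarrow>
       (\<forall>t\<in>{0..T}. has_bochner_integral_in (L2_space P) (L2_enorm P) \<rho>
         (\<lambda>e. weak_integral_process P F T I (\<lambda>r \<omega> u. X r \<omega> u e) t) (J t))))
   \<and>
     (\<forall>Z. (\<forall>t\<in>{0..T}. has_bochner_integral_in (L2_space P) (L2_enorm P) \<rho>
         (\<lambda>e. weak_integral_process P F T I (\<lambda>r \<omega> u. X r \<omega> u e) t) (Z t)) \<longrightarrow>
       (\<forall>t\<in>{0..T}. AE \<omega> in P.
          weak_integral_process P F T I (\<lambda>r \<omega> u. \<integral>e. X r \<omega> u e \<partial>\<rho>) t \<omega> = Z t \<omega>) \<and>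
       ((\<forall>\<omega>\<in>space P. cadlag_on {0..T} (\<lambda>t. Z t \<omega>)) \<longrightarrow>
        (AE \<omega> in P. \<forall>t\<in>{0..T}.
          weak_integral_process P F T I (\<lambda>r \<omega> u. \<integral>e. X r \<omega> u e \<partial>\<rho>) t \<omega> = Z t \<omega>)))"
proof -
  obtain D where D: "countable D" "\<And>r u. r \<in> {0..T} \<Longrightarrow> completion_space (\<iota> r u) \<subseteq> closure (\<iota> r u ` D)"
    using assms(3)[OF assms(4)] by blast
  \<comment> \<open>Index 0 is reserved for the zero vector, as \<open>hilbert_field\<close>
    demands; the later indices enumerate the dense set.\<close>
  define d where "d n = (case n of 0 \<Rightarrow> 0 | Suc m \<Rightarrow> from_nat_into (insert 0 D) m)" for n :: nat
  have "D \<subseteq> range d"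
  proof
    fix x assume "x \<in> D"
    then obtain m where "from_nat_into (insert 0 D) m = x"
      using from_nat_into_surj[of "insert 0 D" x] D(1) by auto
    then have "d (Suc m) = x" by (simp add: d_def)
    then show "x \<in> range d" by blast
  qed
  have dense: "completion_space (\<iota> r u) \<subseteq> closure (range (\<lambda>i. \<iota> r u (d i)))" if "r \<in> {0..T}" for r u
  proof -
    have "\<iota> r u ` D \<subseteq> range (\<lambda>i. \<iota> r u (d i))" using \<open>D \<subseteq> range d\<close> by blast
    from order_trans[OF D(2)[OF that] closure_mono[OF this]] show ?thesis .
  qed
  interpret stochastic_fubini P F \<R> M \<mu> \<Lambda> q \<iota> T d I \<rho> X
  proof (intro stochastic_fubini.intro weak_integral.intro weak_integrands.intro
      weak_integrands_axioms.intro weak_integral_axioms.intro stochastic_fubini_axioms.intro)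
    show "d 0 = 0" by (simp add: d_def)
  qed (fact assms dense)+
  show ?thesis
    unfolding XI_def[symmetric]
  proof (intro conjI allI impI ballI)
    show "AE ((r, \<omega>), u) in (restrict_space \<Lambda> {0<..T} \<Otimes>\<^sub>M P) \<Otimes>\<^sub>M \<mu>. integrable \<rho> (\<lambda>e. X r \<omega> u e)"
      by (rule AE_integrable)
    show "XI \<in> L2w" by (rule XI_L2w)
    show "bochner_integrable_in (M2_space P F T) (M2_enorm P T) \<rho> (\<lambda>e. process (Xe e))"
      unfolding bochner_integrable_in_def by (intro exI[of _ "process XI"] process_has_bochner_integral)
  next
    fix Y t assume "has_bochner_integral_in (M2_space P F T) (M2_enorm P T) \<rho> (\<lambda>e. process (Xe e)) Y" "t \<in> {0..T}"
    then show "has_bochner_integral_in (L2_space P) (L2_enorm P) \<rho> (\<lambda>e. process (Xe e) t) (Y t)"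
      by (rule has_bochner_integral_M2_eval)
  next
    fix Z t assume "\<forall>t\<in>{0..T}. has_bochner_integral_in (L2_space P) (L2_enorm P) \<rho> (\<lambda>e. process (Xe e) t) (Z t)"
      and t: "t \<in> {0..T}"
    from process_XI_AE_eq(1)[OF bspec[OF this(1)] t] show "AE \<omega> in P. process XI t \<omega> = Z t \<omega>" .
  next
    fix Z assume Z: "\<forall>t\<in>{0..T}. has_bochner_integral_in (L2_space P) (L2_enorm P) \<rho> (\<lambda>e. process (Xe e) t) (Z t)"
      and c: "\<forall>\<omega>\<in>space P. cadlag_on {0..T} (\<lambda>t. Z t \<omega>)"
    from process_XI_AE_eq(2)[OF bspec[OF Z] bspec[OF c]]
    show "AE \<omega> in P. \<forall>t\<in>{0..T}. process XI t \<omega> = Z t \<omega>" .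
  qed
qed

end
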